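(* Let $m$ be an integer with $m>0$ and $m\neq 3$, and suppose that $m^2+16$ is not divisible by an odd square (i.e. by the square of any odd integer greater than $1$). Let $\mathbb{K}_m$ be the simplest quartic field generated over $\mathbb{Q}$ by a root of $P_m(x)=x^4-mx^3-6x^2+mx+1$. Then $$I(\mathbb{K}_m)=\begin{cases}2&\text{if } m\text{ is odd},\\ 1&\text{if } m\text{ is even},\end{cases}$$ and $$i(\mathbb{K}_m)=\begin{cases}1&\text{if } 1\le v_2(m)\le 3,\\ 4&\text{otherwise.}\end{cases}$$
   Context: Here $v_2$ is the $2$-adic valuation. For a number field $\mathbb{K}$ of degree $n$ over $\mathbb{Q}$ with ring of integers $\mathbb{A}$, let $\widehat{\mathbb{A}}$ be the set of $\theta\in\mathbb{A}$ that are primitive over $\mathbb{Q}$, i.e. $\mathbb{K}=\mathbb{Q}(\theta)$. For $\theta\in\widehat{\mathbb{A}}$ let $I(\theta)=[\mathbb{A}:\mathbb{Z}[\theta]]$ and define $I(\mathbb{K})=\gcd_{\theta\in\widehat{\mathbb{A}}} I(\theta)$. For $\theta\in\mathbb{A}$ let $F_\theta(x)\in\mathbb{Z}[x]$ be the (degree $n$) characteristic polynomial of $\theta$ over $\mathbb{Q}$ and set $i(\theta)=\gcd_{x\in\mathbb{Z}}F_\theta(x)$. Define $i(\mathbb{K})=\operatorname{lcm}_{\theta\in\widehat{\mathbb{A}}}\, i(\theta)$. *)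

theory Defs
  imports
    Complex_Main
    "HOL-Algebra.Generated_Fields"
    "HOL-Algebra.Algebraic_Closure_Type"
    "Jordan_Normal_Form.Char_Poly"
begin

text \<open>
  Number fields are taken to be subfields \<open>K\<close> of the complex numbers, given by their carrier sets;
  the complex field is viewed as a ring record, so that generated subrings and subfields and
  additive cosets are the notions of HOL-Algebra.
\<close>

abbreviation complex_ring :: "complex ring"
  where "complex_ring \<equiv> ring_of_type_algebra"

text \<open>Every subfield of the complex numbers contains the rationals, so this is \<open>\<rat>(\<theta>)\<close>.\<close>

definition rat_adjoin :: "complex \<Rightarrow> complex set"
  where "rat_adjoin \<theta> = generate_field complex_ring {\<theta>}"

definition int_adjoin :: "complex \<Rightarrow> complex set"
  where "int_adjoin \<theta> = generate_ring complex_ring {\<theta>}"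

definition ring_of_integers :: "complex set \<Rightarrow> complex set"
  where "ring_of_integers K = {x \<in> K. algebraic_int x}"

definition primitive_integers :: "complex set \<Rightarrow> complex set"
  where "primitive_integers K = {\<theta> \<in> ring_of_integers K. rat_adjoin \<theta> = K}"


subsection \<open>The index of a number field\<close>

definition element_index :: "complex set \<Rightarrow> complex \<Rightarrow> nat"
  where "element_index K \<theta> =
    card (a_rcosets\<^bsub>complex_ring\<lparr>carrier := ring_of_integers K\<rparr>\<^esub> (int_adjoin \<theta>))"

definition field_index :: "complex set \<Rightarrow> nat"
  where "field_index K = Gcd (element_index K ` primitive_integers K)"


subsection \<open>Characteristic polynomials over the rationals\<close>

global_interpretation rat_complex: vector_space "\<lambda>(q::rat) (z::complex). of_rat q * z"
  by unfold_locales (simp_all add: of_rat_add of_rat_mult algebra_simps)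

definition is_rat_basis :: "complex set \<Rightarrow> complex list \<Rightarrow> bool"
  where "is_rat_basis K bs \<longleftrightarrow>
    distinct bs \<and> rat_complex.independent (set bs) \<and> rat_complex.span (set bs) = K"

text \<open>
  Column \<open>j\<close> holds the coordinates of \<open>\<theta> * bs ! j\<close>: this is the matrix of multiplication by \<open>\<theta>\<close>
  with respect to the basis \<open>bs\<close>.
\<close>

definition mult_matrix :: "complex list \<Rightarrow> complex \<Rightarrow> rat mat"
  where "mult_matrix bs \<theta> = mat (length bs) (length bs)
    (\<lambda>(i, j). rat_complex.representation (set bs) (\<theta> * bs ! j) (bs ! i))"

text \<open>
  The characteristic polynomial of \<open>\<theta>\<close> as an element of the field \<open>K\<close>, of degree \<open>[K : \<rat>]\<close>.
  It does not depend on the basis, so an arbitrary one is chosen.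
\<close>

definition field_char_poly :: "complex set \<Rightarrow> complex \<Rightarrow> rat poly"
  where "field_char_poly K \<theta> = char_poly (mult_matrix (SOME bs. is_rat_basis K bs) \<theta>)"

text \<open>Meaningful for \<open>\<theta>\<close> in the ring of integers of \<open>K\<close>, where the coefficients are integers.\<close>

definition int_field_char_poly :: "complex set \<Rightarrow> complex \<Rightarrow> int poly"
  where "int_field_char_poly K \<theta> = (THE F. map_poly of_int F = field_char_poly K \<theta>)"

definition element_value_gcd :: "complex set \<Rightarrow> complex \<Rightarrow> int"
  where "element_value_gcd K \<theta> = Gcd (range (poly (int_field_char_poly K \<theta>)))"

definition field_value_lcm :: "complex set \<Rightarrow> int"
  where "field_value_lcm K = Lcm (element_value_gcd K ` primitive_integers K)"


subsection \<open>Simplest quartic fields\<close>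

text \<open>The polynomial \<open>x^4 - m x^3 - 6 x^2 + m x + 1\<close>.\<close>

definition simplest_quartic_poly :: "int \<Rightarrow> int poly"
  where "simplest_quartic_poly m = [:1, m, -6, -m, 1:]"

end

theory Submission
  imports Defs "HOL-Algebra.Sylow"
begin

text \<open>
  Put \<open>t = \<alpha> - 1/\<alpha>\<close> and \<open>g = \<alpha> + 1/\<alpha>\<close>. Then \<open>t\<^sup>2 = m t + 4\<close>, so \<open>s = 2t - m\<close> is a square root of
  \<open>M = m\<^sup>2 + 16\<close>, and together with a conjugate \<open>h\<close> of \<open>g\<close> one gets a rational basis \<open>1, s, g, h\<close> of the
  field with a simple multiplication table; the automorphism \<open>s \<mapsto> -s\<close>, \<open>g \<mapsto> h\<close>, \<open>h \<mapsto> -g\<close> generates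
  the Galois group. Integrality of traces and norms down to \<open>\<rat>(s)\<close> and to \<open>\<rat>\<close> shows that the ring of
  integers \<open>A\<close> is an explicit lattice, depending on \<open>m\<close> modulo 8: an element of \<open>A\<close> that a prime
  \<open>p\<close> multiplies into the lattice already lies in it. For odd \<open>p\<close> this uses that \<open>p\<^sup>2\<close> does not divide \<open>M\<close>.

  An element is primitive iff its \<open>g\<close>- or \<open>h\<close>-coordinate is nonzero; its four conjugates are then
  distinct, so that \<open>F\<^sub>\<theta>(x)\<close> is the norm of \<open>x - \<theta>\<close>. The fourth difference of a monic quartic is 24,
  hence \<open>i(\<theta>)\<close> divides 24, and the rest is a study of the norm form modulo 3 and modulo 8.

  The index of \<open>\<alpha>\<close> is a power of 2. For even \<open>m\<close> another element has odd index. For odd \<open>m\<close>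
  every element satisfies a monic equation of degree at most 3 modulo \<open>2A\<close>, which makes all indices
  even, while \<open>\<alpha>\<close> has index 2.
\<close>

text \<open>Both answers follow from how 2 decomposes in the field. For odd m there are two primes
  over 2, each with a residue field of 4 elements. There is only one irreducible quadratic
  polynomial modulo 2, so Z[theta] never maps onto A / 2A and every index is even; an element that
  is 0 modulo one prime and 1 modulo the other has all values of its characteristic polynomial
  divisible by 4. If 16 divides m, there are two ramified primes with residue field of 2 elements:
  indices can be odd, but a theta divisible by the square of one prime, with theta - 1 divisible by
  the square of the other, again gives 4. In the remaining cases one prime lies over 2, it cannot
  contain both theta and theta - 1, and i(theta) is odd. All this is carried out with explicit norm
  forms and parities instead of ideals. Uniqueness of the four coordinates comes from the norm form
  having no nontrivial zero, which comes down to M not being a square; this is where m = 3, with M =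
  25, is excluded.\<close>

section \<open>Algebraic integers form a ring\<close>

text \<open>The coefficients of theta times \<open>v j\<close> form row j of the matrix, so the
  vector of the \<open>v i\<close> is an eigenvector for theta. This serves both for integrality,
  with integer entries, and for the characteristic polynomial of the field, with rational
  ones.\<close>

lemma poly_char_poly_eq_0:
  fixes c :: "nat \<Rightarrow> nat \<Rightarrow> 'a::field"
  assumes "i0 < n" "v i0 \<noteq> 0"
    and stable: "\<And>j. j < n \<Longrightarrow> \<theta> * v j = (\<Sum>i<n. c j i * v i)"
  shows "poly (char_poly (mat n n (\<lambda>(i, j). c i j))) \<theta> = 0"
proof -
  let ?B = "mat n n (\<lambda>(i, j). c i j)" and ?v = "vec n v"
  have "?B *\<^sub>v ?v = \<theta> \<cdot>\<^sub>v ?v"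
    by (rule eq_vecI) (auto simp: scalar_prod_def stable atLeast0LessThan)
  moreover have "?v \<noteq> 0\<^sub>v n"
    using assms(1,2) by (metis index_vec index_zero_vec(1))
  ultimately have "eigenvalue ?B \<theta>"
    unfolding eigenvalue_def eigenvector_def by (intro exI[of _ ?v]) auto
  then show ?thesis
    by (subst (asm) eigenvalue_root_char_poly[of _ n]) auto
qed

lemma sum_set_conv_nth: "distinct xs \<Longrightarrow> (\<Sum>x\<in>set xs. f x) = (\<Sum>i<length xs. f (xs ! i))"
  by (rule sum.reindex_bij_betw[symmetric, of "\<lambda>i. xs ! i"]) (simp add: bij_betw_nth)

interpretation int_complex: Modules.module "\<lambda>(k::int) (z::complex). of_int k * z"
  by unfold_locales (simp_all add: algebra_simps)

text \<open>The determinant trick: theta is an eigenvalue of an integer matrix, whose characteristic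
  polynomial is monic. The nonzero \<open>v0\<close> makes the eigenvector nonzero.\<close>

lemma algebraic_int_if_span_stable:
  assumes "finite V" "v0 \<in> V" "v0 \<noteq> 0"
    and stable: "\<And>v. v \<in> V \<Longrightarrow> \<theta> * v \<in> int_complex.span V"
  shows "algebraic_int \<theta>"
proof -
  obtain xs where xs: "set xs = V" "distinct xs"
    using finite_distinct_list[OF \<open>finite V\<close>] by blast
  have "\<exists>u. \<theta> * v = (\<Sum>w\<in>V. of_int (u w) * w)" if "v \<in> V" for v
    using stable[OF that] by (auto simp: int_complex.span_finite[OF \<open>finite V\<close>])
  then obtain u where u: "\<And>v. v \<in> V \<Longrightarrow> \<theta> * v = (\<Sum>w\<in>V. of_int (u v w) * w)"
    by metis
  define n where "n = length xs"
  define A where "A = mat n n (\<lambda>(i, j). u (xs ! i) (xs ! j))"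
  have A: "A \<in> carrier_mat n n" by (simp add: A_def)
  obtain i0 where i0: "i0 < n" "xs ! i0 = v0"
    using assms(2) xs by (metis in_set_conv_nth n_def)
  have 0: "poly (char_poly (mat n n (\<lambda>(i, j). of_int (u (xs ! i) (xs ! j))))) \<theta> = 0"
  proof (rule poly_char_poly_eq_0[where v = "\<lambda>i. xs ! i"])
    show "i0 < n" "xs ! i0 \<noteq> 0" using i0 assms by auto
    fix j assume "j < n"
    then have "xs ! j \<in> V" using xs by (auto simp: n_def)
    from u[OF this] show "\<theta> * xs ! j = (\<Sum>i<n. of_int (u (xs ! j) (xs ! i)) * xs ! i)"
      unfolding xs(1)[symmetric] sum_set_conv_nth[OF xs(2)] n_def .
  qed
  have eq: "mat n n (\<lambda>(i, j). of_int (u (xs ! i) (xs ! j))) = (map_mat of_int A :: complex mat)"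
    by (rule eq_matI) (auto simp: A_def)
  have "poly (map_poly of_int (char_poly A)) \<theta> = 0"
    using 0 unfolding eq of_int_hom.char_poly_hom[OF A] .
  then show ?thesis
    using degree_monic_char_poly[OF A] unfolding algebraic_int_altdef_ipoly by auto
qed

text \<open>The module is Z[x, y], spanned by the monomials with exponents below the degrees of the
  two monic equations; a monomial that leaves this range is rewritten with one of them. Sums and
  products of x and y then stabilise the same module.\<close>

lemma algebraic_int_stable_module:
  assumes "algebraic_int x" "algebraic_int y"
  obtains V :: "complex set" where "finite V" "1 \<in> V"
    "\<And>v. v \<in> int_complex.span V \<Longrightarrow> x * v \<in> int_complex.span V"
    "\<And>v. v \<in> int_complex.span V \<Longrightarrow> y * v \<in> int_complex.span V"
proof -
  have red: "\<exists>n>0. \<exists>c. z ^ n = (\<Sum>i<n. of_int (c i) * z ^ i)" if z: "algebraic_int z" for z :: complex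
  proof -
    obtain p where p: "poly (map_poly of_int p) z = 0" "lead_coeff p = (1::int)"
      using z unfolding algebraic_int_altdef_ipoly by blast
    define n where "n = degree p"
    \<comment> \<open>A monic constant is 1 and has no root. Positive degrees are what puts the
      monomial 1 into the spanning set.\<close>
    have "n > 0"
    proof (rule ccontr)
      assume "\<not> n > 0"
      then obtain k where "p = [:k:]" unfolding n_def by (metis degree_eq_zeroE gr0I)
      with p show False by simp
    qed
    have "0 = (\<Sum>i\<le>n. of_int (coeff p i) * z ^ i)"
      using p(1) by (simp add: poly_altdef n_def coeff_map_poly degree_map_poly)
    also have "\<dots> = (\<Sum>i<n. of_int (coeff p i) * z ^ i) + z ^ n"
      using p(2) by (simp add: n_def flip: lessThan_Suc_atMost)
    finally have "z ^ n = - (\<Sum>i<n. of_int (coeff p i) * z ^ i)"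
      by (metis add_eq_0_iff)
    then have "z ^ n = (\<Sum>i<n. of_int (- coeff p i) * z ^ i)"
      by (simp add: sum_negf)
    with \<open>n > 0\<close> show ?thesis
      by (intro exI[of _ n] conjI exI[of _ "\<lambda>i. - coeff p i"])
  qed
  obtain p c where p: "p > 0" "x ^ p = (\<Sum>i<p. of_int (c i) * x ^ i)"
    using red[OF assms(1)] by blast
  obtain q d where q: "q > 0" "y ^ q = (\<Sum>i<q. of_int (d i) * y ^ i)"
    using red[OF assms(2)] by blast
  define V where "V = (\<lambda>(i, j). x ^ i * y ^ j) ` ({..<p} \<times> {..<q})"
  have mem: "x ^ i * y ^ j \<in> int_complex.span V" if "i < p" "j < q" for i j
    using that by (intro int_complex.span_base) (auto simp: V_def)
  have lift: "z * v \<in> int_complex.span V"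
    if "\<And>v. v \<in> V \<Longrightarrow> z * v \<in> int_complex.span V" and "v \<in> int_complex.span V" for z v
    using that(2)
  proof (induct rule: int_complex.span_induct_alt)
    case (step k w v)
    have "z * (of_int k * w + v) = of_int k * (z * w) + z * v"
      by (simp add: algebra_simps)
    then show ?case
      using step that(1) by (metis int_complex.span_add int_complex.span_scale)
  qed (simp add: int_complex.span_zero)
  show thesis
  proof
    show "finite V" by (simp add: V_def)
    show "1 \<in> V" unfolding V_def using p(1) q(1)
      by (auto intro!: image_eqI[of _ _ "(0, 0)"])
    fix v assume v: "v \<in> int_complex.span V"
    show "x * v \<in> int_complex.span V"
    proof (rule lift[OF _ v])
      fix w assume "w \<in> V"
      then obtain i j where w: "w = x ^ i * y ^ j" "i < p" "j < q" by (auto simp: V_def)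
      show "x * w \<in> int_complex.span V"
      proof (cases "Suc i < p")
        case True
        then show ?thesis using mem[of "Suc i" j] w by (simp add: mult.assoc)
      next
        case False
        then have "Suc i = p" using w by simp
        then have "x * w = x ^ p * y ^ j" using w by auto
        also have "\<dots> = (\<Sum>i<p. of_int (c i) * (x ^ i * y ^ j))"
          by (simp add: p(2) sum_distrib_right mult.assoc)
        also have "\<dots> \<in> int_complex.span V"
          using w by (auto intro!: int_complex.span_sum int_complex.span_scale mem)
        finally show ?thesis .
      qed
    qed
    show "y * v \<in> int_complex.span V"
    proof (rule lift[OF _ v])
      fix w assume "w \<in> V"
      then obtain i j where w: "w = x ^ i * y ^ j" "i < p" "j < q" by (auto simp: V_def)
      show "y * w \<in> int_complex.span V"
      proof (cases "Suc j < q")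
        case True
        then show ?thesis using mem[of i "Suc j"] w by (simp add: mult.left_commute)
      next
        case False
        then have "Suc j = q" using w by simp
        then have "y * w = x ^ i * y ^ q" using w by auto
        also have "\<dots> = (\<Sum>j<q. of_int (d j) * (x ^ i * y ^ j))"
          by (simp add: q(2) sum_distrib_left mult_ac)
        also have "\<dots> \<in> int_complex.span V"
          using w by (auto intro!: int_complex.span_sum int_complex.span_scale mem)
        finally show ?thesis .
      qed
    qed
  qed
qed

lemma algebraic_int_add:
  fixes x y :: complex
  assumes "algebraic_int x" "algebraic_int y"
  shows "algebraic_int (x + y)"
proof -
  obtain V where V: "finite V" "1 \<in> V"
    "\<And>v. v \<in> int_complex.span V \<Longrightarrow> x * v \<in> int_complex.span V"
    "\<And>v. v \<in> int_complex.span V \<Longrightarrow> y * v \<in> int_complex.span V"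
    by (rule algebraic_int_stable_module[OF assms]) (rule that)
  show ?thesis
  proof (rule algebraic_int_if_span_stable[OF V(1,2)])
    fix v assume "v \<in> V"
    then have "v \<in> int_complex.span V" by (rule int_complex.span_base)
    then show "(x + y) * v \<in> int_complex.span V"
      unfolding distrib_right by (intro int_complex.span_add V)
  qed simp
qed

lemma algebraic_int_mult:
  fixes x y :: complex
  assumes "algebraic_int x" "algebraic_int y"
  shows "algebraic_int (x * y)"
proof -
  obtain V where V: "finite V" "1 \<in> V"
    "\<And>v. v \<in> int_complex.span V \<Longrightarrow> x * v \<in> int_complex.span V"
    "\<And>v. v \<in> int_complex.span V \<Longrightarrow> y * v \<in> int_complex.span V"
    by (rule algebraic_int_stable_module[OF assms]) (rule that)
  show ?thesis
  proof (rule algebraic_int_if_span_stable[OF V(1,2)])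
    fix v assume "v \<in> V"
    then have "v \<in> int_complex.span V" by (rule int_complex.span_base)
    then show "(x * y) * v \<in> int_complex.span V"
      unfolding mult.assoc by (intro V)
  qed simp
qed

lemma algebraic_int_diff:
  fixes x y :: complex
  assumes "algebraic_int x" "algebraic_int y"
  shows "algebraic_int (x - y)"
  using algebraic_int_add[OF assms(1) algebraic_int_minus[OF assms(2)]] by simp

section \<open>Generated subrings and subfields of the complex numbers\<close>

lemma complex_ring_simps [simp]:
  "carrier complex_ring = UNIV" "\<one>\<^bsub>complex_ring\<^esub> = 1" "\<zero>\<^bsub>complex_ring\<^esub> = 0"
  "ring.add complex_ring = (+)" "monoid.mult complex_ring = (*)"
  by (simp_all add: ring_of_type_algebra_def)

lemma complex_ring_a_inv [simp]: "\<ominus>\<^bsub>complex_ring\<^esub> x = - x"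
proof -
  interpret ring "complex_ring" by (rule ring_from_type_algebra)
  show ?thesis using minus_equality[of "- x" x] by simp
qed

lemma complex_ring_m_inv: "x \<noteq> 0 \<Longrightarrow> inv\<^bsub>complex_ring\<^esub> x = inverse x"
proof -
  interpret cring "complex_ring" by (rule cring_from_type_algebra)
  show "x \<noteq> 0 \<Longrightarrow> inv\<^bsub>complex_ring\<^esub> x = inverse x"
    using inv_unique'[of x "inverse x"] by simp
qed

lemma int_adjoin_closed:
  shows int_adjoin_self: "\<theta> \<in> int_adjoin \<theta>"
    and int_adjoin_1: "1 \<in> int_adjoin \<theta>"
    and int_adjoin_add: "x \<in> int_adjoin \<theta> \<Longrightarrow> y \<in> int_adjoin \<theta> \<Longrightarrow> x + y \<in> int_adjoin \<theta>"
    and int_adjoin_mult: "x \<in> int_adjoin \<theta> \<Longrightarrow> y \<in> int_adjoin \<theta> \<Longrightarrow> x * y \<in> int_adjoin \<theta>"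
    and int_adjoin_minus: "x \<in> int_adjoin \<theta> \<Longrightarrow> - x \<in> int_adjoin \<theta>"
  unfolding int_adjoin_def
  using generate_ring.incl[of \<theta> "{\<theta>}" complex_ring]
    generate_ring.one[of complex_ring "{\<theta>}"]
    generate_ring.eng_add[of x complex_ring "{\<theta>}" y]
    generate_ring.eng_mult[of x complex_ring "{\<theta>}" y]
    generate_ring.a_inv[of x complex_ring "{\<theta>}"]
  by simp_all

lemma int_adjoin_0: "0 \<in> int_adjoin \<theta>"
  using int_adjoin_add[OF int_adjoin_1 int_adjoin_minus[OF int_adjoin_1]] by simp

lemma int_adjoin_diff: "x \<in> int_adjoin \<theta> \<Longrightarrow> y \<in> int_adjoin \<theta> \<Longrightarrow> x - y \<in> int_adjoin \<theta>"
  using int_adjoin_add[OF _ int_adjoin_minus, of x \<theta> y] by simp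

lemma int_adjoin_of_nat: "of_nat k \<in> int_adjoin \<theta>"
  by (induction k) (auto intro: int_adjoin_0 int_adjoin_add int_adjoin_1)

lemma int_adjoin_of_int: "of_int k \<in> int_adjoin \<theta>"
  by (cases k rule: int_cases2) (auto intro: int_adjoin_of_nat int_adjoin_minus)

lemma int_adjoin_numeral: "numeral k \<in> int_adjoin \<theta>"
  using int_adjoin_of_nat[of "numeral k"] by simp

lemma int_adjoin_power: "x \<in> int_adjoin \<theta> \<Longrightarrow> x ^ k \<in> int_adjoin \<theta>"
  by (induction k) (auto intro: int_adjoin_1 int_adjoin_mult)

lemmas int_adjoin_intros = int_adjoin_self int_adjoin_1 int_adjoin_0 int_adjoin_add
  int_adjoin_mult int_adjoin_minus int_adjoin_diff int_adjoin_of_int int_adjoin_of_nat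
  int_adjoin_numeral int_adjoin_power

lemma int_adjoin_induct [consumes 1, case_names one self minus add mult]:
  assumes "x \<in> int_adjoin \<theta>" "P 1" "P \<theta>" "\<And>x. P x \<Longrightarrow> P (- x)"
    "\<And>x y. P x \<Longrightarrow> P y \<Longrightarrow> P (x + y)" "\<And>x y. P x \<Longrightarrow> P y \<Longrightarrow> P (x * y)"
  shows "P x"
  using assms(1) unfolding int_adjoin_def
  by (induction rule: generate_ring.induct) (use assms(2-) in auto)

lemma rat_adjoin_closed:
  shows rat_adjoin_self: "\<theta> \<in> rat_adjoin \<theta>"
    and rat_adjoin_1: "1 \<in> rat_adjoin \<theta>"
    and rat_adjoin_add: "x \<in> rat_adjoin \<theta> \<Longrightarrow> y \<in> rat_adjoin \<theta> \<Longrightarrow> x + y \<in> rat_adjoin \<theta>"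
    and rat_adjoin_mult: "x \<in> rat_adjoin \<theta> \<Longrightarrow> y \<in> rat_adjoin \<theta> \<Longrightarrow> x * y \<in> rat_adjoin \<theta>"
    and rat_adjoin_minus: "x \<in> rat_adjoin \<theta> \<Longrightarrow> - x \<in> rat_adjoin \<theta>"
  unfolding rat_adjoin_def
  using generate_field.incl[of \<theta> "{\<theta>}" complex_ring]
    generate_field.one[of complex_ring "{\<theta>}"]
    generate_field.eng_add[of x complex_ring "{\<theta>}" y]
    generate_field.eng_mult[of x complex_ring "{\<theta>}" y]
    generate_field.a_inv[of x complex_ring "{\<theta>}"]
  by simp_all

lemma rat_adjoin_0: "0 \<in> rat_adjoin \<theta>"
  using rat_adjoin_add[OF rat_adjoin_1 rat_adjoin_minus[OF rat_adjoin_1]] by simp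

lemma rat_adjoin_inverse: "x \<in> rat_adjoin \<theta> \<Longrightarrow> inverse x \<in> rat_adjoin \<theta>"
  using generate_field.m_inv[of x complex_ring "{\<theta>}"] rat_adjoin_0[of \<theta>]
  unfolding rat_adjoin_def by (cases "x = 0") (auto simp: complex_ring_m_inv)

lemma rat_adjoin_diff: "x \<in> rat_adjoin \<theta> \<Longrightarrow> y \<in> rat_adjoin \<theta> \<Longrightarrow> x - y \<in> rat_adjoin \<theta>"
  using rat_adjoin_add[OF _ rat_adjoin_minus, of x \<theta> y] by simp

lemma rat_adjoin_divide: "x \<in> rat_adjoin \<theta> \<Longrightarrow> y \<in> rat_adjoin \<theta> \<Longrightarrow> x / y \<in> rat_adjoin \<theta>"
  using rat_adjoin_mult[OF _ rat_adjoin_inverse, of x \<theta> y] by (simp add: divide_inverse)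

lemma rat_adjoin_of_nat: "of_nat k \<in> rat_adjoin \<theta>"
  by (induction k) (auto intro: rat_adjoin_0 rat_adjoin_add rat_adjoin_1)

lemma rat_adjoin_of_int: "of_int k \<in> rat_adjoin \<theta>"
  by (cases k rule: int_cases2) (auto intro: rat_adjoin_of_nat rat_adjoin_minus)

lemma rat_adjoin_numeral: "numeral k \<in> rat_adjoin \<theta>"
  using rat_adjoin_of_nat[of "numeral k"] by simp

lemma rat_adjoin_of_rat: "of_rat q \<in> rat_adjoin \<theta>"
  by (cases q) (auto simp: of_rat_rat intro: rat_adjoin_of_int rat_adjoin_divide)

lemmas rat_adjoin_intros = rat_adjoin_self rat_adjoin_1 rat_adjoin_0 rat_adjoin_add
  rat_adjoin_mult rat_adjoin_minus rat_adjoin_inverse rat_adjoin_diff rat_adjoin_divide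
  rat_adjoin_of_int rat_adjoin_of_nat rat_adjoin_numeral rat_adjoin_of_rat

lemma rat_adjoin_least:
  assumes "x \<in> rat_adjoin \<theta>" "1 \<in> E" "\<theta> \<in> E" "\<And>x. x \<in> E \<Longrightarrow> - x \<in> E"
    "\<And>x. x \<in> E \<Longrightarrow> x \<noteq> 0 \<Longrightarrow> inverse x \<in> E"
    "\<And>x y. x \<in> E \<Longrightarrow> y \<in> E \<Longrightarrow> x + y \<in> E" "\<And>x y. x \<in> E \<Longrightarrow> y \<in> E \<Longrightarrow> x * y \<in> E"
  shows "x \<in> E"
  using assms(1) unfolding rat_adjoin_def
  by (induction rule: generate_field.induct) (use assms(2-) in \<open>auto simp: complex_ring_m_inv\<close>)


section \<open>Indices of additive subgroups\<close>

text \<open>The index counts cosets in a ring record with carrier A. The locale provides the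
  additive group of that record and its quotient by H, so that divisibility of the index becomes a
  statement about orders of elements of A / H.\<close>

locale additive_subgroup_pair =
  fixes A H :: "complex set"
  assumes zero: "0 \<in> H" and subset: "H \<subseteq> A"
    and A_diff: "x \<in> A \<Longrightarrow> y \<in> A \<Longrightarrow> x - y \<in> A"
    and H_diff: "x \<in> H \<Longrightarrow> y \<in> H \<Longrightarrow> x - y \<in> H"
begin

abbreviation "G \<equiv> add_monoid (complex_ring\<lparr>carrier := A\<rparr>)"

abbreviation "cosets \<equiv> a_rcosets\<^bsub>complex_ring\<lparr>carrier := A\<rparr>\<^esub> H"

lemma A_minus: "x \<in> A \<Longrightarrow> - x \<in> A"
  using A_diff[of 0 x] zero subset by auto

lemma A_add: "x \<in> A \<Longrightarrow> y \<in> A \<Longrightarrow> x + y \<in> A"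
  using A_diff[of x "- y"] A_minus by auto

lemma H_minus: "x \<in> H \<Longrightarrow> - x \<in> H"
  using H_diff[of 0 x] zero by auto

lemma H_add: "x \<in> H \<Longrightarrow> y \<in> H \<Longrightarrow> x + y \<in> H"
  using H_diff[of x "- y"] H_minus by auto

lemma comm_group: "comm_group G"
proof (rule comm_groupI)
  fix x assume "x \<in> carrier G"
  then show "\<exists>y\<in>carrier G. y \<otimes>\<^bsub>G\<^esub> x = \<one>\<^bsub>G\<^esub>"
    using A_minus by (intro bexI[of _ "- x"]) auto
qed (use zero subset in \<open>auto intro: A_add\<close>)

sublocale comm_group G
  by (rule comm_group)

lemma H_inv: "x \<in> A \<Longrightarrow> inv\<^bsub>G\<^esub> x = - x"
  using A_minus inv_unique'[of x "- x"] by simp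

lemma subgroup_H: "subgroup H G"
  using subset zero H_add H_minus by (intro subgroupI) (auto simp: H_inv[simplified] subset_iff)

sublocale normal H G
  by (rule subgroup_imp_normal[OF subgroup_H])

lemma cosets_eq: "cosets = rcosets\<^bsub>G\<^esub> H"
  by (simp add: A_RCOSETS_def)

lemma order_Mod: "Coset.order (G Mod H) = card cosets"
  by (simp add: Coset.order_def FactGroup_def cosets_eq)

lemma coset_eq_self_iff: "x \<in> A \<Longrightarrow> H #>\<^bsub>G\<^esub> x = H \<longleftrightarrow> x \<in> H"
  using coset_join1[of H x] coset_join2[of x H] subgroup_H subset by auto

lemma coset_eqI:
  assumes "x \<in> A" "y \<in> A" "x - y \<in> H"
  shows "H #>\<^bsub>G\<^esub> x = H #>\<^bsub>G\<^esub> y"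
proof -
  have "x \<in> H #>\<^bsub>G\<^esub> y"
    using assms(3) unfolding r_coset_def by (auto intro!: bexI[of _ "x - y"])
  then show ?thesis using repr_independence[of x H y] subgroup_H assms(2) by auto
qed

lemma coset_pow:
  assumes "x \<in> A"
  shows "of_nat n * x \<in> A" "(H #>\<^bsub>G\<^esub> x) [^]\<^bsub>G Mod H\<^esub> n = H #>\<^bsub>G\<^esub> (of_nat n * x)"
proof (induction n)
  case 0
  show "of_nat 0 * x \<in> A" using zero subset by auto
  show "(H #>\<^bsub>G\<^esub> x) [^]\<^bsub>G Mod H\<^esub> (0::nat) = H #>\<^bsub>G\<^esub> (of_nat 0 * x)"
    using zero subset coset_eq_self_iff[of 0] by auto
next
  case (Suc n)
  show "of_nat (Suc n) * x \<in> A"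
    using A_add[OF Suc(1) assms] by (simp add: algebra_simps)
  show "(H #>\<^bsub>G\<^esub> x) [^]\<^bsub>G Mod H\<^esub> Suc n = H #>\<^bsub>G\<^esub> (of_nat (Suc n) * x)"
    using rcos_sum[of "of_nat n * x" x] Suc assms
    by (simp add: algebra_simps)
qed

lemma coset_in_Mod: "x \<in> A \<Longrightarrow> H #>\<^bsub>G\<^esub> x \<in> carrier (G Mod H)"
  by (auto simp: carrier_FactGroup)

text \<open>The class of x has order exactly p in A / H.\<close>

lemma prime_dvd_card_cosets:
  assumes "prime p" "x \<in> A" "x \<notin> H" "of_nat p * x \<in> H"
  shows "p dvd card cosets"
proof -
  interpret Q: group "G Mod H" by (rule factorgroup_is_group)
  let ?X = "H #>\<^bsub>G\<^esub> x"
  have C: "?X \<in> carrier (G Mod H)" by (rule coset_in_Mod[OF assms(2)])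
  have "?X [^]\<^bsub>G Mod H\<^esub> p = \<one>\<^bsub>G Mod H\<^esub>"
    using coset_pow[OF assms(2), of p] coset_eq_self_iff assms(4) by simp
  then have "Q.ord ?X dvd p" using Q.pow_eq_id[OF C] by simp
  moreover have "Q.ord ?X \<noteq> 1"
    using Q.ord_eq_1[OF C] coset_eq_self_iff assms(2,3) by simp
  ultimately have "Q.ord ?X = p" using \<open>prime p\<close> by (auto simp: prime_nat_iff)
  then show ?thesis using Q.ord_dvd_group_order[OF C] order_Mod by simp
qed

text \<open>F meets every coset. That the count is nonzero excludes the value 0 which
  \<open>card\<close> takes on infinite sets.\<close>

lemma finite_cosets:
  assumes "finite F" "F \<subseteq> A" "\<And>x. x \<in> A \<Longrightarrow> \<exists>y\<in>F. x - y \<in> H"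
  shows "finite cosets" "card cosets \<le> card F" "card cosets \<noteq> 0"
proof -
  have sub: "cosets \<subseteq> (\<lambda>x. H #>\<^bsub>G\<^esub> x) ` F"
  proof
    fix C assume "C \<in> cosets"
    then obtain x where x: "x \<in> A" "C = H #>\<^bsub>G\<^esub> x"
      by (auto simp: cosets_eq RCOSETS_def)
    with assms(3) obtain y where "y \<in> F" "x - y \<in> H" by blast
    with x assms(2) coset_eqI show "C \<in> (\<lambda>x. H #>\<^bsub>G\<^esub> x) ` F" by blast
  qed
  then show fin: "finite cosets" using assms(1) finite_surj by blast
  show "card cosets \<le> card F" using sub assms(1) by (rule surj_card_le[rotated])
  have "H \<in> cosets" using subgroup_in_rcosets[OF is_group] by (simp add: cosets_eq)
  then show "card cosets \<noteq> 0" using fin by auto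
qed

text \<open>Cauchy's theorem, obtained from Sylow's theorem for subgroups of order \<open>p\<close>.\<close>

lemma prime_dvd_exponent:
  assumes "finite cosets" "prime p" "p dvd card cosets"
    and N: "\<And>x. x \<in> A \<Longrightarrow> of_nat N * x \<in> H"
  shows "p dvd N"
proof -
  interpret Q: group "G Mod H" by (rule factorgroup_is_group)
  obtain k where "Coset.order (G Mod H) = p ^ 1 * k" using assms(3) order_Mod by auto
  moreover have "finite (carrier (G Mod H))" using assms(1) by (simp add: FactGroup_def cosets_eq)
  ultimately obtain P where P: "subgroup P (G Mod H)" "card P = p ^ 1"
    using sylow_thm[OF assms(2) Q.is_group] by blast
  have "1 < card P" using P(2) prime_gt_1_nat[OF assms(2)] by simp
  then obtain C where C: "C \<in> P" "C \<noteq> \<one>\<^bsub>G Mod H\<^esub>"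
    by (metis card_le_Suc0_iff_eq card.infinite less_numeral_extra(4) less_nat_zero_code
        One_nat_def not_less subgroup.one_closed P(1))
  have XM: "C \<in> carrier (G Mod H)" using subgroup.mem_carrier[OF P(1) C(1)] .
  interpret P: group "(G Mod H)\<lparr>carrier := P\<rparr>"
    by (rule subgroup.subgroup_is_group[OF P(1) Q.is_group])
  have "C [^]\<^bsub>(G Mod H)\<lparr>carrier := P\<rparr>\<^esub> card P = \<one>\<^bsub>G Mod H\<^esub>"
    using P.pow_order_eq_1[of C] C by (simp add: Coset.order_def)
  then have "C [^]\<^bsub>G Mod H\<^esub> p = \<one>\<^bsub>G Mod H\<^esub>"
    using P(2) by (simp add: nat_pow_def)
  then have "Q.ord C dvd p" using Q.pow_eq_id[OF XM] by simp
  moreover have "Q.ord C \<noteq> 1" using Q.ord_eq_1[OF XM] C by simp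
  ultimately have ord: "Q.ord C = p" using \<open>prime p\<close> by (auto simp: prime_nat_iff)
  obtain x where x: "x \<in> A" "C = H #>\<^bsub>G\<^esub> x" using XM by (auto simp: carrier_FactGroup)
  have "C [^]\<^bsub>G Mod H\<^esub> N = \<one>\<^bsub>G Mod H\<^esub>"
    using coset_pow[OF x(1), of N] coset_eq_self_iff N[OF x(1)] x by simp
  then show ?thesis using Q.pow_eq_id[OF XM] ord by simp
qed

end

section \<open>Characteristic polynomials over the rationals\<close>

text \<open>Whichever basis the choice operator picks, its list of vectors is an eigenvector for
  theta, and it has the same length as \<open>bs\<close> because all bases have the same
  size.\<close>

lemma field_char_poly_root:
  assumes basis: "is_rat_basis K bs" and "bs \<noteq> []"
    and stable: "\<And>x. x \<in> K \<Longrightarrow> \<theta> * x \<in> K"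
  shows "poly (map_poly of_rat (field_char_poly K \<theta>)) \<theta> = 0"
    "degree (field_char_poly K \<theta>) = length bs" "lead_coeff (field_char_poly K \<theta>) = 1"
proof -
  define cs where "cs = (SOME bs. is_rat_basis K bs)"
  have cs: "is_rat_basis K cs" unfolding cs_def using basis by (rule someI[of "is_rat_basis K"])
  define n where "n = length cs"
  have len: "length xs = rat_complex.dim K" if "is_rat_basis K xs" for xs
    using that rat_complex.basis_card_eq_dim[of "set xs" K] rat_complex.span_superset[of "set xs"]
    by (auto simp: is_rat_basis_def distinct_card)
  have n: "length bs = n" using len[OF basis] len[OF cs] by (simp add: n_def)
  define B where "B = mult_matrix cs \<theta>"
  have B: "B \<in> carrier_mat n n" by (simp add: B_def mult_matrix_def n_def)
  have F: "field_char_poly K \<theta> = char_poly B"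
    by (simp add: field_char_poly_def B_def cs_def)
  show "degree (field_char_poly K \<theta>) = length bs" "lead_coeff (field_char_poly K \<theta>) = 1"
    using degree_monic_char_poly[OF B] n by (simp_all add: F)
  have n0: "0 < n" using n assms(2) by auto
  have ind: "rat_complex.independent (set cs)" and sp: "rat_complex.span (set cs) = K"
    and dist: "distinct cs" using cs by (auto simp: is_rat_basis_def)
  define c where "c j i = rat_complex.representation (set cs) (\<theta> * cs ! j) (cs ! i)" for j i
  have "poly (char_poly (mat n n (\<lambda>(i, j). of_rat (c i j)))) \<theta> = 0"
  proof (rule poly_char_poly_eq_0[where v = "\<lambda>i. cs ! i"])
    show "0 < n" by (rule n0)
    have "cs ! 0 \<in> set cs" using n0 by (simp add: n_def)
    then show "cs ! 0 \<noteq> 0" using ind rat_complex.dependent_zero by metis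
    fix j assume "j < n"
    then have "\<theta> * cs ! j \<in> rat_complex.span (set cs)"
      using stable sp rat_complex.span_base[of "cs ! j" "set cs"] by (auto simp: n_def)
    from rat_complex.sum_representation_eq[OF ind this, of "set cs"]
    show "\<theta> * cs ! j = (\<Sum>i<n. of_rat (c j i) * cs ! i)"
      by (simp add: sum_set_conv_nth[OF dist] c_def n_def)
  qed
  \<comment> \<open>\<open>mult_matrix\<close> keeps the coordinates of theta times a basis vector
    in columns, whereas the eigenvector argument needs them in rows. The transpose has the same
    characteristic polynomial.\<close>
  moreover have "mat n n (\<lambda>(i, j). of_rat (c i j)) = (map_mat of_rat (transpose_mat B) :: complex mat)"
    by (rule eq_matI) (auto simp: B_def mult_matrix_def c_def n_def)
  moreover have "char_poly (map_mat of_rat (transpose_mat B) :: complex mat)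
      = map_poly of_rat (char_poly B)"
    using of_rat_hom.char_poly_hom[of "transpose_mat B" n] B by simp
  ultimately show "poly (map_poly of_rat (field_char_poly K \<theta>)) \<theta> = 0"
    by (simp add: F)
qed

lemmas expand_simps = algebra_simps power2_eq_square add_divide_distrib diff_divide_distrib

section \<open>The simplest quartic field\<close>

text \<open>Dividing the quartic equation by x^2 turns it into t^2 = m t + 4. Then g^2 = t^2 + 4
  lies in the quadratic subfield, and h is the multiple of g whose square is the conjugate of g^2
  under s to -s.\<close>

lemma quartic_table:
  fixes m x u :: "'a::field_char_0"
  assumes u: "x * u = 1" and x: "x ^ 4 - m * x ^ 3 - 6 * x\<^sup>2 + m * x + 1 = 0"
  defines "t \<equiv> x - u"
  defines "s \<equiv> 2 * t - m" and "g \<equiv> x + u"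
  defines "h \<equiv> (s - m) * g / 4" and "M \<equiv> m\<^sup>2 + 16"
  shows "t * t = m * t + 4" "s * s = M" "s * g = m * g + 4 * h" "s * h = 4 * g - m * h"
    "g * g = (M + m * s) / 2" "h * h = (M - m * s) / 2" "g * h = 2 * s"
proof -
  have "(x * u)\<^sup>2 * x\<^sup>2 - m * ((x * u)\<^sup>2 * x) - 6 * (x * u)\<^sup>2 + m * (x * u) * u + u\<^sup>2
      = u\<^sup>2 * (x ^ 4 - m * x ^ 3 - 6 * x\<^sup>2 + m * x + 1)"
    by (simp add: algebra_simps power2_eq_square power3_eq_cube power4_eq_xxxx)
  then have "x\<^sup>2 - m * x - 6 + m * u + u\<^sup>2 = 0"
    unfolding u x by simp
  then have "x\<^sup>2 - 2 * (x * u) + u\<^sup>2 = m * (x - u) + 4"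
    unfolding u by (simp add: algebra_simps)
  then show t: "t * t = m * t + 4"
    by (simp add: t_def power2_eq_square algebra_simps)
  have "s * s = 4 * (t * t) - 4 * m * t + m\<^sup>2"
    by (simp add: s_def algebra_simps power2_eq_square)
  then show s: "s * s = M" unfolding t by (simp add: M_def algebra_simps)
  have "g * g = t * t + 4 * (x * u)"
    by (simp add: g_def t_def algebra_simps)
  then show g: "g * g = (M + m * s) / 2"
    unfolding t u by (simp add: s_def M_def power2_eq_square algebra_simps)
  have h4: "4 * h = (s - m) * g" by (simp add: h_def)
  show sg: "s * g = m * g + 4 * h"
    unfolding h4 by (simp add: algebra_simps)
  have "4 * (s * h) = s * ((s - m) * g)" unfolding h4[symmetric] by simp
  also have "\<dots> = (s * s) * g - m * (s * g)" by (simp add: algebra_simps)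
  also have "\<dots> = 4 * (4 * g - m * h)"
    unfolding s sg by (simp add: M_def algebra_simps power2_eq_square)
  finally show "s * h = 4 * g - m * h" by (simp only: mult_cancel_left) simp
  have "8 * (g * h) = (s - m) * (2 * (g * g))"
    by (simp add: h_def)
  also have "2 * (g * g) = M + m * s"
    unfolding g by simp
  also have "(s - m) * \<dots> = M * s + m * (s * s) - m * M - m * m * s"
    by (simp add: algebra_simps)
  also have "\<dots> = 8 * (2 * s)"
    unfolding s by (simp add: M_def algebra_simps power2_eq_square)
  finally show gh: "g * h = 2 * s" by simp
  have "4 * (h * h) = (s - m) * (g * h)"
    by (simp add: h_def)
  also have "\<dots> = 2 * (s * s - m * s)"
    unfolding gh by (simp add: algebra_simps)
  finally have "4 * (h * h) = 4 * ((M - m * s) / 2)" unfolding s by simp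
  then show "h * h = (M - m * s) / 2" by (simp only: mult_cancel_left) simp
qed

lemma table_mult:
  fixes m M s g h a b c d a' b' c' d' :: "'a::field_char_0"
  assumes "s * s = M" "s * g = m * g + 4 * h" "s * h = 4 * g - m * h"
    "g * g = (M + m * s) / 2" "h * h = (M - m * s) / 2" "g * h = 2 * s"
  shows "(a + b * s + c * g + d * h) * (a' + b' * s + c' * g + d' * h) =
    (a * a' + b * b' * M + (c * c' + d * d') * M / 2)
    + (a * b' + b * a' + (c * c' - d * d') * m / 2 + 2 * (c * d' + d * c')) * s
    + (a * c' + c * a' + m * (b * c' + c * b') + 4 * (b * d' + d * b')) * g
    + (a * d' + d * a' + 4 * (b * c' + c * b') - m * (b * d' + d * b')) * h"
proof -
  have "(a + b * s + c * g + d * h) * (a' + b' * s + c' * g + d' * h) =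
    a * a' + (a * b' + b * a') * s + (a * c' + c * a') * g + (a * d' + d * a') * h
    + b * b' * (s * s) + (b * c' + c * b') * (s * g) + (b * d' + d * b') * (s * h)
    + c * c' * (g * g) + d * d' * (h * h) + (c * d' + d * c') * (g * h)"
    by (simp add: algebra_simps)
  then show ?thesis
    unfolding assms by (simp add: field_simps)
qed

locale simplest_quartic =
  fixes m :: int and \<alpha> :: complex
  assumes m_pos: "m > 0" and m_neq_3: "m \<noteq> 3"
    and no_odd_square: "\<And>k::int. odd k \<Longrightarrow> k > 1 \<Longrightarrow> \<not> k\<^sup>2 dvd m\<^sup>2 + 16"
    and root: "poly (map_poly of_int (simplest_quartic_poly m)) \<alpha> = 0"
begin

definition cm :: complex where "cm = of_int m"
definition rm :: rat where "rm = of_int m"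
definition M :: int where "M = m\<^sup>2 + 16"
definition cM :: complex where "cM = cm\<^sup>2 + 16"
definition rM :: rat where "rM = rm\<^sup>2 + 16"
definition t :: complex where "t = \<alpha> - inverse \<alpha>"
definition s :: complex where "s = 2 * t - cm"
definition g :: complex where "g = \<alpha> + inverse \<alpha>"
definition h :: complex where "h = (s - cm) * g / 4"

lemma of_rat_rm: "of_rat rm = cm" and of_rat_rM: "of_rat rM = cM"
  by (simp_all add: rm_def rM_def cm_def cM_def of_rat_add of_rat_power)

lemma rM_eq: "rM = of_int M"
  by (simp add: rM_def rm_def M_def)

lemma \<alpha>_eq: "\<alpha> ^ 4 - cm * \<alpha> ^ 3 - 6 * \<alpha>\<^sup>2 + cm * \<alpha> + 1 = 0"
proof -
  have "1 + \<alpha> * (cm + \<alpha> * (- 6 + \<alpha> * (- cm + \<alpha>))) = 0"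
    using root unfolding cm_def by (simp add: simplest_quartic_poly_def of_int_hom.map_poly_pCons_hom)
  then show ?thesis
    by (simp add: algebra_simps power2_eq_square power3_eq_cube power4_eq_xxxx)
qed

lemma \<alpha>_nz: "\<alpha> \<noteq> 0"
  using \<alpha>_eq by auto

lemmas table = quartic_table[OF right_inverse[OF \<alpha>_nz] \<alpha>_eq,
    folded t_def g_def, folded s_def, folded h_def, folded cM_def]

lemma \<alpha>_coords: "\<alpha> = cm / 4 + s / 4 + g / 2"
  unfolding s_def g_def t_def by (simp add: diff_divide_distrib add_divide_distrib)

definition el :: "rat \<Rightarrow> rat \<Rightarrow> rat \<Rightarrow> rat \<Rightarrow> complex"
  where "el a b c d = of_rat a + of_rat b * s + of_rat c * g + of_rat d * h"

lemma el_add: "el a b c d + el a' b' c' d' = el (a + a') (b + b') (c + c') (d + d')"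
  by (simp add: el_def of_rat_add algebra_simps)

lemma el_minus: "- el a b c d = el (- a) (- b) (- c) (- d)"
  by (simp add: el_def of_rat_minus algebra_simps)

lemma el_diff: "el a b c d - el a' b' c' d' = el (a - a') (b - b') (c - c') (d - d')"
  by (simp add: el_def of_rat_diff algebra_simps)

lemma el_mult: "el a b c d * el a' b' c' d' =
    el (a * a' + b * b' * rM + (c * c' + d * d') * rM / 2)
       (a * b' + b * a' + (c * c' - d * d') * rm / 2 + 2 * (c * d' + d * c'))
       (a * c' + c * a' + rm * (b * c' + c * b') + 4 * (b * d' + d * b'))
       (a * d' + d * a' + 4 * (b * c' + c * b') - rm * (b * d' + d * b'))"
  unfolding el_def table_mult[OF table(2-)]
  by (simp add: of_rat_add of_rat_mult of_rat_diff of_rat_divide of_rat_rm of_rat_rM)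

lemma el_rat: "el a 0 0 0 = of_rat a"
  by (simp add: el_def)

lemma el_0: "el 0 0 0 0 = 0" and el_1: "el 1 0 0 0 = 1"
  by (simp_all add: el_def)

text \<open>For m at least 2, a square equal to m^2 + 16 lies strictly between m^2 and (m + 3)^2.
  Then (m + 1)^2 is ruled out by parity and (m + 2)^2 forces m = 3. For m = 1 the number is
  17.\<close>

lemma M_nonsquare: "k\<^sup>2 \<noteq> M" for k :: int
proof
  assume "k\<^sup>2 = M"
  then have k: "\<bar>k\<bar>\<^sup>2 = m\<^sup>2 + 16" by (simp add: M_def)
  define l where "l = \<bar>k\<bar>"
  have l: "l\<^sup>2 = m\<^sup>2 + 16" "l \<ge> 0" using k by (auto simp: l_def)
  have "l > m"
    by (rule power_less_imp_less_base[of _ 2]) (use l in auto)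
  moreover have "l < m + 3 \<or> m \<le> 1"
  proof (rule ccontr)
    assume "\<not> ?thesis"
    then have "(m + 3)\<^sup>2 \<le> l\<^sup>2" "m \<ge> 2" using m_pos by (auto intro: power_mono)
    with l show False by (simp add: power2_eq_square algebra_simps)
  qed
  moreover have "m \<le> 1 \<Longrightarrow> l < 5"
  proof (rule ccontr)
    assume "m \<le> 1" "\<not> l < 5"
    then have "5\<^sup>2 \<le> l\<^sup>2" by (intro power_mono) auto
    moreover have "m = 1" using m_pos \<open>m \<le> 1\<close> by simp
    ultimately show False using l by simp
  qed
  ultimately have "l = m + 1 \<or> l = m + 2 \<or> (m = 1 \<and> (l = 2 \<or> l = 3 \<or> l = 4))"
    using m_pos by linarith
  then show False
    using l m_neq_3 by (auto simp: power2_eq_square algebra_simps) presburger+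
qed

text \<open>Otherwise q / r would be a rational, hence an integral, square root of M. All uniqueness
  of coordinates rests on this irrationality of s.\<close>

lemma rat_nonsquare:
  fixes q r :: rat
  assumes "q\<^sup>2 = rM * r\<^sup>2"
  shows "q = 0" "r = 0"
proof -
  show "r = 0"
  proof (rule ccontr)
    assume "r \<noteq> 0"
    define x where "x = q / r"
    have x: "x ^ 2 = rM"
      using assms \<open>r \<noteq> 0\<close> by (simp add: x_def power_divide)
    have "algebraic_int x"
      by (rule algebraic_int_root[of rM "monom 1 2"])
         (use x in \<open>auto simp: poly_monom degree_monom_eq rM_eq\<close>)
    moreover have "x \<in> \<rat>"
      by (cases x) (auto simp: Fract_of_int_quotient)
    ultimately obtain k :: int where "x = of_int k"
      using rational_algebraic_int_is_int by (metis Ints_cases)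
    with x have "(of_int (k\<^sup>2) :: rat) = of_int M" by (simp add: rM_eq)
    then have "k\<^sup>2 = M" by (simp only: of_int_eq_iff)
    then show False using M_nonsquare by blast
  qed
  with assms show "q = 0" by simp
qed

text \<open>\<open>U + V s\<close> is the norm of \<open>a + b s + c g + d h\<close> relative to \<open>\<rat>(s)\<close>, and \<open>Nm\<close> is the absolute norm.\<close>

definition U :: "rat \<Rightarrow> rat \<Rightarrow> rat \<Rightarrow> rat \<Rightarrow> rat"
  where "U a b c d = a\<^sup>2 + rM * b\<^sup>2 - rM * (c\<^sup>2 + d\<^sup>2) / 2"
definition V :: "rat \<Rightarrow> rat \<Rightarrow> rat \<Rightarrow> rat \<Rightarrow> rat"
  where "V a b c d = 2 * a * b - rm * (c\<^sup>2 - d\<^sup>2) / 2 - 4 * c * d"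
definition Nm :: "rat \<Rightarrow> rat \<Rightarrow> rat \<Rightarrow> rat \<Rightarrow> rat"
  where "Nm a b c d = (U a b c d)\<^sup>2 - rM * (V a b c d)\<^sup>2"

lemma rel_norm: "el a b c d * el a b (- c) (- d) = el (U a b c d) (V a b c d) 0 0"
  by (simp add: el_mult U_def V_def power2_eq_square algebra_simps diff_divide_distrib add_divide_distrib)

lemma quad_norm: "el a b 0 0 * el a (- b) 0 0 = of_rat (a\<^sup>2 - rM * b\<^sup>2)"
  by (simp add: el_mult power2_eq_square algebra_simps flip: el_rat)

lemma norm_eq: "el a b c d * (el a b (- c) (- d) * el (U a b c d) (- V a b c d) 0 0)
    = of_rat (Nm a b c d)"
  unfolding mult.assoc[symmetric] rel_norm quad_norm Nm_def ..

text \<open>A zero norm forces U = V = 0, since s is irrational. Combining the two equations, the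
  square of 2 (a^2 - M b^2) becomes M R^2, and the irrationality of s applies twice more. This
  yields both the independence of 1, s, g, h and the existence of inverses in the field.\<close>

lemma Nm_eq_0:
  assumes "Nm a b c d = 0"
  shows "a = 0" "b = 0" "c = 0" "d = 0"
proof -
  have U0: "U a b c d = 0" and V0: "V a b c d = 0"
    using rat_nonsquare[of "U a b c d" "V a b c d"] assms by (auto simp: Nm_def)
  \<comment> \<open>R is the imaginary part of (c + d i)^2 (m - 4 i); the real part m (c^2 - d^2) +
    8 c d equals 4 a b when V = 0. Comparing absolute values gives (4 a b)^2 + R^2 = M (c^2 +
    d^2)^2.\<close>
  define R where "R = 2 * c * d * rm - 4 * (c\<^sup>2 - d\<^sup>2)"
  have e1: "a\<^sup>2 + rM * b\<^sup>2 = rM * (c\<^sup>2 + d\<^sup>2) / 2" using U0 by (simp add: U_def)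
  have e2: "4 * a * b = rm * (c\<^sup>2 - d\<^sup>2) + 8 * c * d" using V0 by (simp add: V_def)
  have "(2 * (a\<^sup>2 - rM * b\<^sup>2))\<^sup>2 = (2 * (a\<^sup>2 + rM * b\<^sup>2))\<^sup>2 - rM * (4 * a * b)\<^sup>2"
    by (simp add: power2_eq_square algebra_simps)
  also have "\<dots> = rM * R\<^sup>2"
    unfolding e1 e2 by (simp add: R_def rM_def power2_eq_square field_simps)
  finally have "2 * (a\<^sup>2 - rM * b\<^sup>2) = 0" by (rule rat_nonsquare(1))
  then have "a\<^sup>2 = rM * b\<^sup>2" by simp
  then show ab: "a = 0" "b = 0" using rat_nonsquare by blast+
  have "rM > 0" unfolding rM_def by (rule add_nonneg_pos) auto
  with e1 ab have "c\<^sup>2 + d\<^sup>2 = 0" by simp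
  then show "c = 0" "d = 0" by (simp_all add: sum_power2_eq_zero_iff)
qed

lemma el_eq_0: "el a b c d = 0 \<longleftrightarrow> a = 0 \<and> b = 0 \<and> c = 0 \<and> d = 0"
proof
  assume "el a b c d = 0"
  then have "Nm a b c d = 0" using norm_eq[of a b c d] by simp
  then show "a = 0 \<and> b = 0 \<and> c = 0 \<and> d = 0" using Nm_eq_0 by blast
qed (simp add: el_0)

lemma el_eq_iff: "el a b c d = el a' b' c' d' \<longleftrightarrow> a = a' \<and> b = b' \<and> c = c' \<and> d = d'"
proof -
  have "el a b c d = el a' b' c' d' \<longleftrightarrow> el (a - a') (b - b') (c - c') (d - d') = 0"
    by (simp flip: el_diff)
  then show ?thesis by (simp add: el_eq_0)
qed

lemma el_eqD:
  assumes "el a b c d = el a' b' c' d'"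
  shows "a = a'" "b = b'" "c = c'" "d = d'"
  using assms by (simp_all add: el_eq_iff)

section \<open>The field in coordinates\<close>

definition K :: "complex set" where "K = {el a b c d | a b c d. True}"

lemma el_in_K: "el a b c d \<in> K" by (auto simp: K_def)

lemma K_E: "x \<in> K \<Longrightarrow> (\<And>a b c d. x = el a b c d \<Longrightarrow> P) \<Longrightarrow> P" by (auto simp: K_def)

lemma K_add: "x \<in> K \<Longrightarrow> y \<in> K \<Longrightarrow> x + y \<in> K"
  by (auto simp: K_def el_add) blast

lemma K_mult: "x \<in> K \<Longrightarrow> y \<in> K \<Longrightarrow> x * y \<in> K"
  by (auto simp: K_def el_mult) blast

lemma K_minus: "x \<in> K \<Longrightarrow> - x \<in> K"
  by (auto simp: K_def el_minus) blast

lemma K_diff: "x \<in> K \<Longrightarrow> y \<in> K \<Longrightarrow> x - y \<in> K"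
  by (auto simp: K_def el_diff) blast

lemma K_rat: "of_rat q \<in> K"
  using el_in_K[of q 0 0 0] by (simp add: el_rat)

lemma K_int: "of_int k \<in> K"
  using K_rat[of "of_int k"] by simp

lemma K_nat: "of_nat k \<in> K"
  using K_rat[of "of_nat k"] by simp

lemma K_numeral: "numeral k \<in> K"
  using K_rat[of "numeral k"] by simp

lemma K_1: "1 \<in> K"
  using K_rat[of 1] by simp

lemma K_inverse:
  assumes "x \<in> K" "x \<noteq> 0"
  shows "inverse x \<in> K"
proof -
  obtain a b c d where x: "x = el a b c d" using assms(1) by (rule K_E)
  have N: "Nm a b c d \<noteq> 0" using assms(2) x Nm_eq_0 el_eq_0 by metis
  define y where "y = el a b (- c) (- d) * el (U a b c d) (- V a b c d) 0 0"
  have "x * y = of_rat (Nm a b c d)" using norm_eq x y_def by simp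
  then have "inverse x = y * of_rat (1 / Nm a b c d)"
    using N assms(2) by (simp add: of_rat_divide field_simps)
  also have "\<dots> \<in> K" unfolding y_def by (intro K_mult el_in_K K_rat)
  finally show ?thesis .
qed

lemma K_divide: "x \<in> K \<Longrightarrow> y \<in> K \<Longrightarrow> x / y \<in> K"
  unfolding divide_inverse
  by (cases "y = 0") (auto intro: K_mult K_inverse K_int[of 0, simplified])

lemma K_gens: "s \<in> K" "g \<in> K" "h \<in> K"
  using el_in_K[of 0 1 0 0] el_in_K[of 0 0 1 0] el_in_K[of 0 0 0 1] by (simp_all add: el_def)

lemmas K_intros = K_add K_mult K_minus K_diff K_rat K_int K_nat K_numeral K_1 K_divide K_gens

lemma \<alpha>_in_K: "\<alpha> \<in> K"
proof -
  have "cm / 4 + s / 4 + g / 2 \<in> K" unfolding cm_def by (intro K_intros)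
  then show ?thesis by (simp only: \<alpha>_coords[symmetric])
qed

lemma el_in_rat_adjoin:
  assumes "s \<in> rat_adjoin \<theta>" "g \<in> rat_adjoin \<theta>" "h \<in> rat_adjoin \<theta>"
  shows "el a b c d \<in> rat_adjoin \<theta>"
  unfolding el_def by (intro rat_adjoin_intros assms)

lemma rat_adjoin_subset: "\<theta> \<in> K \<Longrightarrow> rat_adjoin \<theta> \<subseteq> K"
  by (rule subsetI, rule rat_adjoin_least[of _ \<theta>])
     (auto intro: K_1 K_minus K_inverse K_add K_mult)

lemma rat_adjoin_\<alpha>: "rat_adjoin \<alpha> = K"
proof
  show "rat_adjoin \<alpha> \<subseteq> K" by (rule rat_adjoin_subset[OF \<alpha>_in_K])
  have t: "t \<in> rat_adjoin \<alpha>" unfolding t_def by (intro rat_adjoin_intros)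
  have s: "s \<in> rat_adjoin \<alpha>" unfolding s_def cm_def by (intro rat_adjoin_intros t)
  have g: "g \<in> rat_adjoin \<alpha>" unfolding g_def by (intro rat_adjoin_intros)
  have h: "h \<in> rat_adjoin \<alpha>" unfolding h_def cm_def by (intro rat_adjoin_intros g s)
  show "K \<subseteq> rat_adjoin \<alpha>"
    using el_in_rat_adjoin[OF s g h] by (auto simp: K_def)
qed

text \<open>The automorphism \<open>s \<mapsto> -s\<close>, \<open>g \<mapsto> h\<close>, \<open>h \<mapsto> -g\<close> generates the cyclic Galois group.\<close>

lemma conjugate_mult:
  assumes "el a b c d * el a' b' c' d' = el A B C D"
  shows "el a (- b) (- d) c * el a' (- b') (- d') c' = el A (- B) (- D) C"
proof -
  have eqs: "A = a * a' + b * b' * rM + (c * c' + d * d') * rM / 2"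
    "B = a * b' + b * a' + (c * c' - d * d') * rm / 2 + 2 * (c * d' + d * c')"
    "C = a * c' + c * a' + rm * (b * c' + c * b') + 4 * (b * d' + d * b')"
    "D = a * d' + d * a' + 4 * (b * c' + c * b') - rm * (b * d' + d * b')"
    using assms unfolding el_mult el_eq_iff by blast+
  have "(d * d' - c * c') * rm / 2 = - ((c * c' - d * d') * rm / 2)"
    by (simp add: left_diff_distrib diff_divide_distrib)
  then show ?thesis
    unfolding el_mult el_eq_iff eqs by (simp add: ring_distribs)
qed

text \<open>The automorphism is not introduced as a function on complex numbers but acts on
  coordinates. The Horner evaluations of a rational polynomial at theta and at its image are
  therefore followed simultaneously.\<close>

lemma poly_conjugate:
  fixes p :: "rat poly"
  shows "\<exists>a' b' c' d'. poly (map_poly of_rat p) (el a b c d) = el a' b' c' d' \<and>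
    poly (map_poly of_rat p) (el a (- b) (- d) c) = el a' (- b') (- d') c'"
proof (induction p)
  case 0
  have "poly (map_poly of_rat 0) x = el 0 0 0 0" for x
    by (simp add: el_0)
  then show ?case by (intro exI[of _ 0]) simp
next
  case (pCons q p)
  then obtain a' b' c' d' where 1:
    "poly (map_poly of_rat p) (el a b c d) = el a' b' c' d'"
    "poly (map_poly of_rat p) (el a (- b) (- d) c) = el a' (- b') (- d') c'"
    by blast
  have eq: "poly (map_poly of_rat (pCons q p)) x = el q 0 0 0 + x * poly (map_poly of_rat p) x" for x
    by (simp only: of_rat_hom.map_poly_pCons_hom poly_pCons el_rat)
  obtain A B C D where 2: "el a b c d * el a' b' c' d' = el A B C D"
    by (rule K_E[OF K_mult[OF el_in_K el_in_K]])
  show ?case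
    unfolding eq 1 conjugate_mult[OF 2] 2 el_add
    by (intro exI[of _ "q + A"] exI[of _ B] exI[of _ C] exI[of _ D]) simp
qed

lemma conjugate_root:
  fixes p :: "rat poly"
  assumes "poly (map_poly of_rat p) (el a b c d) = 0"
  shows "poly (map_poly of_rat p) (el a (- b) (- d) c) = 0"
proof -
  obtain a' b' c' d' where 1:
    "poly (map_poly of_rat p) (el a b c d) = el a' b' c' d'"
    "poly (map_poly of_rat p) (el a (- b) (- d) c) = el a' (- b') (- d') c'"
    using poly_conjugate by blast
  with assms show ?thesis by (simp add: el_eq_0 el_0)
qed

section \<open>Conditions on the coordinates of algebraic integers\<close>

lemma conjugate_algebraic_int:
  assumes "algebraic_int (el a b c d)"
  shows "algebraic_int (el a (- b) (- d) c)"
proof -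
  obtain p :: "int poly" where p: "poly (map_poly of_int p) (el a b c d) = 0" "lead_coeff p = 1"
    using assms unfolding algebraic_int_altdef_ipoly by blast
  have eq: "map_poly of_rat (map_poly rat_of_int p) = (map_poly of_int p :: complex poly)"
    by (simp add: map_poly_map_poly o_def)
  have "poly (map_poly of_rat (map_poly rat_of_int p)) (el a b c d) = 0"
    unfolding eq by (rule p(1))
  from conjugate_root[OF this] have "poly (map_poly of_int p) (el a (- b) (- d) c) = 0"
    unfolding eq .
  with p(2) show ?thesis unfolding algebraic_int_altdef_ipoly by blast
qed

lemma of_rat_algebraic_int:
  assumes "algebraic_int (of_rat q :: complex)"
  shows "q \<in> \<int>"
proof -
  have "(of_rat q :: complex) \<in> \<int>"
    using rational_algebraic_int_is_int[OF assms] by simp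
  then obtain k where "(of_rat q :: complex) = of_int k" by (auto elim: Ints_cases)
  then have "(of_rat q :: complex) = of_rat (of_int k)" by simp
  then have "q = of_int k" by (simp only: of_rat_eq_iff)
  then show ?thesis by simp
qed

text \<open>Applying the automorphism twice negates c and d. Hence the relative trace 2 a + 2 b s
  and the relative norm U + V s are integral; the four numbers are the trace and the norm down to Q
  of each of these.\<close>

lemma integral_conditions:
  assumes "algebraic_int (el a b c d)"
  shows "4 * a \<in> \<int>" "4 * (a\<^sup>2 - rM * b\<^sup>2) \<in> \<int>" "2 * U a b c d \<in> \<int>" "Nm a b c d \<in> \<int>"
proof -
  note 1 = conjugate_algebraic_int[OF assms]
  note 2 = conjugate_algebraic_int[OF 1]
  have tr: "algebraic_int (el (2 * a) (2 * b) 0 0)"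
    using algebraic_int_add[OF assms 2] by (simp add: el_add)
  note tr' = conjugate_algebraic_int[OF tr]
  have nm: "algebraic_int (el (U a b c d) (V a b c d) 0 0)"
    using algebraic_int_mult[OF assms 2] by (simp add: rel_norm)
  note nm' = conjugate_algebraic_int[OF nm]
  show "4 * a \<in> \<int>"
    using algebraic_int_add[OF tr tr'] by (intro of_rat_algebraic_int) (simp add: el_add el_rat)
  show "4 * (a\<^sup>2 - rM * b\<^sup>2) \<in> \<int>"
    using algebraic_int_mult[OF tr tr']
    by (intro of_rat_algebraic_int) (simp add: quad_norm power_mult_distrib algebra_simps)
  show "2 * U a b c d \<in> \<int>"
    using algebraic_int_add[OF nm nm'] by (intro of_rat_algebraic_int) (simp add: el_add el_rat)
  show "Nm a b c d \<in> \<int>"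
    using algebraic_int_mult[OF nm nm']
    by (intro of_rat_algebraic_int) (simp add: quad_norm Nm_def)
qed

end

section \<open>The ring of integers\<close>

lemma prime_sq_dvd_multD:
  fixes p x y :: int
  assumes "prime p" "p\<^sup>2 dvd x * y" "\<not> p\<^sup>2 dvd x"
  shows "p dvd y"
proof (rule ccontr)
  assume "\<not> p dvd y"
  then have "coprime (p\<^sup>2) y" using assms(1) by (simp add: prime_imp_coprime)
  then show False using assms(2,3) by (simp add: coprime_dvd_mult_left_iff)
qed

lemma prime_cube_dvd_squareD:
  fixes p x :: int
  assumes "prime p" "p ^ 3 dvd x\<^sup>2"
  shows "p\<^sup>2 dvd x"
proof -
  have p0: "p \<noteq> 0" using assms(1) by auto
  have "p dvd x\<^sup>2" using assms(2) by (meson dvd_power dvd_trans zero_less_numeral)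
  then have "p dvd x" using assms(1) prime_dvd_power by blast
  then obtain y where y: "x = p * y" by blast
  have "p\<^sup>2 * p dvd p\<^sup>2 * y\<^sup>2" using assms(2) by (simp add: y power_mult_distrib power2_eq_square power3_eq_cube mult.assoc)
  then have "p dvd y\<^sup>2" using p0 by simp
  then have "p dvd y" using assms(1) prime_dvd_power by blast
  then show ?thesis by (simp add: y power2_eq_square)
qed

lemma odd_prime_not_dvd_2:
  fixes p :: int
  assumes "prime p" "odd p"
  shows "\<not> p dvd 2"
proof
  assume "p dvd 2"
  then have "p \<le> 2" by (rule zdvd_imp_le) simp
  then show False using prime_ge_2_int[OF assms(1)] assms(2) by auto
qed

text \<open>With \<open>Q = m(c\<^sup>2 - d\<^sup>2) + 8cd\<close> and \<open>R = 2mcd - 4(c\<^sup>2 - d\<^sup>2)\<close>, i.e. \<open>(c + di)\<^sup>2 (m - 4i) = Q + Ri\<close>,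
  one has \<open>Q\<^sup>2 + R\<^sup>2 = (c\<^sup>2 + d\<^sup>2)\<^sup>2 (m\<^sup>2 + 16)\<close> and \<open>mQ - 4R = (c\<^sup>2 - d\<^sup>2)(m\<^sup>2 + 16)\<close>.\<close>

lemma odd_prime_dvd_coords:
  fixes p m c d :: int
  assumes p: "prime p" "odd p" and M: "\<not> p\<^sup>2 dvd m\<^sup>2 + 16"
    and S: "p\<^sup>2 dvd (m\<^sup>2 + 16) * (c\<^sup>2 + d\<^sup>2)" and Q: "p\<^sup>2 dvd m * (c\<^sup>2 - d\<^sup>2) + 8 * c * d"
  shows "p dvd c" "p dvd d"
proof -
  define Q' where "Q' = m * (c\<^sup>2 - d\<^sup>2) + 8 * c * d"
  define R where "R = 2 * m * c * d - 4 * (c\<^sup>2 - d\<^sup>2)"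
  have pS: "p dvd c\<^sup>2 + d\<^sup>2" by (rule prime_sq_dvd_multD[OF p(1) S M])
  \<comment> \<open>M may contain p once, so only one factor p of c^2 + d^2 is known. Multiplying
    both facts still reaches p^3, which is enough for p^2 to divide R.\<close>
  have "p * p\<^sup>2 dvd (c\<^sup>2 + d\<^sup>2) * ((m\<^sup>2 + 16) * (c\<^sup>2 + d\<^sup>2))"
    by (rule mult_dvd_mono[OF pS S])
  then have 1: "p ^ 3 dvd (c\<^sup>2 + d\<^sup>2) * ((m\<^sup>2 + 16) * (c\<^sup>2 + d\<^sup>2))"
    by (simp add: power2_eq_square power3_eq_cube mult.assoc)
  have "(p\<^sup>2)\<^sup>2 dvd Q'\<^sup>2" using Q unfolding Q'_def by (rule dvd_power_same)
  then have "p ^ 3 dvd Q'\<^sup>2" by (rule dvd_trans[rotated]) (simp flip: power_mult, simp add: le_imp_power_dvd)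
  with 1 have "p ^ 3 dvd (c\<^sup>2 + d\<^sup>2) * ((m\<^sup>2 + 16) * (c\<^sup>2 + d\<^sup>2)) - Q'\<^sup>2" by (rule dvd_diff)
  also have "(c\<^sup>2 + d\<^sup>2) * ((m\<^sup>2 + 16) * (c\<^sup>2 + d\<^sup>2)) - Q'\<^sup>2 = R\<^sup>2"
    by (simp add: Q'_def R_def power2_eq_square algebra_simps)
  finally have R: "p\<^sup>2 dvd R" by (rule prime_cube_dvd_squareD[OF p(1)])
  have "p\<^sup>2 dvd m * Q' - 4 * R" using Q R unfolding Q'_def by (intro dvd_diff dvd_mult) auto
  also have "m * Q' - 4 * R = (m\<^sup>2 + 16) * (c\<^sup>2 - d\<^sup>2)"
    by (simp add: Q'_def R_def power2_eq_square algebra_simps)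
  finally have pD: "p dvd c\<^sup>2 - d\<^sup>2" by (rule prime_sq_dvd_multD[OF p(1) _ M])
  have "\<not> p dvd 2" by (rule odd_prime_not_dvd_2[OF p])
  moreover have "p dvd 2 * c\<^sup>2" using dvd_add[OF pS pD] by (simp add: algebra_simps)
  moreover have "p dvd 2 * d\<^sup>2" using dvd_diff[OF pS pD] by (simp add: algebra_simps)
  ultimately show "p dvd c" "p dvd d"
    using p(1) by (meson prime_dvd_mult_iff prime_dvd_power)+
qed

definition lat :: "complex \<Rightarrow> complex \<Rightarrow> complex \<Rightarrow> complex set"
  where "lat w e f = {of_int a + of_int b * w + of_int c * e + of_int d * f | a b c d. True}"

lemma latI: "x = of_int a + of_int b * w + of_int c * e + of_int d * f \<Longrightarrow> x \<in> lat w e f"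
  by (auto simp: lat_def)

lemma latE:
  assumes "x \<in> lat w e f"
  obtains a b c d where "x = of_int a + of_int b * w + of_int c * e + of_int d * f"
  using assms by (auto simp: lat_def)

lemma lat_diff: "x \<in> lat w e f \<Longrightarrow> y \<in> lat w e f \<Longrightarrow> x - y \<in> lat w e f"
proof (elim latE)
  fix a b c d a' b' c' d'
  assume "x = of_int a + of_int b * w + of_int c * e + of_int d * f"
    "y = of_int a' + of_int b' * w + of_int c' * e + of_int d' * f"
  then show "x - y \<in> lat w e f"
    by (intro latI[of _ "a - a'" "b - b'" w "c - c'" e "d - d'" f]) (simp add: algebra_simps)
qed

lemma lat_of_int_mult: "x \<in> lat w e f \<Longrightarrow> of_int k * x \<in> lat w e f"
proof (elim latE)
  fix a b c d
  assume "x = of_int a + of_int b * w + of_int c * e + of_int d * f"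
  then show "of_int k * x \<in> lat w e f"
    by (intro latI[of _ "k * a" "k * b" w "k * c" e "k * d" f]) (simp add: algebra_simps)
qed

lemma lat_basis: "w \<in> lat w e f" "e \<in> lat w e f" "f \<in> lat w e f" "of_int k \<in> lat w e f"
  by (rule latI[of _ 0 1 _ 0 _ 0], simp, rule latI[of _ 0 0 _ 1 _ 0], simp,
      rule latI[of _ 0 0 _ 0 _ 1], simp, rule latI[of _ k 0 _ 0 _ 0], simp)

lemma lat_0: "0 \<in> lat w e f" and lat_1: "1 \<in> lat w e f"
  using lat_basis(4)[of 0] lat_basis(4)[of 1] by auto

lemma lat_minus: "x \<in> lat w e f \<Longrightarrow> - x \<in> lat w e f"
  using lat_diff[OF lat_0, of x] by simp

lemma lat_add: "x \<in> lat w e f \<Longrightarrow> y \<in> lat w e f \<Longrightarrow> x + y \<in> lat w e f"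
  using lat_diff[of x w e f "- y"] lat_minus by auto

lemmas lat_intros = lat_diff lat_of_int_mult lat_basis lat_0 lat_1 lat_minus lat_add

lemma lat_subset:
  assumes "w \<in> lat w' e' f'" "e \<in> lat w' e' f'" "f \<in> lat w' e' f'"
  shows "lat w e f \<subseteq> lat w' e' f'"
  by (auto elim!: latE intro!: lat_intros assms)

lemma int_scale_Ints:
  fixes x :: rat
  assumes "x \<in> \<int>" "of_int k = of_int n * x"
  shows "n dvd k"
proof -
  obtain l where "x = of_int l" using assms(1) by (auto elim: Ints_cases)
  with assms(2) have "(of_int k :: rat) = of_int (n * l)" by simp
  then have "k = n * l" by (simp only: of_int_eq_iff)
  then show ?thesis by simp
qed

section \<open>Descent at odd primes and reduction to the prime 2\<close>

context simplest_quartic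
begin

lemma lat_sgh: "lat s g h = {el (of_int a) (of_int b) (of_int c) (of_int d) | a b c d. True}"
  by (simp add: lat_def el_def)

lemma el_scale: "of_rat q * el a b c d = el (q * a) (q * b) (q * c) (q * d)"
  by (simp only: el_def of_rat_mult distrib_left mult.assoc)

lemma odd_prime_sq_not_dvd_M:
  assumes "prime (p::int)" "odd p"
  shows "\<not> p\<^sup>2 dvd m\<^sup>2 + 16"
  using no_odd_square[of p] assms prime_gt_1_int by blast

text \<open>The trace and the norm of the relative trace make a and b integral. Then the trace of
  the relative norm gives p^2 | M (c0^2 + d0^2), and the absolute norm gives p^2 | m (c0^2 - d0^2) +
  8 c0 d0, which are the hypotheses of \<open>odd_prime_dvd_coords\<close>.\<close>

lemma odd_prime_descent:
  assumes "x \<in> K" "algebraic_int x" and p: "prime (p::int)" "odd p" and px: "of_int p * x \<in> lat s g h"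
  shows "x \<in> lat s g h"
proof -
  obtain a b c d where x: "x = el a b c d" using assms(1) by (rule K_E)
  note cond = integral_conditions[OF assms(2)[unfolded x]]
  have "of_rat (of_int p) * x = of_int p * x" by simp
  with px obtain a0 b0 c0 d0 where "el (of_int p * a) (of_int p * b) (of_int p * c) (of_int p * d)
      = el (of_int a0) (of_int b0) (of_int c0) (of_int d0)"
    unfolding x el_scale lat_sgh by auto
  then have 0: "of_int p * a = of_int a0" "of_int p * b = of_int b0" "of_int p * c = of_int c0"
    "of_int p * d = of_int d0"
    by (simp_all add: el_eq_iff)
  define P :: rat where "P = of_int p"
  have P0: "P \<noteq> 0" using p by (auto simp: P_def)
  note 0 = 0[folded P_def]
  have scaled: "z \<in> \<int>" if "p dvd z0" "P * z = of_int z0" for z z0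
  proof -
    from that(1) obtain k where "z0 = p * k" by blast
    with that(2) have "P * z = P * of_int k" by (simp add: P_def)
    then have "z = of_int k" using P0 by simp
    then show ?thesis by simp
  qed
  have odd_not2: "\<not> p dvd 2" "\<not> p dvd 4"
  proof -
    show 2: "\<not> p dvd 2" by (rule odd_prime_not_dvd_2[OF p])
    then show "\<not> p dvd 4" using p(1) prime_dvd_mult_iff[of p 2 2] by simp
  qed
  note M = odd_prime_sq_not_dvd_M[OF p]
  have "p dvd 4 * a0"
    by (rule int_scale_Ints[OF cond(1)]) (simp add: algebra_simps flip: 0 P_def)
  then have "p dvd a0" using p(1) odd_not2 by (simp add: prime_dvd_mult_iff)
  then have a: "a \<in> \<int>" using scaled 0(1) by blast
  then have "4 * a\<^sup>2 - 4 * (a\<^sup>2 - rM * b\<^sup>2) \<in> \<int>" by (intro Ints_diff cond Ints_mult Ints_power) auto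
  then have "4 * (rM * b\<^sup>2) \<in> \<int>" by (simp add: algebra_simps)
  then have "p\<^sup>2 dvd (m\<^sup>2 + 16) * (4 * b0\<^sup>2)"
    by (rule int_scale_Ints)
       (simp add: rM_def rm_def power_mult_distrib flip: 0 P_def)
  then have "p dvd 4 * b0\<^sup>2" by (rule prime_sq_dvd_multD[OF p(1) _ M])
  then have "p dvd b0" using p(1) odd_not2 by (simp add: prime_dvd_mult_iff prime_dvd_power_iff)
  then have b: "b \<in> \<int>" using scaled 0(2) by blast
  have rM: "rM \<in> \<int>" by (simp add: rM_eq)
  have "2 * a\<^sup>2 + 2 * (rM * b\<^sup>2) - 2 * U a b c d \<in> \<int>"
    by (intro Ints_diff Ints_add cond Ints_mult Ints_power a b rM) auto
  then have "rM * (c\<^sup>2 + d\<^sup>2) \<in> \<int>" by (simp add: U_def algebra_simps)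
  then have S: "p\<^sup>2 dvd (m\<^sup>2 + 16) * (c0\<^sup>2 + d0\<^sup>2)"
    by (rule int_scale_Ints)
       (simp add: rM_def rm_def power_mult_distrib distrib_left flip: 0 P_def)
  have "(2 * U a b c d)\<^sup>2 - 4 * Nm a b c d \<in> \<int>"
    by (intro Ints_diff cond Ints_mult Ints_power) auto
  then have 1: "rM * (2 * V a b c d)\<^sup>2 \<in> \<int>"
    by (simp add: Nm_def power_mult_distrib mult.left_commute)
  \<comment> \<open>Z is 2 V with the denominator p^2 cleared.\<close>
  define Z where "Z = 4 * a0 * b0 - (m * (c0\<^sup>2 - d0\<^sup>2) + 8 * c0 * d0)"
  have Z: "of_int Z = P\<^sup>2 * (2 * V a b c d)"
    unfolding Z_def V_def rm_def
    by (simp add: algebra_simps power2_eq_square diff_divide_distrib flip: 0)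
  have "of_int ((m\<^sup>2 + 16) * Z\<^sup>2) = rM * (of_int Z)\<^sup>2"
    by (simp add: rM_def rm_def)
  also have "\<dots> = of_int (p ^ 4) * (rM * (2 * V a b c d)\<^sup>2)"
    unfolding Z by (simp add: P_def power_mult_distrib flip: power_mult)
  finally have p4: "p ^ 4 dvd (m\<^sup>2 + 16) * Z\<^sup>2"
    by (rule int_scale_Ints[OF 1])
  have "p\<^sup>2 dvd p ^ 4" by (rule le_imp_power_dvd) simp
  \<comment> \<open>M can absorb only one factor p, so p^4 | M Z^2 is used twice: once for p | Z
    and, after cancelling p^2, once more for p | Z / p.\<close>
  with p4 have "p dvd Z\<^sup>2" using prime_sq_dvd_multD[OF p(1) _ M] dvd_trans by blast
  then have "p dvd Z" using p(1) by (simp add: prime_dvd_power_iff)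
  then obtain Y where Y: "Z = p * Y" by blast
  have e: "p ^ 4 = p\<^sup>2 * p\<^sup>2" by (simp flip: power_add)
  have "(m\<^sup>2 + 16) * (p * Y)\<^sup>2 = p\<^sup>2 * ((m\<^sup>2 + 16) * Y\<^sup>2)"
    by (simp add: power_mult_distrib mult.left_commute)
  with p4 have "p\<^sup>2 * p\<^sup>2 dvd p\<^sup>2 * ((m\<^sup>2 + 16) * Y\<^sup>2)"
    unfolding Y e by (simp only:)
  then have "p\<^sup>2 dvd (m\<^sup>2 + 16) * Y\<^sup>2"
    unfolding dvd_mult_cancel_left using P0 by (simp add: P_def)
  then have "p dvd Y\<^sup>2" by (rule prime_sq_dvd_multD[OF p(1) _ M])
  then have "p dvd Y" using p(1) by (simp add: prime_dvd_power_iff)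
  then have pX: "p\<^sup>2 dvd Z" by (simp add: Y power2_eq_square)
  have "p\<^sup>2 dvd a0 * b0" using mult_dvd_mono[OF \<open>p dvd a0\<close> \<open>p dvd b0\<close>] by (simp add: power2_eq_square)
  then have "p\<^sup>2 dvd 4 * a0 * b0" by (simp add: mult.assoc)
  then have "p\<^sup>2 dvd 4 * a0 * b0 - Z" using pX by (rule dvd_diff)
  then have Q: "p\<^sup>2 dvd m * (c0\<^sup>2 - d0\<^sup>2) + 8 * c0 * d0" by (simp add: Z_def)
  have c: "c \<in> \<int>" and d: "d \<in> \<int>"
    using scaled 0(3,4) odd_prime_dvd_coords[OF p M S Q] by blast+
  from a b c d obtain a1 b1 c1 d1 where "a = of_int a1" "b = of_int b1" "c = of_int c1" "d = of_int d1"
    by (meson Ints_cases)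
  then show ?thesis unfolding x lat_sgh by blast
qed

lemma common_denominator:
  assumes "x \<in> K"
  obtains D :: nat where "D > 0" "of_nat D * x \<in> lat s g h"
proof -
  obtain a b c d where x: "x = el a b c d" using assms by (rule K_E)
  have den: "\<exists>n>0. \<exists>k. of_int n * q = of_int k" for q :: rat
  proof (cases q)
    case (Fract u v)
    then show ?thesis by (intro exI[of _ v] conjI exI[of _ u]) (auto simp: Fract_of_int_quotient)
  qed
  obtain n1 k1 where 1: "n1 > 0" "of_int n1 * a = of_int k1" using den by blast
  obtain n2 k2 where 2: "n2 > 0" "of_int n2 * b = of_int k2" using den by blast
  obtain n3 k3 where 3: "n3 > 0" "of_int n3 * c = of_int k3" using den by blast
  obtain n4 k4 where 4: "n4 > 0" "of_int n4 * d = of_int k4" using den by blast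
  define n where "n = n1 * n2 * n3 * n4"
  have n: "n > 0" using 1 2 3 4 by (simp add: n_def)
  have "of_nat (nat n) * x = of_rat (of_int n) * el a b c d" using n x by simp
  also have "\<dots> = el (of_int (n2 * n3 * n4 * k1)) (of_int (n1 * n3 * n4 * k2))
      (of_int (n1 * n2 * n4 * k3)) (of_int (n1 * n2 * n3 * k4))"
    unfolding el_scale el_eq_iff of_int_mult n_def 1(2)[symmetric] 2(2)[symmetric]
      3(2)[symmetric] 4(2)[symmetric] by (simp add: mult_ac)
  also have "\<dots> \<in> lat s g h" unfolding lat_sgh by blast
  finally show ?thesis using that[of "nat n"] n by simp
qed

lemma sixteen_lat:
  assumes "16 * w \<in> lat s g h" "16 * e \<in> lat s g h" "16 * f \<in> lat s g h" "x \<in> lat w e f"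
  shows "16 * x \<in> lat s g h"
proof -
  obtain a b c d where "x = of_int a + of_int b * w + of_int c * e + of_int d * f"
    using assms(4) by (rule latE)
  then have "16 * x = of_int (16 * a) + of_int b * (16 * w) + of_int c * (16 * e) + of_int d * (16 * f)"
    by (simp add: algebra_simps)
  also have "\<dots> \<in> lat s g h" by (intro lat_intros assms)
  finally show ?thesis .
qed

text \<open>The spans of 1, s, g, h and of 1, w, e, f agree up to the factor 16, so odd primes are
  handled once and for all in the former. What remains for each integral basis is the condition
  \<open>two\<close>.\<close>

lemma integers_in_lat:
  assumes sgh: "s \<in> lat w e f" "g \<in> lat w e f" "h \<in> lat w e f"
    and wef: "16 * w \<in> lat s g h" "16 * e \<in> lat s g h" "16 * f \<in> lat s g h"
    and two: "\<And>y. y \<in> K \<Longrightarrow> algebraic_int y \<Longrightarrow> 2 * y \<in> lat w e f \<Longrightarrow> y \<in> lat w e f"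
    and x: "x \<in> K" "algebraic_int x"
  shows "x \<in> lat w e f"
proof -
  have sub: "lat s g h \<subseteq> lat w e f" by (rule lat_subset[OF sgh])
  note sub16 = sixteen_lat[OF wef]
  have prime_step: "y \<in> lat w e f"
    if y: "y \<in> K" "algebraic_int y" "of_nat p * y \<in> lat w e f" and p: "prime p" for y and p :: nat
  proof (cases "p = 2")
    case True
    then show ?thesis using two y by simp
  next
    case False
    then have "odd p" using p by (metis primes_dvd_imp_eq two_is_prime_nat)
    have eq: "of_int (int p) * (16 * y) = 16 * (of_nat p * y)" by simp
    have "of_int (int p) * (16 * y) \<in> lat s g h" unfolding eq by (rule sub16[OF y(3)])
    moreover have "16 * y \<in> K" using y K_mult[OF K_numeral] by blast
    moreover have "algebraic_int (16 * y)" using y by (intro algebraic_int_mult) auto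
    ultimately have 16: "16 * y \<in> lat w e f"
      using odd_prime_descent[of "16 * y" "int p"] p \<open>odd p\<close> sub by auto
    have "coprime (int p) 2" using \<open>odd p\<close> by simp
    then have "coprime (int p) (2 ^ 4)" by (simp only: coprime_power_right_iff) simp
    moreover have "(2::int) ^ 4 = 16" by simp
    ultimately have "coprime (int p) 16" by metis
    \<comment> \<open>The descent at p only places 16 y in the lattice; p y lies there by
      assumption, and p is coprime to 16.\<close>
    then obtain u v where uv: "u * int p + v * 16 = 1" using bezout_int[of "int p" 16] by auto
    have "y = of_int (u * int p + v * 16) * y" unfolding uv by simp
    also have "\<dots> = of_int u * (of_nat p * y) + of_int v * (16 * y)"
      by (simp add: algebra_simps)
    also have "\<dots> \<in> lat w e f" by (intro lat_intros 16 y)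
    finally show ?thesis .
  qed
  obtain D :: nat where "D > 0" "of_nat D * x \<in> lat s g h" using common_denominator[OF x(1)] .
  then have "D > 0" "of_nat D * x \<in> lat w e f" using sub by auto
  then show ?thesis
  \<comment> \<open>One prime factor of the denominator D is removed at a time.\<close>
  proof (induction D rule: less_induct)
    case (less D)
    show ?case
    proof (cases "D = 1")
      case True
      then show ?thesis using less.prems by simp
    next
      case False
      then obtain p where p: "prime p" "p dvd D" using prime_factor_nat by blast
      then obtain D' where D': "D = p * D'" by blast
      have "of_nat D' * x \<in> K" using x K_mult[OF K_nat] by blast
      moreover have "algebraic_int (of_nat D' * x)" using x by (intro algebraic_int_mult) auto
      moreover have "of_nat p * (of_nat D' * x) \<in> lat w e f" using less.prems D' by (simp add: mult.assoc)
      ultimately have "of_nat D' * x \<in> lat w e f" using prime_step p by blast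
      moreover have "D' < D" "D' > 0" using D' p prime_gt_1_nat less.prems by auto
      ultimately show ?thesis using less.IH by blast
    qed
  qed
qed

end

section \<open>Parity arguments for the descent at 2\<close>

lemma four_dvd_doubleD: "4 dvd 2 * x \<Longrightarrow> even x" for x :: int
  by presburger

lemma even_if_four_dvd: "4 dvd x \<Longrightarrow> even x" for x :: int
  by presburger

text \<open>For omega^2 = j omega + q, the hypotheses say that (P + Q omega) / 4 has integral trace
  and norm. As the discriminant j^2 + 4 q is odd, Z[omega] contains all such numbers; the square of
  the trace minus four times the norm isolates Q.\<close>

lemma quadratic_dvd_4:
  fixes P Q j q :: int
  assumes "odd j" and tr: "4 dvd 2 * P + j * Q" and nm: "16 dvd P\<^sup>2 + j * P * Q - q * Q\<^sup>2"
  shows "4 dvd P" "4 dvd Q"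
proof -
  have "4\<^sup>2 dvd (2 * P + j * Q)\<^sup>2" using tr by (rule dvd_power_same)
  then have "16 dvd (2 * P + j * Q)\<^sup>2" by simp
  then have "16 dvd (2 * P + j * Q)\<^sup>2 - 4 * (P\<^sup>2 + j * P * Q - q * Q\<^sup>2)"
    using nm by (rule dvd_diff[OF _ dvd_mult])
  also have "\<dots> = (j\<^sup>2 + 4 * q) * Q\<^sup>2" by (simp add: power2_eq_square algebra_simps)
  finally have "2 ^ 4 dvd (j\<^sup>2 + 4 * q) * Q\<^sup>2" by simp
  moreover have "coprime (2 ^ 4) (j\<^sup>2 + 4 * q)"
    using \<open>odd j\<close> by (simp only: coprime_power_left_iff) simp
  ultimately have "2 ^ 4 dvd Q\<^sup>2" using coprime_dvd_mult_right_iff by blast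
  then have "4\<^sup>2 dvd Q\<^sup>2" by simp
  then show Q: "4 dvd Q" by (simp only: pow_divides_pow_iff)
  then obtain Q' where Q': "Q = 4 * Q'" by blast
  have "4 dvd 2 * P" using tr unfolding Q' by (simp add: dvd_add_left_iff mult.left_commute)
  then obtain P' where P': "P = 2 * P'" by (auto elim!: dvdE)
  have "16 dvd 4 * (P'\<^sup>2 + 2 * j * P' * Q' - 4 * q * Q'\<^sup>2)"
    using nm unfolding P' Q' by (simp add: power2_eq_square algebra_simps)
  moreover have "16 dvd 4 * x \<Longrightarrow> even x" for x :: int by presburger
  ultimately have "even (P'\<^sup>2 + 2 * j * P' * Q' - 4 * q * Q'\<^sup>2)" by blast
  then have "even P'" by simp
  then show "4 dvd P" unfolding P' by auto
qed

text \<open>The analogue for omega^2 = 2 r, of even discriminant, where the trace only says that P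
  is even. The polynomial x^2 - 2 r is Eisenstein at 2, and P and Q are halved alternately.\<close>

lemma quadratic_dvd_4':
  fixes P Q r :: int
  assumes "odd r" and "even P" and nm: "16 dvd P\<^sup>2 - 2 * r * Q\<^sup>2"
  shows "4 dvd P" "4 dvd Q"
proof -
  obtain P' where P': "P = 2 * P'" using \<open>even P\<close> by blast
  have "16 dvd 2 * (2 * P'\<^sup>2 - r * Q\<^sup>2)"
    using nm unfolding P' by (simp add: power2_eq_square algebra_simps)
  moreover have "16 dvd 2 * x \<Longrightarrow> 8 dvd x \<and> even x" for x :: int by presburger
  ultimately have 8: "8 dvd 2 * P'\<^sup>2 - r * Q\<^sup>2" and "even (2 * P'\<^sup>2 - r * Q\<^sup>2)" by blast+
  then obtain Q' where Q': "Q = 2 * Q'" using \<open>odd r\<close> by auto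
  have "8 dvd 2 * (P'\<^sup>2 - 2 * r * Q'\<^sup>2)"
    using 8 unfolding Q' by (simp add: power2_eq_square algebra_simps)
  moreover have "8 dvd 2 * x \<Longrightarrow> 4 dvd x \<and> even x" for x :: int by presburger
  ultimately have 4: "4 dvd P'\<^sup>2 - 2 * r * Q'\<^sup>2" and "even (P'\<^sup>2 - 2 * r * Q'\<^sup>2)" by blast+
  then obtain P'' where P'': "P' = 2 * P''" by auto
  have "4 dvd 2 * (2 * P''\<^sup>2 - r * Q'\<^sup>2)"
    using 4 unfolding P'' by (simp add: power2_eq_square algebra_simps)
  then have "even (2 * P''\<^sup>2 - r * Q'\<^sup>2)" by (rule four_dvd_doubleD)
  then have "even Q'" using \<open>odd r\<close> by auto
  then show "4 dvd P" "4 dvd Q" by (auto simp: P' P'' Q')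
qed

lemma algebraic_int_quadratic:
  fixes x :: complex
  assumes "x * x = of_int p * x + of_int q"
  shows "algebraic_int x"
  unfolding algebraic_int_altdef_ipoly
  by (rule exI[of _ "[:- q, - p, 1:]"])
     (use assms in \<open>simp add: of_int_hom.map_poly_pCons_hom algebra_simps\<close>)

lemma algebraic_int_if_square:
  fixes x :: complex
  assumes "algebraic_int (x * x)"
  shows "algebraic_int x"
  by (rule algebraic_int_root[OF assms, of "monom 1 2"])
     (auto simp: poly_monom degree_monom_eq power2_eq_square)

lemma lat_algebraic_int:
  assumes "algebraic_int w" "algebraic_int e" "algebraic_int f" "x \<in> lat w e f"
  shows "algebraic_int x"
  using assms by (auto elim!: latE intro!: algebraic_int_add algebraic_int_mult)

lemma two_lat_evenE:
  assumes y: "2 * y = of_int a + of_int b * w + of_int c * e + of_int d * f"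
    and ev: "even a" "even b" "even c" "even d"
  shows "y \<in> lat w e f"
proof -
  obtain a' b' c' d' where eqs: "a = 2 * a'" "b = 2 * b'" "c = 2 * c'" "d = 2 * d'"
    using ev by (meson evenE)
  have "2 * y = 2 * (of_int a' + of_int b' * w + of_int c' * e + of_int d' * f)"
    unfolding y eqs by (simp only: of_int_mult of_int_numeral distrib_left mult.assoc)
  then have "y = of_int a' + of_int b' * w + of_int c' * e + of_int d' * f"
    by (simp only: mult_cancel_left) simp
  then show ?thesis by (rule latI)
qed

text \<open>In this and the next three lemmas P and Q are the coordinates of the relative norm of 2
  y, four times that of y, and a, b, c, d are the coordinates of 2 y; evenness of all four places y
  in the lattice. For odd m the evenness of c and d is supplied by traces.\<close>

lemma parity_odd:
  fixes a b c d m :: int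
  assumes "odd m" "even c" "even d"
    and P: "4 dvd a\<^sup>2 + 4 * b\<^sup>2 + a * d * m + 4 * b * (c - d) - c\<^sup>2 - d\<^sup>2 + c * d * (m - 2)"
    and Q: "4 dvd 2 * a * b + m * b\<^sup>2 + a * (c - d) + m * b * c - 2 * c * d"
  shows "even a" "even b"
proof -
  have "even (a\<^sup>2 + 4 * b\<^sup>2 + a * d * m + 4 * b * (c - d) - c\<^sup>2 - d\<^sup>2 + c * d * (m - 2))"
    by (rule even_if_four_dvd[OF P])
  then show "even a" using assms(2,3) by simp
  have "even (2 * a * b + m * b\<^sup>2 + a * (c - d) + m * b * c - 2 * c * d)" by (rule even_if_four_dvd[OF Q])
  then show "even b" using assms(1,2,3) \<open>even a\<close> by simp
qed

text \<open>All five parameters matter only modulo 4, which leaves 1024 cases. Squares are written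
  as products so that the congruence rules for \<open>mod\<close> reach every variable.\<close>

lemma parity_2_mod_4:
  fixes a b c d l :: int
  assumes P: "4 dvd a\<^sup>2 + b\<^sup>2 * (l\<^sup>2 + l + 1) + 2 * c * d - c\<^sup>2 * (l * (2 * l + 1) + 2)
      - d\<^sup>2 * ((2 * l + 1) * (l + 1) + 2)"
    and Q: "4 dvd 2 * a * b + b\<^sup>2 - (c\<^sup>2 - d\<^sup>2) * (2 * l + 1) - 4 * c * d"
  shows "even a \<and> even b \<and> even c \<and> even d"
proof -
  let ?P = "\<lambda>a b c d l. (a * a + b * b * (l * l + l + 1) + 2 * c * d - c * c * (l * (2 * l + 1) + 2)
      - d * d * ((2 * l + 1) * (l + 1) + 2)) mod (4::int)"
  let ?Q = "\<lambda>a b c d l. (2 * a * b + b * b - (c * c - d * d) * (2 * l + 1) - 4 * c * d) mod (4::int)"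
  have "list_all (\<lambda>a. list_all (\<lambda>b. list_all (\<lambda>c. list_all (\<lambda>d. list_all (\<lambda>l.
      ?P a b c d l = 0 \<and> ?Q a b c d l = 0 \<longrightarrow> a mod 2 = 0 \<and> b mod 2 = 0 \<and> c mod 2 = 0 \<and> d mod 2 = 0)
      [0,1,2,3]) [0,1,2,3]) [0,1,2,3]) [0,1,2,3]) [0,1,2,3]"
    by code_simp
  then have *: "\<forall>a\<in>{0,1,2,3}. \<forall>b\<in>{0,1,2,3}. \<forall>c\<in>{0,1,2,3}. \<forall>d\<in>{0,1,2,3}. \<forall>l\<in>{0,1,2,3}.
      ?P a b c d l = 0 \<and> ?Q a b c d l = 0 \<longrightarrow> a mod 2 = 0 \<and> b mod 2 = 0 \<and> c mod 2 = 0 \<and> d mod 2 = 0"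
    unfolding list_all_iff list.set .
  have r: "x mod 4 \<in> {0,1,2,3}" for x :: int by auto
  have "?P (a mod 4) (b mod 4) (c mod 4) (d mod 4) (l mod 4) = ?P a b c d l"
    by (intro mod_add_cong mod_diff_cong mod_mult_cong refl mod_mod_trivial)
  moreover have "?Q (a mod 4) (b mod 4) (c mod 4) (d mod 4) (l mod 4) = ?Q a b c d l"
    by (intro mod_add_cong mod_diff_cong mod_mult_cong refl mod_mod_trivial)
  moreover have "?P a b c d l = 0" "?Q a b c d l = 0"
    using P Q by (simp_all only: power2_eq_square dvd_eq_mod_eq_0)
  ultimately have "a mod 4 mod 2 = 0 \<and> b mod 4 mod 2 = 0 \<and> c mod 4 mod 2 = 0 \<and> d mod 4 mod 2 = 0"
    using *[THEN bspec, OF r[of a], THEN bspec, OF r[of b], THEN bspec, OF r[of c],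
        THEN bspec, OF r[of d], THEN bspec, OF r[of l]] by argo
  then show ?thesis by (simp add: mod_mod_cancel even_iff_mod_2_eq_zero)
qed

lemma parity_4_mod_8:
  fixes a b c d n :: int
  assumes "odd n" and P: "4 dvd a\<^sup>2 + b\<^sup>2 * (n\<^sup>2 + 1) - (c\<^sup>2 + d\<^sup>2) * (n\<^sup>2 + 1)"
    and Q: "4 dvd 2 * a * b - (c\<^sup>2 - d\<^sup>2 + 2 * c * d * n)"
  shows "even a" "even b" "even c" "even d"
proof -
  obtain r where r: "n = 2 * r + 1" using \<open>odd n\<close> oddE by blast
  have "even (a\<^sup>2 + b\<^sup>2 * (n\<^sup>2 + 1) - (c\<^sup>2 + d\<^sup>2) * (n\<^sup>2 + 1))" by (rule even_if_four_dvd[OF P])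
  then show a: "even a" using \<open>odd n\<close> by simp
  then obtain a' where a': "a = 2 * a'" by blast
  have "even (2 * a * b - (c\<^sup>2 - d\<^sup>2 + 2 * c * d * n))" by (rule even_if_four_dvd[OF Q])
  then have cd: "even c \<longleftrightarrow> even d" by simp
  show c: "even c"
  proof (rule ccontr)
    assume "odd c"
    then have "odd d" using cd by simp
    with \<open>odd c\<close> obtain c' d' where cd': "c = 2 * c' + 1" "d = 2 * d' + 1" by (meson oddE)
    \<comment> \<open>For odd c, d, n and even a, every term is divisible by 4 once c^2 and d^2 are
      taken together, except 2 c d n, which is 2 modulo 4.\<close>
    have "2 * a * b - (c\<^sup>2 - d\<^sup>2 + 2 * c * d * n)
        = 4 * (a' * b - (c'\<^sup>2 + c' - d'\<^sup>2 - d') - (2 * c' * d' + c' + d') * n - r) - 2"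
      unfolding a' cd' r by (simp add: power2_eq_square algebra_simps)
    moreover have "\<not> 4 dvd 4 * x - 2" for x :: int by presburger
    ultimately show False using Q by metis
  qed
  then show d: "even d" using cd by simp
  obtain c' d' where cd': "c = 2 * c'" "d = 2 * d'" using c d by (meson evenE)
  have "a\<^sup>2 + b\<^sup>2 * (n\<^sup>2 + 1) - (c\<^sup>2 + d\<^sup>2) * (n\<^sup>2 + 1)
      = 2 * b\<^sup>2 + 4 * (a'\<^sup>2 + b\<^sup>2 * (r\<^sup>2 + r) - (c'\<^sup>2 + d'\<^sup>2) * (n\<^sup>2 + 1))"
    unfolding a' cd' by (simp add: r power2_eq_square algebra_simps)
  with P have "4 dvd 2 * b\<^sup>2 + 4 * (a'\<^sup>2 + b\<^sup>2 * (r\<^sup>2 + r) - (c'\<^sup>2 + d'\<^sup>2) * (n\<^sup>2 + 1))"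
    by (simp only:)
  then have "4 dvd 2 * b\<^sup>2" by (simp only: dvd_add_left_iff dvd_triv_left)
  then have "even (b\<^sup>2)" by (rule four_dvd_doubleD)
  then show "even b" by simp
qed

text \<open>Q gives b even and c, d of equal parity; P modulo 2 then gives a even, after which P
  modulo 4 is only -2 d^2.\<close>

lemma parity_8:
  fixes a b c d l :: int
  assumes P: "4 dvd a\<^sup>2 + l\<^sup>2 * b\<^sup>2 - (c\<^sup>2 + d\<^sup>2) * (4 * l\<^sup>2 + 1) + (c\<^sup>2 - d\<^sup>2 + 4 * c * d * l)"
    and Q: "4 dvd 2 * a * b + b\<^sup>2 - 2 * (c\<^sup>2 - d\<^sup>2 + 4 * c * d * l)"
  shows "even a" "even b" "even c" "even d"
proof -
  have "even (2 * a * b + b\<^sup>2 - 2 * (c\<^sup>2 - d\<^sup>2 + 4 * c * d * l))" by (rule even_if_four_dvd[OF Q])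
  then show b: "even b" by simp
  then obtain b' where b': "b = 2 * b'" by blast
  have "2 * a * b + b\<^sup>2 - 2 * (c\<^sup>2 - d\<^sup>2 + 4 * c * d * l)
      = 4 * (a * b' + b'\<^sup>2 - 2 * c * d * l) - 2 * (c\<^sup>2 - d\<^sup>2)"
    unfolding b' by (simp add: power2_eq_square algebra_simps)
  moreover have "4 dvd 4 * x - 2 * y \<Longrightarrow> even y" for x y :: int by presburger
  ultimately have "even (c\<^sup>2 - d\<^sup>2)" using Q by metis
  then have cd: "even c \<longleftrightarrow> even d" by simp
  have P': "a\<^sup>2 + l\<^sup>2 * b\<^sup>2 - (c\<^sup>2 + d\<^sup>2) * (4 * l\<^sup>2 + 1) + (c\<^sup>2 - d\<^sup>2 + 4 * c * d * l)
      = a\<^sup>2 - 2 * d\<^sup>2 + 4 * (l\<^sup>2 * b'\<^sup>2 - (c\<^sup>2 + d\<^sup>2) * l\<^sup>2 + c * d * l)"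
    unfolding b' by (simp add: power2_eq_square algebra_simps)
  have "4 dvd x + 4 * y \<Longrightarrow> even x" for x y :: int by presburger
  then have "even (a\<^sup>2 - 2 * d\<^sup>2)" using P unfolding P' by blast
  then show a: "even a" by simp
  then obtain a' where a': "a = 2 * a'" by blast
  have "a\<^sup>2 = 4 * a'\<^sup>2" unfolding a' by (simp add: power2_eq_square)
  then have "4 dvd 4 * (a'\<^sup>2 + (l\<^sup>2 * b'\<^sup>2 - (c\<^sup>2 + d\<^sup>2) * l\<^sup>2 + c * d * l)) - 2 * d\<^sup>2"
    using P unfolding P' by (simp add: algebra_simps)
  then have "4 dvd 2 * d\<^sup>2" by (simp only: dvd_diff_right_iff dvd_triv_left)
  then have "even (d\<^sup>2)" by (rule four_dvd_doubleD)
  then show "even d" by simp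
  then show "even c" using cd by simp
qed

text \<open>The norm forms in the coordinates with respect to the integral bases below. The values of
  \<open>P\<close> and \<open>Q\<close> are the coordinates of the norm relative to the quadratic subfield.\<close>

definition norm_quadratic :: "int \<Rightarrow> int \<Rightarrow> int \<Rightarrow> int \<Rightarrow> int"
  where "norm_quadratic j k P Q = P\<^sup>2 + j * P * Q - k * Q\<^sup>2"

definition P_odd :: "int \<Rightarrow> int \<Rightarrow> int \<Rightarrow> int \<Rightarrow> int \<Rightarrow> int"
  where "P_odd m a b c d = a\<^sup>2 + 4 * b\<^sup>2 + a * d * m + 4 * b * (c - d) - c\<^sup>2 - d\<^sup>2 + c * d * (m - 2)"

definition Q_odd :: "int \<Rightarrow> int \<Rightarrow> int \<Rightarrow> int \<Rightarrow> int \<Rightarrow> int"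
  where "Q_odd m a b c d = 2 * a * b + m * b\<^sup>2 + a * (c - d) + m * b * c - 2 * c * d"

text \<open>The parameters of \<open>norm_quadratic\<close> in the four cases come from t^2 = m t +
  4, w2^2 = w2 + l^2 + l + 1, w4^2 = n^2 + 1 and w8^2 = w8 + l^2.\<close>

definition norm_odd :: "int \<Rightarrow> int \<Rightarrow> int \<Rightarrow> int \<Rightarrow> int \<Rightarrow> int"
  where "norm_odd m a b c d = norm_quadratic m 4 (P_odd m a b c d) (Q_odd m a b c d)"

definition P_2_mod_4 :: "int \<Rightarrow> int \<Rightarrow> int \<Rightarrow> int \<Rightarrow> int \<Rightarrow> int"
  where "P_2_mod_4 l a b c d = a\<^sup>2 + b\<^sup>2 * (l\<^sup>2 + l + 1) + 2 * c * d - c\<^sup>2 * (l * (2 * l + 1) + 2)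
    - d\<^sup>2 * ((2 * l + 1) * (l + 1) + 2)"

definition Q_2_mod_4 :: "int \<Rightarrow> int \<Rightarrow> int \<Rightarrow> int \<Rightarrow> int \<Rightarrow> int"
  where "Q_2_mod_4 l a b c d = 2 * a * b + b\<^sup>2 - (c\<^sup>2 - d\<^sup>2) * (2 * l + 1) - 4 * c * d"

definition norm_2_mod_4 :: "int \<Rightarrow> int \<Rightarrow> int \<Rightarrow> int \<Rightarrow> int \<Rightarrow> int"
  where "norm_2_mod_4 l a b c d = norm_quadratic 1 (l\<^sup>2 + l + 1) (P_2_mod_4 l a b c d) (Q_2_mod_4 l a b c d)"

definition P_4_mod_8 :: "int \<Rightarrow> int \<Rightarrow> int \<Rightarrow> int \<Rightarrow> int \<Rightarrow> int"
  where "P_4_mod_8 n a b c d = a\<^sup>2 + b\<^sup>2 * (n\<^sup>2 + 1) - (c\<^sup>2 + d\<^sup>2) * (n\<^sup>2 + 1)"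

definition Q_4_mod_8 :: "int \<Rightarrow> int \<Rightarrow> int \<Rightarrow> int \<Rightarrow> int \<Rightarrow> int"
  where "Q_4_mod_8 n a b c d = 2 * a * b - (c\<^sup>2 - d\<^sup>2 + 2 * c * d * n)"

definition norm_4_mod_8 :: "int \<Rightarrow> int \<Rightarrow> int \<Rightarrow> int \<Rightarrow> int \<Rightarrow> int"
  where "norm_4_mod_8 n a b c d = norm_quadratic 0 (n\<^sup>2 + 1) (P_4_mod_8 n a b c d) (Q_4_mod_8 n a b c d)"

definition P_8 :: "int \<Rightarrow> int \<Rightarrow> int \<Rightarrow> int \<Rightarrow> int \<Rightarrow> int"
  where "P_8 l a b c d = a\<^sup>2 + l\<^sup>2 * b\<^sup>2 - (c\<^sup>2 + d\<^sup>2) * (4 * l\<^sup>2 + 1) + (c\<^sup>2 - d\<^sup>2 + 4 * c * d * l)"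

definition Q_8 :: "int \<Rightarrow> int \<Rightarrow> int \<Rightarrow> int \<Rightarrow> int \<Rightarrow> int"
  where "Q_8 l a b c d = 2 * a * b + b\<^sup>2 - 2 * (c\<^sup>2 - d\<^sup>2 + 4 * c * d * l)"

definition norm_8 :: "int \<Rightarrow> int \<Rightarrow> int \<Rightarrow> int \<Rightarrow> int \<Rightarrow> int"
  where "norm_8 l a b c d = norm_quadratic 1 (l\<^sup>2) (P_8 l a b c d) (Q_8 l a b c d)"


section \<open>Integral bases for m odd, 2 modulo 4, 4 modulo 8 and 0 modulo 8\<close>

context simplest_quartic
begin

lemma s_el: "s = el 0 1 0 0" and g_el: "g = el 0 0 1 0" and h_el: "h = el 0 0 0 1"
  by (simp_all add: el_def)

lemma \<alpha>_el: "\<alpha> = el (rm / 4) (1 / 4) (1 / 2) 0"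
proof -
  have "\<alpha> = cm / 4 + s / 4 + g / 2" by (rule \<alpha>_coords)
  also have "\<dots> = el (rm / 4) (1 / 4) (1 / 2) 0"
    by (simp add: el_def of_rat_divide of_rat_rm)
  finally show ?thesis .
qed

lemma t_el: "t = el (rm / 2) (1 / 2) 0 0"
proof -
  have "t = (s + cm) / 2" by (simp add: s_def)
  also have "\<dots> = el (rm / 2) (1 / 2) 0 0"
    by (simp add: el_def of_rat_divide of_rat_rm add_divide_distrib)
  finally show ?thesis .
qed

lemma of_int_el: "of_int k = el (of_int k) 0 0 0"
  by (simp add: el_rat)

lemma of_int_scale: "of_int k * el a b c d = el (of_int k * a) (of_int k * b) (of_int k * c) (of_int k * d)"
  using el_scale[of "of_int k"] by simp

lemma half_el:
  assumes "2 * y = el a b c d"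
  shows "y = el (a / 2) (b / 2) (c / 2) (d / 2)"
proof -
  have "y = of_rat (1 / 2) * (2 * y)" by (simp add: of_rat_divide)
  then show ?thesis unfolding assms el_scale by simp
qed

lemma lat_el:
  "of_int a + of_int b * el w1 w2 w3 w4 + of_int c * el e1 e2 e3 e4 + of_int d * el f1 f2 f3 f4
    = el (of_int a + of_int b * w1 + of_int c * e1 + of_int d * f1)
         (of_int b * w2 + of_int c * e2 + of_int d * f2)
         (of_int b * w3 + of_int c * e3 + of_int d * f3)
         (of_int b * w4 + of_int c * e4 + of_int d * f4)"
  unfolding of_int_el[of a] of_int_scale el_add by simp

lemma el_in_latI:
  assumes "x1 = of_int a + of_int b * w1 + of_int c * e1 + of_int d * f1"
    "x2 = of_int b * w2 + of_int c * e2 + of_int d * f2"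
    "x3 = of_int b * w3 + of_int c * e3 + of_int d * f3"
    "x4 = of_int b * w4 + of_int c * e4 + of_int d * f4"
  shows "el x1 x2 x3 x4 \<in> lat (el w1 w2 w3 w4) (el e1 e2 e3 e4) (el f1 f2 f3 f4)"
  by (rule latI[of _ a b _ c _ d]) (simp only: lat_el assms)

lemma sixteen_el: "16 * el a b c d = el (16 * a) (16 * b) (16 * c) (16 * d)"
  using of_int_scale[of 16] by simp

lemma el_in_lat_sgh: "a = of_int a' \<Longrightarrow> b = of_int b' \<Longrightarrow> c = of_int c' \<Longrightarrow> d = of_int d'
    \<Longrightarrow> el a b c d \<in> lat s g h"
  unfolding lat_sgh by blast

lemma dvd_conditions:
  assumes "algebraic_int (el a b c d)"
  shows "of_int T = 8 * U a b c d \<Longrightarrow> 4 dvd T" "of_int N = 16 * Nm a b c d \<Longrightarrow> 16 dvd N"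
    "of_int T = 8 * a \<Longrightarrow> 2 dvd T" "of_int N = 16 * (a\<^sup>2 - rM * b\<^sup>2) \<Longrightarrow> 4 dvd N"
proof -
  note cond = integral_conditions[OF assms]
  show "of_int T = 8 * U a b c d \<Longrightarrow> 4 dvd T" by (rule int_scale_Ints[OF cond(3)]) simp
  show "of_int N = 16 * Nm a b c d \<Longrightarrow> 16 dvd N" by (rule int_scale_Ints[OF cond(4)]) simp
  show "of_int T = 8 * a \<Longrightarrow> 2 dvd T" by (rule int_scale_Ints[OF cond(1)]) simp
  show "of_int N = 16 * (a\<^sup>2 - rM * b\<^sup>2) \<Longrightarrow> 4 dvd N" by (rule int_scale_Ints[OF cond(2)]) simp
qed

lemma ring_of_integers_K_eqI:
  assumes "algebraic_int w" "algebraic_int e" "algebraic_int f" "w \<in> K" "e \<in> K" "f \<in> K"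
    and "\<And>x. x \<in> K \<Longrightarrow> algebraic_int x \<Longrightarrow> x \<in> lat w e f"
  shows "ring_of_integers K = lat w e f"
proof
  show "ring_of_integers K \<subseteq> lat w e f" using assms(7) by (auto simp: ring_of_integers_def)
  show "lat w e f \<subseteq> ring_of_integers K"
  proof
    fix x assume x: "x \<in> lat w e f"
    then have "x \<in> K" by (auto elim!: latE intro!: K_intros assms(4-6))
    then show "x \<in> ring_of_integers K"
      using lat_algebraic_int[OF assms(1-3) x] by (simp add: ring_of_integers_def)
  qed
qed

lemma \<alpha>_algebraic_int: "algebraic_int \<alpha>"
  unfolding algebraic_int_altdef_ipoly
  by (rule exI[of _ "simplest_quartic_poly m"]) (use root in \<open>simp add: simplest_quartic_poly_def\<close>)

lemma conj_el_algebraic_int: "algebraic_int (el a b c d) \<Longrightarrow> algebraic_int (- el a (- b) (- d) c)"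
  using conjugate_algebraic_int by simp

text \<open>With omega = j / 2 + s / v the first two hypotheses say U + V s = P + Q omega, and the
  third expresses omega^2 = j omega + k through its discriminant.\<close>

lemma Nm_eq_norm_quadratic:
  assumes U: "U a b c d = of_int P + of_int j * of_int Q / 2" and V: "V a b c d = of_int Q / of_int v"
    and v: "4 * rM / (of_int v)\<^sup>2 = of_int (j\<^sup>2 + 4 * k)"
  shows "Nm a b c d = of_int (norm_quadratic j k P Q)"
proof -
  have "rM * (V a b c d)\<^sup>2 = 4 * rM / (of_int v)\<^sup>2 * (of_int Q)\<^sup>2 / 4"
    unfolding V by (simp add: power_divide)
  then show ?thesis
    unfolding Nm_def U v norm_quadratic_def by (simp add: expand_simps)
qed

text \<open>Passing from 2 y to y divides U and V by 4 and the absolute norm by 16, which turns the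
  integrality of 2 U and \<open>Nm\<close> at y into these divisibilities.\<close>

lemma half_dvd:
  assumes y: "algebraic_int y" "2 * y = el a b c d"
    and U: "U a b c d = of_int P + of_int j * of_int Q / 2"
    and N: "Nm a b c d = of_int (norm_quadratic j k P Q)"
  shows "4 dvd 2 * P + j * Q" "16 dvd P\<^sup>2 + j * P * Q - k * Q\<^sup>2"
proof -
  note dvd = dvd_conditions[OF y(1)[unfolded half_el[OF y(2)]]]
  have U': "U (a / 2) (b / 2) (c / 2) (d / 2) = U a b c d / 4"
    by (simp add: U_def power_divide expand_simps)
  have V': "V (a / 2) (b / 2) (c / 2) (d / 2) = V a b c d / 4"
    by (simp add: V_def power_divide expand_simps)
  have N': "16 * Nm (a / 2) (b / 2) (c / 2) (d / 2) = Nm a b c d"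
    unfolding Nm_def U' V' by (simp add: power_divide diff_divide_distrib)
  show "4 dvd 2 * P + j * Q" by (rule dvd(1)) (simp add: U' U)
  show "16 dvd P\<^sup>2 + j * P * Q - k * Q\<^sup>2"
    by (rule dvd(2)) (simp only: N' N norm_quadratic_def)
qed

text \<open>Integral bases \<open>1, w, e, f\<close>; the numeral is the largest power of 2, at most 8, dividing \<open>m\<close>,
  except that \<open>e4\<close> and \<open>f4\<close> serve for both 4 and 8, and that
  the basis for odd \<open>m\<close> is \<open>1, t, e1, \<beta>\<close>.\<close>

definition e1 :: complex where "e1 = el (rm / 4) (1 / 4) (1 / 2) 0"
text \<open>The automorphism sends \<open>e1\<close> to \<open>\<beta>\<close>, \<open>e2\<close> to
  \<open>f2\<close> and \<open>e4\<close> to the negative of \<open>f4\<close>, so that integrality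
  has to be shown only for one element of each pair.\<close>

definition \<beta> :: complex where "\<beta> = el (rm / 4) (- 1 / 4) 0 (1 / 2)"
definition w2 :: complex where "w2 = el (1 / 2) (1 / 4) 0 0"
definition e2 :: complex where "e2 = el 0 0 (1 / 2) 0"
definition f2 :: complex where "f2 = el 0 0 0 (1 / 2)"
definition w4 :: complex where "w4 = el 0 (1 / 4) 0 0"
definition e4 :: complex where "e4 = el 0 0 (1 / 4) (1 / 4)"
definition f4 :: complex where "f4 = el 0 0 (1 / 4) (- 1 / 4)"
definition w8 :: complex where "w8 = el (1 / 2) (1 / 8) 0 0"

lemma e1_eq: "e1 = \<alpha>"
  unfolding e1_def by (rule \<alpha>_el[symmetric])

lemma rel_norm_odd:
  assumes el: "el A B C D = of_int a + of_int b * t + of_int c * e1 + of_int d * \<beta>"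
  shows "U A B C D = of_int (P_odd m a b c d) + of_int m * of_int (Q_odd m a b c d) / 2"
    "V A B C D = of_int (Q_odd m a b c d) / of_int 2"
proof -
  note r_def = rm_def
  define ra rb rc rd :: rat where "ra = of_int a" "rb = of_int b" "rc = of_int c" "rd = of_int d"
  note coords = el_eqD[OF el[unfolded t_el e1_def \<beta>_def lat_el], folded ra_rb_rc_rd_def]
  define p where "p = ra\<^sup>2 + 4 * rb\<^sup>2 + ra * rd * rm + 4 * rb * (rc - rd) - rc\<^sup>2 - rd\<^sup>2 + rc * rd * (rm - 2)"
  define q where "q = 2 * ra * rb + rm * rb\<^sup>2 + ra * (rc - rd) + rm * rb * rc - 2 * rc * rd"
  have p: "of_int (P_odd m a b c d) = p"
    by (simp add: p_def P_odd_def ra_rb_rc_rd_def r_def)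
  have q: "of_int (Q_odd m a b c d) = q"
    by (simp add: q_def Q_odd_def ra_rb_rc_rd_def r_def)
  show "U A B C D = of_int (P_odd m a b c d) + of_int m * of_int (Q_odd m a b c d) / 2"
    unfolding coords U_def rM_def p q p_def q_def
    by (simp add: expand_simps flip: rm_def)
  show "V A B C D = of_int (Q_odd m a b c d) / of_int 2"
    unfolding coords V_def q q_def
    by (simp add: expand_simps)
qed

lemma Nm_odd:
  assumes el: "el A B C D = of_int a + of_int b * t + of_int c * e1 + of_int d * \<beta>"
  shows "Nm A B C D = of_int (norm_odd m a b c d)"
  unfolding norm_odd_def
proof (rule Nm_eq_norm_quadratic[OF rel_norm_odd[OF el]])
  note r_def = rm_def
  show "4 * rM / (of_int 2)\<^sup>2 = of_int (m\<^sup>2 + 4 * 4)"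
    by (simp add: rM_def r_def expand_simps)
qed

lemma sixteen_odd:
  shows "16 * t \<in> lat s g h" "16 * e1 \<in> lat s g h" "16 * \<beta> \<in> lat s g h"
proof -
  show "16 * t \<in> lat s g h" unfolding t_el e1_def \<beta>_def sixteen_el
    by (rule el_in_lat_sgh[of _ "8 * m" _ "8" _ "0" _ "0"]) (simp_all add: rm_def)
  show "16 * e1 \<in> lat s g h" unfolding t_el e1_def \<beta>_def sixteen_el
    by (rule el_in_lat_sgh[of _ "4 * m" _ "4" _ "8" _ "0"]) (simp_all add: rm_def)
  show "16 * \<beta> \<in> lat s g h" unfolding t_el e1_def \<beta>_def sixteen_el
    by (rule el_in_lat_sgh[of _ "4 * m" _ "- 4" _ "0" _ "8"]) (simp_all add: rm_def)
qed

lemma ring_of_integers_odd: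
  assumes "odd m"
  shows "ring_of_integers K = lat t e1 \<beta>"
proof (rule ring_of_integers_K_eqI)
  note els = t_el e1_def \<beta>_def
  show "t \<in> K" "e1 \<in> K" "\<beta> \<in> K" unfolding els by (rule el_in_K)+
  have "t * t = of_int m * t + of_int 4" using table(1) by (simp add: cm_def)
  then show "algebraic_int t" by (rule algebraic_int_quadratic)
  show e_int: "algebraic_int e1" unfolding e1_eq by (rule \<alpha>_algebraic_int)
  show "algebraic_int \<beta>"
    using conjugate_algebraic_int[OF e_int[unfolded els]] by (simp add: \<beta>_def)
  fix x assume x: "x \<in> K" "algebraic_int x"
  show "x \<in> lat t e1 \<beta>"
  proof (rule integers_in_lat[OF _ _ _ sixteen_odd _ x])
    show "s \<in> lat t e1 \<beta>" unfolding els s_el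
      by (rule el_in_latI[of _ "- m" "2" _ "0" _ "0"]) (simp_all add: rm_def)
    show "g \<in> lat t e1 \<beta>" unfolding els g_el
      by (rule el_in_latI[of _ "0" "- 1" _ "2" _ "0"]) (simp_all add: rm_def)
    show "h \<in> lat t e1 \<beta>" unfolding els h_el
      by (rule el_in_latI[of _ "- m" "1" _ "0" _ "2"]) (simp_all add: rm_def)
    fix y assume y: "y \<in> K" "algebraic_int y" "2 * y \<in> lat t e1 \<beta>"
    then obtain a b c d where 2: "2 * y = of_int a + of_int b * t + of_int c * e1 + of_int d * \<beta>"
      by (elim latE)
    obtain A B C D where el: "2 * y = el A B C D" using K_mult[OF K_numeral y(1)] by (rule K_E)
    note eq = trans[OF el[symmetric] 2]
    note T = half_dvd[OF y(2) el rel_norm_odd(1)[OF eq] Nm_odd[OF eq, unfolded norm_odd_def]]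
    note PQ = quadratic_dvd_4[OF assms T]
    have y_el: "y = el (A / 2) (B / 2) (C / 2) (D / 2)" by (rule half_el[OF el])
    note dvd = dvd_conditions(3,4)[OF y(2)[unfolded y_el]]
    have AB: "A = of_int a + of_int b * (rm / 2) + of_int c * (rm / 4) + of_int d * (rm / 4)"
      "B = of_int b / 2 + of_int c / 4 - of_int d / 4"
      using eq[unfolded els lat_el el_eq_iff] by simp_all
    \<comment> \<open>The number is twice the absolute trace of y.\<close>
    have "2 dvd 4 * a + 2 * b * m + (c + d) * m"
      by (rule dvd(1)) (simp add: AB rm_def algebra_simps)
    then have cd: "even (c + d)" using assms by simp
    define ra rb rc rd :: rat where "ra = of_int a" "rb = of_int b" "rc = of_int c" "rd = of_int d"
    \<comment> \<open>Twice the relative trace of y has coordinates 2 a + d m and 2 b + c - d with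
      respect to 1 and t; its norm is four times an integer.\<close>
    have "4 dvd (2 * a + d * m)\<^sup>2 + m * (2 * a + d * m) * (2 * b + c - d) - 4 * (2 * b + c - d)\<^sup>2"
    proof (rule dvd(2))
      have "16 * ((A / 2)\<^sup>2 - rM * (B / 2)\<^sup>2) = (2 * ra + rd * rm)\<^sup>2
          + rm * (2 * ra + rd * rm) * (2 * rb + rc - rd) - 4 * (2 * rb + rc - rd)\<^sup>2"
        unfolding AB[folded ra_rb_rc_rd_def] rM_def by (simp add: expand_simps)
      then show "of_int ((2 * a + d * m)\<^sup>2 + m * (2 * a + d * m) * (2 * b + c - d)
          - 4 * (2 * b + c - d)\<^sup>2) = 16 * ((A / 2)\<^sup>2 - rM * (B / 2)\<^sup>2)"
        by (simp add: ra_rb_rc_rd_def rm_def)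
    qed
    then have "even ((2 * a + d * m)\<^sup>2 + m * (2 * a + d * m) * (2 * b + c - d) - 4 * (2 * b + c - d)\<^sup>2)"
      by (rule even_if_four_dvd)
    then have d: "even d" using cd assms by auto
    then have c: "even c" using cd by simp
    show "y \<in> lat t e1 \<beta>"
      by (rule two_lat_evenE[OF 2 parity_odd[OF assms c d PQ[unfolded P_odd_def Q_odd_def]] c d])
  qed
qed

lemma rel_norm_2_mod_4:
  assumes m: "m = 2 * (2 * l + 1)" and el: "el A B C D = of_int a + of_int b * w2 + of_int c * e2 + of_int d * f2"
  shows "U A B C D = of_int (P_2_mod_4 l a b c d) + of_int 1 * of_int (Q_2_mod_4 l a b c d) / 2"
    "V A B C D = of_int (Q_2_mod_4 l a b c d) / of_int 4"
proof -
  define r :: rat where "r = of_int l"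
  have rm: "rm = 2 * (2 * r + 1)" unfolding rm_def r_def using m by simp
  define ra rb rc rd :: rat where "ra = of_int a" "rb = of_int b" "rc = of_int c" "rd = of_int d"
  note coords = el_eqD[OF el[unfolded w2_def e2_def f2_def lat_el], folded ra_rb_rc_rd_def]
  define p where "p = ra\<^sup>2 + rb\<^sup>2 * (r\<^sup>2 + r + 1) + 2 * rc * rd - rc\<^sup>2 * (r * (2 * r + 1) + 2)
    - rd\<^sup>2 * ((2 * r + 1) * (r + 1) + 2)"
  define q where "q = 2 * ra * rb + rb\<^sup>2 - (rc\<^sup>2 - rd\<^sup>2) * (2 * r + 1) - 4 * rc * rd"
  have p: "of_int (P_2_mod_4 l a b c d) = p"
    by (simp add: p_def P_2_mod_4_def ra_rb_rc_rd_def r_def)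
  have q: "of_int (Q_2_mod_4 l a b c d) = q"
    by (simp add: q_def Q_2_mod_4_def ra_rb_rc_rd_def r_def)
  show "U A B C D = of_int (P_2_mod_4 l a b c d) + of_int 1 * of_int (Q_2_mod_4 l a b c d) / 2"
    unfolding coords U_def rM_def rm p q p_def q_def
    by (simp add: expand_simps)
  show "V A B C D = of_int (Q_2_mod_4 l a b c d) / of_int 4"
    unfolding coords V_def rm q q_def
    by (simp add: expand_simps)
qed

lemma Nm_2_mod_4:
  assumes m: "m = 2 * (2 * l + 1)" and el: "el A B C D = of_int a + of_int b * w2 + of_int c * e2 + of_int d * f2"
  shows "Nm A B C D = of_int (norm_2_mod_4 l a b c d)"
  unfolding norm_2_mod_4_def
proof (rule Nm_eq_norm_quadratic[OF rel_norm_2_mod_4[OF m el]])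
  define r :: rat where "r = of_int l"
  have rm: "rm = 2 * (2 * r + 1)" unfolding rm_def r_def using m by simp
  show "4 * rM / (of_int 4)\<^sup>2 = of_int (1\<^sup>2 + 4 * (l\<^sup>2 + l + 1))"
    by (simp add: rM_def rm r_def expand_simps)
qed

lemma sixteen_2_mod_4:
  shows "16 * w2 \<in> lat s g h" "16 * e2 \<in> lat s g h" "16 * f2 \<in> lat s g h"
proof -
  show "16 * w2 \<in> lat s g h" unfolding w2_def e2_def f2_def sixteen_el
    by (rule el_in_lat_sgh[of _ "8" _ "4" _ "0" _ "0"]) simp_all
  show "16 * e2 \<in> lat s g h" unfolding w2_def e2_def f2_def sixteen_el
    by (rule el_in_lat_sgh[of _ "0" _ "0" _ "8" _ "0"]) simp_all
  show "16 * f2 \<in> lat s g h" unfolding w2_def e2_def f2_def sixteen_el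
    by (rule el_in_lat_sgh[of _ "0" _ "0" _ "0" _ "8"]) simp_all
qed

lemma ring_of_integers_2_mod_4:
  assumes m: "m = 2 * (2 * l + 1)"
  shows "ring_of_integers K = lat w2 e2 f2"
proof (rule ring_of_integers_K_eqI)
  define r :: rat where "r = of_int l"
  have rm: "rm = 2 * (2 * r + 1)" unfolding rm_def r_def using m by simp
  note els = w2_def e2_def f2_def
  show "w2 \<in> K" "e2 \<in> K" "f2 \<in> K" unfolding els by (rule el_in_K)+
  have "w2 * w2 = of_int 1 * w2 + of_int (l\<^sup>2 + l + 1)"
    unfolding els of_int_scale of_int_el[of "l\<^sup>2 + l + 1"] el_mult el_add el_eq_iff
    by (simp add: r_def rM_def rm expand_simps)
  then show w_int: "algebraic_int w2" by (rule algebraic_int_quadratic)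
  have ee: "e2 * e2 = of_int (l * (2 * l + 1) + 2) + of_int (2 * l + 1) * w2"
    unfolding els of_int_scale of_int_el[of "l * (2 * l + 1) + 2"] el_mult el_add el_eq_iff
    by (simp add: r_def rM_def rm expand_simps)
  have "algebraic_int (of_int (l * (2 * l + 1) + 2) + of_int (2 * l + 1) * w2)"
    by (intro algebraic_int_add algebraic_int_mult algebraic_int_of_int w_int)
  then show e_int: "algebraic_int e2" unfolding ee[symmetric] by (rule algebraic_int_if_square)
  show "algebraic_int f2"
    using conjugate_algebraic_int[OF e_int[unfolded els]] unfolding els by simp

  fix x assume x: "x \<in> K" "algebraic_int x"
  show "x \<in> lat w2 e2 f2"
  proof (rule integers_in_lat[OF _ _ _ sixteen_2_mod_4 _ x])
    show "s \<in> lat w2 e2 f2" unfolding els s_el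
      by (rule el_in_latI[of _ "- 2" "4" _ "0" _ "0"]) simp_all
    show "g \<in> lat w2 e2 f2" unfolding els g_el
      by (rule el_in_latI[of _ "0" "0" _ "2" _ "0"]) simp_all
    show "h \<in> lat w2 e2 f2" unfolding els h_el
      by (rule el_in_latI[of _ "0" "0" _ "0" _ "2"]) simp_all
    fix y assume y: "y \<in> K" "algebraic_int y" "2 * y \<in> lat w2 e2 f2"
    then obtain a b c d where 2: "2 * y = of_int a + of_int b * w2 + of_int c * e2 + of_int d * f2"
      by (elim latE)
    obtain A B C D where el: "2 * y = el A B C D" using K_mult[OF K_numeral y(1)] by (rule K_E)
    note eq = trans[OF el[symmetric] 2]
    note T = half_dvd[OF y(2) el rel_norm_2_mod_4(1)[OF m eq] Nm_2_mod_4[OF m eq, unfolded norm_2_mod_4_def]]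
    note PQ = quadratic_dvd_4[OF odd_one T]
    note even_abcd = parity_2_mod_4[OF PQ[unfolded P_2_mod_4_def Q_2_mod_4_def]]
    show "y \<in> lat w2 e2 f2"
      by (rule two_lat_evenE[OF 2]) (use even_abcd in simp_all)
  qed
qed

lemma rel_norm_4_mod_8:
  assumes m: "m = 4 * n" and el: "el A B C D = of_int a + of_int b * w4 + of_int c * e4 + of_int d * f4"
  shows "U A B C D = of_int (P_4_mod_8 n a b c d) + of_int 0 * of_int (Q_4_mod_8 n a b c d) / 2"
    "V A B C D = of_int (Q_4_mod_8 n a b c d) / of_int 4"
proof -
  define r :: rat where "r = of_int n"
  have rm: "rm = 4 * r" unfolding rm_def r_def using m by simp
  define ra rb rc rd :: rat where "ra = of_int a" "rb = of_int b" "rc = of_int c" "rd = of_int d"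
  note coords = el_eqD[OF el[unfolded w4_def e4_def f4_def lat_el], folded ra_rb_rc_rd_def]
  define p where "p = ra\<^sup>2 + rb\<^sup>2 * (r\<^sup>2 + 1) - (rc\<^sup>2 + rd\<^sup>2) * (r\<^sup>2 + 1)"
  define q where "q = 2 * ra * rb - (rc\<^sup>2 - rd\<^sup>2 + 2 * rc * rd * r)"
  have p: "of_int (P_4_mod_8 n a b c d) = p"
    by (simp add: p_def P_4_mod_8_def ra_rb_rc_rd_def r_def)
  have q: "of_int (Q_4_mod_8 n a b c d) = q"
    by (simp add: q_def Q_4_mod_8_def ra_rb_rc_rd_def r_def)
  show "U A B C D = of_int (P_4_mod_8 n a b c d) + of_int 0 * of_int (Q_4_mod_8 n a b c d) / 2"
    unfolding coords U_def rM_def rm p q p_def q_def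
    by (simp add: expand_simps)
  show "V A B C D = of_int (Q_4_mod_8 n a b c d) / of_int 4"
    unfolding coords V_def rm q q_def
    by (simp add: expand_simps)
qed

lemma Nm_4_mod_8:
  assumes m: "m = 4 * n" and el: "el A B C D = of_int a + of_int b * w4 + of_int c * e4 + of_int d * f4"
  shows "Nm A B C D = of_int (norm_4_mod_8 n a b c d)"
  unfolding norm_4_mod_8_def
proof (rule Nm_eq_norm_quadratic[OF rel_norm_4_mod_8[OF m el]])
  define r :: rat where "r = of_int n"
  have rm: "rm = 4 * r" unfolding rm_def r_def using m by simp
  show "4 * rM / (of_int 4)\<^sup>2 = of_int (0\<^sup>2 + 4 * (n\<^sup>2 + 1))"
    by (simp add: rM_def rm r_def expand_simps)
qed

lemma sixteen_4_mod_8: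
  shows "16 * w4 \<in> lat s g h" "16 * e4 \<in> lat s g h" "16 * f4 \<in> lat s g h"
proof -
  show "16 * w4 \<in> lat s g h" unfolding w4_def e4_def f4_def sixteen_el
    by (rule el_in_lat_sgh[of _ "0" _ "4" _ "0" _ "0"]) simp_all
  show "16 * e4 \<in> lat s g h" unfolding w4_def e4_def f4_def sixteen_el
    by (rule el_in_lat_sgh[of _ "0" _ "0" _ "4" _ "4"]) simp_all
  show "16 * f4 \<in> lat s g h" unfolding w4_def e4_def f4_def sixteen_el
    by (rule el_in_lat_sgh[of _ "0" _ "0" _ "4" _ "- 4"]) simp_all
qed

lemma ring_of_integers_4_mod_8:
  assumes m: "m = 4 * n" and n: "odd n"
  shows "ring_of_integers K = lat w4 e4 f4"
proof (rule ring_of_integers_K_eqI)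
  define r :: rat where "r = of_int n"
  have rm: "rm = 4 * r" unfolding rm_def r_def using m by simp
  note els = w4_def e4_def f4_def
  show "w4 \<in> K" "e4 \<in> K" "f4 \<in> K" unfolding els by (rule el_in_K)+
  have "w4 * w4 = of_int 0 * w4 + of_int (n\<^sup>2 + 1)"
    unfolding els of_int_scale of_int_el[of "n\<^sup>2 + 1"] el_mult el_add el_eq_iff
    by (simp add: r_def rM_def rm expand_simps)
  then show w_int: "algebraic_int w4" by (rule algebraic_int_quadratic)
  have ee: "e4 * e4 = of_int (n\<^sup>2 + 1) + of_int 1 * w4"
    unfolding els of_int_scale of_int_el[of "n\<^sup>2 + 1"] el_mult el_add el_eq_iff
    by (simp add: r_def rM_def rm expand_simps)
  have "algebraic_int (of_int (n\<^sup>2 + 1) + of_int 1 * w4)"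
    by (intro algebraic_int_add algebraic_int_mult algebraic_int_of_int w_int)
  then show e_int: "algebraic_int e4" unfolding ee[symmetric] by (rule algebraic_int_if_square)
  show "algebraic_int f4"
    using conj_el_algebraic_int[OF e_int[unfolded els]] unfolding els el_minus by simp

  fix x assume x: "x \<in> K" "algebraic_int x"
  show "x \<in> lat w4 e4 f4"
  proof (rule integers_in_lat[OF _ _ _ sixteen_4_mod_8 _ x])
    show "s \<in> lat w4 e4 f4" unfolding els s_el
      by (rule el_in_latI[of _ "0" "4" _ "0" _ "0"]) simp_all
    show "g \<in> lat w4 e4 f4" unfolding els g_el
      by (rule el_in_latI[of _ "0" "0" _ "2" _ "2"]) simp_all
    show "h \<in> lat w4 e4 f4" unfolding els h_el
      by (rule el_in_latI[of _ "0" "0" _ "2" _ "- 2"]) simp_all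
    fix y assume y: "y \<in> K" "algebraic_int y" "2 * y \<in> lat w4 e4 f4"
    then obtain a b c d where 2: "2 * y = of_int a + of_int b * w4 + of_int c * e4 + of_int d * f4"
      by (elim latE)
    obtain A B C D where el: "2 * y = el A B C D" using K_mult[OF K_numeral y(1)] by (rule K_E)
    note eq = trans[OF el[symmetric] 2]
    note T = half_dvd[OF y(2) el rel_norm_4_mod_8(1)[OF m eq] Nm_4_mod_8[OF m eq, unfolded norm_4_mod_8_def]]
    obtain l where l: "n = 2 * l + 1" using n oddE by blast
    \<comment> \<open>The discriminant of \<open>w4\<close> is even, so the second quadratic lemma
      is used; for odd n it applies because n^2 + 1 is twice an odd number.\<close>
    have n2: "n\<^sup>2 + 1 = 2 * (2 * (l\<^sup>2 + l) + 1)"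
      unfolding l by (simp add: power2_eq_square algebra_simps)
    have PQ: "4 dvd P_4_mod_8 n a b c d" "4 dvd Q_4_mod_8 n a b c d"
      by (rule quadratic_dvd_4'[of "2 * (l\<^sup>2 + l) + 1"]; use T n2 in \<open>simp add: four_dvd_doubleD\<close>)+
    note even_abcd = parity_4_mod_8[OF n PQ[unfolded P_4_mod_8_def Q_4_mod_8_def]]
    show "y \<in> lat w4 e4 f4"
      by (rule two_lat_evenE[OF 2]) (use even_abcd in simp_all)
  qed
qed

lemma rel_norm_8:
  assumes m: "m = 8 * l" and el: "el A B C D = of_int a + of_int b * w8 + of_int c * e4 + of_int d * f4"
  shows "U A B C D = of_int (P_8 l a b c d) + of_int 1 * of_int (Q_8 l a b c d) / 2"
    "V A B C D = of_int (Q_8 l a b c d) / of_int 8"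
proof -
  define r :: rat where "r = of_int l"
  have rm: "rm = 8 * r" unfolding rm_def r_def using m by simp
  define ra rb rc rd :: rat where "ra = of_int a" "rb = of_int b" "rc = of_int c" "rd = of_int d"
  note coords = el_eqD[OF el[unfolded w8_def e4_def f4_def lat_el], folded ra_rb_rc_rd_def]
  define p where "p = ra\<^sup>2 + r\<^sup>2 * rb\<^sup>2 - (rc\<^sup>2 + rd\<^sup>2) * (4 * r\<^sup>2 + 1) + (rc\<^sup>2 - rd\<^sup>2 + 4 * rc * rd * r)"
  define q where "q = 2 * ra * rb + rb\<^sup>2 - 2 * (rc\<^sup>2 - rd\<^sup>2 + 4 * rc * rd * r)"
  have p: "of_int (P_8 l a b c d) = p"
    by (simp add: p_def P_8_def ra_rb_rc_rd_def r_def)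
  have q: "of_int (Q_8 l a b c d) = q"
    by (simp add: q_def Q_8_def ra_rb_rc_rd_def r_def)
  show "U A B C D = of_int (P_8 l a b c d) + of_int 1 * of_int (Q_8 l a b c d) / 2"
    unfolding coords U_def rM_def rm p q p_def q_def
    by (simp add: expand_simps)
  show "V A B C D = of_int (Q_8 l a b c d) / of_int 8"
    unfolding coords V_def rm q q_def
    by (simp add: expand_simps)
qed

lemma Nm_8:
  assumes m: "m = 8 * l" and el: "el A B C D = of_int a + of_int b * w8 + of_int c * e4 + of_int d * f4"
  shows "Nm A B C D = of_int (norm_8 l a b c d)"
  unfolding norm_8_def
proof (rule Nm_eq_norm_quadratic[OF rel_norm_8[OF m el]])
  define r :: rat where "r = of_int l"
  have rm: "rm = 8 * r" unfolding rm_def r_def using m by simp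
  show "4 * rM / (of_int 8)\<^sup>2 = of_int (1\<^sup>2 + 4 * (l\<^sup>2))"
    by (simp add: rM_def rm r_def expand_simps)
qed

lemma sixteen_8:
  shows "16 * w8 \<in> lat s g h" "16 * e4 \<in> lat s g h" "16 * f4 \<in> lat s g h"
proof -
  show "16 * w8 \<in> lat s g h" unfolding w8_def e4_def f4_def sixteen_el
    by (rule el_in_lat_sgh[of _ "8" _ "2" _ "0" _ "0"]) simp_all
  show "16 * e4 \<in> lat s g h" unfolding w8_def e4_def f4_def sixteen_el
    by (rule el_in_lat_sgh[of _ "0" _ "0" _ "4" _ "4"]) simp_all
  show "16 * f4 \<in> lat s g h" unfolding w8_def e4_def f4_def sixteen_el
    by (rule el_in_lat_sgh[of _ "0" _ "0" _ "4" _ "- 4"]) simp_all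
qed

lemma ring_of_integers_8:
  assumes m: "m = 8 * l"
  shows "ring_of_integers K = lat w8 e4 f4"
proof (rule ring_of_integers_K_eqI)
  define r :: rat where "r = of_int l"
  have rm: "rm = 8 * r" unfolding rm_def r_def using m by simp
  note els = w8_def e4_def f4_def
  show "w8 \<in> K" "e4 \<in> K" "f4 \<in> K" unfolding els by (rule el_in_K)+
  have "w8 * w8 = of_int 1 * w8 + of_int (l\<^sup>2)"
    unfolding els of_int_scale of_int_el[of "l\<^sup>2"] el_mult el_add el_eq_iff
    by (simp add: r_def rM_def rm expand_simps)
  then show w_int: "algebraic_int w8" by (rule algebraic_int_quadratic)
  have ee: "e4 * e4 = of_int (4 * l\<^sup>2) + of_int (2) * w8"
    unfolding els of_int_scale of_int_el[of "4 * l\<^sup>2"] el_mult el_add el_eq_iff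
    by (simp add: r_def rM_def rm expand_simps)
  have "algebraic_int (of_int (4 * l\<^sup>2) + of_int (2) * w8)"
    by (intro algebraic_int_add algebraic_int_mult algebraic_int_of_int w_int)
  then show e_int: "algebraic_int e4" unfolding ee[symmetric] by (rule algebraic_int_if_square)
  show "algebraic_int f4"
    using conj_el_algebraic_int[OF e_int[unfolded els]] unfolding els el_minus by simp

  fix x assume x: "x \<in> K" "algebraic_int x"
  show "x \<in> lat w8 e4 f4"
  proof (rule integers_in_lat[OF _ _ _ sixteen_8 _ x])
    show "s \<in> lat w8 e4 f4" unfolding els s_el
      by (rule el_in_latI[of _ "- 4" "8" _ "0" _ "0"]) simp_all
    show "g \<in> lat w8 e4 f4" unfolding els g_el
      by (rule el_in_latI[of _ "0" "0" _ "2" _ "2"]) simp_all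
    show "h \<in> lat w8 e4 f4" unfolding els h_el
      by (rule el_in_latI[of _ "0" "0" _ "2" _ "- 2"]) simp_all
    fix y assume y: "y \<in> K" "algebraic_int y" "2 * y \<in> lat w8 e4 f4"
    then obtain a b c d where 2: "2 * y = of_int a + of_int b * w8 + of_int c * e4 + of_int d * f4"
      by (elim latE)
    obtain A B C D where el: "2 * y = el A B C D" using K_mult[OF K_numeral y(1)] by (rule K_E)
    note eq = trans[OF el[symmetric] 2]
    note T = half_dvd[OF y(2) el rel_norm_8(1)[OF m eq] Nm_8[OF m eq, unfolded norm_8_def]]
    note PQ = quadratic_dvd_4[OF odd_one T]
    note even_abcd = parity_8[OF PQ[unfolded P_8_def Q_8_def]]
    show "y \<in> lat w8 e4 f4"
      by (rule two_lat_evenE[OF 2]) (use even_abcd in simp_all)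
  qed
qed

end

section \<open>Primitive elements and characteristic polynomials\<close>

lemma algebraic_int_sum:
  fixes f :: "'b \<Rightarrow> complex"
  shows "(\<And>i. i \<in> I \<Longrightarrow> algebraic_int (f i)) \<Longrightarrow> algebraic_int (\<Sum>i\<in>I. f i)"
  by (induction I rule: infinite_finite_induct) (auto intro: algebraic_int_add)

lemma algebraic_int_coeff_mult:
  fixes p q :: "complex poly"
  assumes "\<And>i. algebraic_int (coeff p i)" "\<And>i. algebraic_int (coeff q i)"
  shows "algebraic_int (coeff (p * q) i)"
  unfolding coeff_mult by (intro algebraic_int_sum algebraic_int_mult assms)

lemma poly_linear_factors:
  fixes x :: "'a::comm_ring_1"
  shows "poly (\<Prod>r\<leftarrow>rs. [:- r, 1:]) x = (\<Prod>r\<leftarrow>rs. x - r)"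
  by (induction rs) (simp_all del: mult_pCons_left mult_pCons_right)

context simplest_quartic
begin

lemma K_basis: "is_rat_basis K [1, s, g, h]"
proof -
  have one: "1 = el 1 0 0 0" by (simp add: el_1)
  have dist: "distinct [1, s, g, h]"
    unfolding one s_el g_el h_el by (simp add: el_eq_iff)
  have comb: "of_rat a * 1 + (of_rat b * s + (of_rat c * g + of_rat d * h)) = el a b c d" for a b c d
    by (simp add: el_def)
  have "rat_complex.independent {1, s, g, h}"
  proof (rule rat_complex.independent_if_scalars_zero)
    fix f x assume "(\<Sum>x\<in>{1, s, g, h}. of_rat (f x) * x) = 0" and x: "x \<in> {1, s, g, h}"
    then have "of_rat (f 1) * 1 + (of_rat (f s) * s + (of_rat (f g) * g + of_rat (f h) * h)) = 0"
      using dist by simp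
    then show "f x = 0" using x unfolding comb el_eq_0 by blast
  qed simp
  moreover have "rat_complex.span {1, s, g, h} = K"
  proof
    show "rat_complex.span {1, s, g, h} \<subseteq> K"
      by (rule rat_complex.span_minimal)
        (auto simp: rat_complex.subspace_def intro!: K_intros K_int[of 0, simplified])
    show "K \<subseteq> rat_complex.span {1, s, g, h}"
    proof
      fix x assume "x \<in> K"
      then obtain a b c d where x: "x = el a b c d" by (rule K_E)
      show "x \<in> rat_complex.span {1, s, g, h}"
        unfolding x comb[symmetric]
        by (intro rat_complex.span_add rat_complex.span_scale rat_complex.span_base) auto
    qed
  qed
  ultimately show ?thesis using dist by (simp add: is_rat_basis_def)
qed

lemma card_K_basis: "card {1, s, g, h} = 4"
  using distinct_card[of "[1, s, g, h]"] K_basis by (simp add: is_rat_basis_def)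

definition conjugates :: "rat \<Rightarrow> rat \<Rightarrow> rat \<Rightarrow> rat \<Rightarrow> complex list"
  where "conjugates a b c d =
    [el a b c d, el a (- b) (- d) c, el a b (- c) (- d), el a (- b) d (- c)]"

lemma distinct_conjugates: "c \<noteq> 0 \<or> d \<noteq> 0 \<Longrightarrow> distinct (conjugates a b c d)"
  by (auto simp: conjugates_def el_eq_iff)

lemma conjugates_root:
  fixes p :: "rat poly"
  assumes "poly (map_poly of_rat p) (el a b c d) = 0" "x \<in> set (conjugates a b c d)"
  shows "poly (map_poly of_rat p) x = 0"
proof -
  note 1 = conjugate_root[OF assms(1)]
  note 2 = conjugate_root[OF 1]
  note 3 = conjugate_root[OF 2]
  show ?thesis using assms 1 2 3 by (auto simp: conjugates_def)
qed

text \<open>Stands in for the minimal polynomial: the distinct conjugates are too many roots for a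
  nonzero polynomial of degree below 4.\<close>

lemma complex_poly_eq_0:
  fixes p :: "complex poly"
  assumes "c \<noteq> 0 \<or> d \<noteq> 0" "\<And>x. x \<in> set (conjugates a b c d) \<Longrightarrow> poly p x = 0" "degree p < 4"
  shows "p = 0"
proof (rule ccontr)
  assume "p \<noteq> 0"
  have "card (set (conjugates a b c d)) = 4"
    using distinct_card[OF distinct_conjugates[OF assms(1)]] by (simp add: conjugates_def)
  moreover have "card (set (conjugates a b c d)) \<le> card {x. poly p x = 0}"
    using assms(2) \<open>p \<noteq> 0\<close> by (intro card_mono) (auto simp: poly_roots_finite)
  moreover have "card {x. poly p x = 0} \<le> degree p"
    using \<open>p \<noteq> 0\<close> by (rule card_poly_roots_bound)
  ultimately show False using assms(3) by simp
qed

lemma rat_poly_eq_0: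
  fixes p :: "rat poly"
  assumes "c \<noteq> 0 \<or> d \<noteq> 0" "poly (map_poly of_rat p) (el a b c d) = 0" "degree p < 4"
  shows "p = 0"
proof -
  have "map_poly of_rat p = (0 :: complex poly)"
    by (rule complex_poly_eq_0[OF assms(1) conjugates_root[OF assms(2)]])
       (use assms(3) in simp_all)
  then show ?thesis by simp
qed

text \<open>The elements with c = d = 0 form the field Q(s), which does not contain g.\<close>

lemma primitive_coords:
  assumes "rat_adjoin (el a b c d) = K"
  shows "c \<noteq> 0 \<or> d \<noteq> 0"
proof (rule ccontr)
  assume 0: "\<not> ?thesis"
  define E where "E = {el a b 0 0 | a b. True}"
  have E: "el a b 0 0 \<in> E" for a b by (auto simp: E_def)
  have "g \<in> rat_adjoin (el a b c d)" using assms K_gens by simp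
  then have "g \<in> E"
  proof (rule rat_adjoin_least)
    show "1 \<in> E" using E[of 1 0] by (simp add: el_1)
    show "el a b c d \<in> E" using 0 E by simp
    show "- x \<in> E" if "x \<in> E" for x using that by (auto simp: E_def el_minus) blast
    show "x + y \<in> E" if "x \<in> E" "y \<in> E" for x y
      using that by (auto simp: E_def el_add) blast
    show mult: "x * y \<in> E" if "x \<in> E" "y \<in> E" for x y
      using that by (auto simp: E_def el_mult) blast
    show "inverse x \<in> E" if xE: "x \<in> E" and x0: "x \<noteq> 0" for x
    proof -
      obtain a b where x: "x = el a b 0 0" using xE by (auto simp: E_def)
      define n where "n = a\<^sup>2 - rM * b\<^sup>2"
      have n: "n \<noteq> 0"
        using rat_nonsquare[of a b] x x0 by (auto simp: n_def el_0)
      have "x * el a (- b) 0 0 = of_rat n" unfolding x n_def by (rule quad_norm)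
      moreover have "of_rat n * (of_rat (1 / n) :: complex) = 1" using n by (simp flip: of_rat_mult)
      ultimately have "x * (el a (- b) 0 0 * of_rat (1 / n)) = 1" by (simp flip: mult.assoc)
      then have "inverse x = el a (- b) 0 0 * el (1 / n) 0 0 0"
        unfolding el_rat by (rule inverse_unique)
      then show ?thesis using mult[OF E E] by simp
    qed
  qed
  then show False unfolding E_def g_el by (auto simp: el_eq_iff)
qed

lemma powers_independent:
  fixes f :: "nat \<Rightarrow> rat"
  assumes "c \<noteq> 0 \<or> d \<noteq> 0" "(\<Sum>i<4. of_rat (f i) * el a b c d ^ i) = 0" "i < 4"
  shows "f i = 0"
proof -
  define p where "p = (\<Sum>i<4. monom (f i) i)"
  have "map_poly of_rat p = (\<Sum>i<4. monom (of_rat (f i)) i :: complex poly)"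
    by (rule poly_eqI) (simp add: p_def coeff_map_poly coeff_sum coeff_monom)
  then have "poly (map_poly of_rat p) (el a b c d) = 0"
    using assms(2) by (simp add: poly_sum poly_monom)
  moreover have "degree p < 4"
    unfolding p_def by (intro degree_sum_less) (auto intro: le_less_trans[OF degree_monom_le])
  ultimately have "p = 0" using rat_poly_eq_0[OF assms(1)] by blast
  moreover have "coeff p i = f i"
    using assms(3) by (simp add: p_def coeff_sum coeff_monom)
  ultimately show ?thesis by simp
qed

text \<open>The powers of theta up to the third are four independent elements of a space of
  dimension 4, hence span it.\<close>

lemma rat_adjoin_eq_K:
  assumes cd: "c \<noteq> 0 \<or> d \<noteq> 0"
  shows "rat_adjoin (el a b c d) = K"
proof
  define \<theta> where "\<theta> = el a b c d"
  show "rat_adjoin (el a b c d) \<subseteq> K" by (rule rat_adjoin_subset[OF el_in_K])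
  \<comment> \<open>Independence is a property of the set of powers, so these must first be
    distinct; a coincidence would be a relation with coefficients 1 and -1.\<close>
  have inj: "inj_on (\<lambda>i. \<theta> ^ i) {..<4}"
  proof (rule inj_onI, rule ccontr)
    fix i j :: nat assume ij: "i \<in> {..<4}" "j \<in> {..<4}" "\<theta> ^ i = \<theta> ^ j" "i \<noteq> j"
    define f :: "nat \<Rightarrow> rat" where "f k = (if k = i then 1 else 0) - (if k = j then 1 else 0)" for k
    have "(\<Sum>k<4. of_rat (f k) * \<theta> ^ k)
        = (\<Sum>k<4. (if k = i then \<theta> ^ k else 0) - (if k = j then \<theta> ^ k else 0))"
      by (rule sum.cong) (auto simp: f_def of_rat_diff)
    also have "\<dots> = 0" using ij by (simp add: sum_subtractf)
    finally have "f i = 0" using powers_independent[OF cd, of f a b i] ij by (simp add: \<theta>_def)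
    then show False using ij(4) by (simp add: f_def)
  qed
  define S where "S = (\<lambda>i. \<theta> ^ i) ` {..<4}"
  have card: "card S = 4" using inj by (simp add: S_def card_image)
  have ind: "rat_complex.independent S"
  proof (rule rat_complex.independent_if_scalars_zero)
    fix f x assume 0: "(\<Sum>x\<in>S. of_rat (f x) * x) = 0" and "x \<in> S"
    then obtain i where i: "i < 4" "x = \<theta> ^ i" by (auto simp: S_def)
    have "(\<Sum>i<4. of_rat (f (\<theta> ^ i)) * \<theta> ^ i) = 0"
      using 0 unfolding S_def by (simp add: sum.reindex[OF inj])
    then show "f x = 0" using powers_independent[OF cd, of "\<lambda>i. f (\<theta> ^ i)" a b i] i by (simp add: \<theta>_def)
  qed (simp add: S_def)
  have K: "rat_complex.span {1, s, g, h} = K" using K_basis by (simp add: is_rat_basis_def)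
  have pow: "\<theta> ^ i \<in> K" for i by (induction i) (auto simp: \<theta>_def intro: K_1 K_mult el_in_K)
  have sub: "S \<subseteq> K" using pow by (auto simp: S_def)
  have span: "K \<subseteq> rat_complex.span S"
  proof
    fix x assume x: "x \<in> K"
    show "x \<in> rat_complex.span S"
    proof (rule ccontr)
      assume "x \<notin> rat_complex.span S"
      then have ind': "rat_complex.independent (insert x S)" and "x \<notin> S"
        using ind rat_complex.independent_insert[of x S] rat_complex.span_base[of x S] by auto
      have "insert x S \<subseteq> rat_complex.span {1, s, g, h}" using x sub K by simp
      from rat_complex.independent_span_bound[OF _ ind' this]
      have "card (insert x S) \<le> 4" unfolding card_K_basis by simp
      moreover have "finite S" by (simp add: S_def)
      ultimately show False using card \<open>x \<notin> S\<close> by simp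
    qed
  qed
  have "rat_complex.span S \<subseteq> rat_adjoin \<theta>"
  proof (rule rat_complex.span_minimal)
    have "\<theta> ^ i \<in> rat_adjoin \<theta>" for i by (induction i) (auto intro: rat_adjoin_intros)
    then show "S \<subseteq> rat_adjoin \<theta>" by (auto simp: S_def)
    show "rat_complex.subspace (rat_adjoin \<theta>)"
      by (auto simp: rat_complex.subspace_def intro: rat_adjoin_intros)
  qed
  with span show "K \<subseteq> rat_adjoin (el a b c d)" unfolding \<theta>_def by blast
qed

lemma primitive_integers_iff:
  "el a b c d \<in> primitive_integers K \<longleftrightarrow> algebraic_int (el a b c d) \<and> (c \<noteq> 0 \<or> d \<noteq> 0)"
proof -
  have eq: "rat_adjoin (el a b c d) = K \<longleftrightarrow> c \<noteq> 0 \<or> d \<noteq> 0"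
    using primitive_coords rat_adjoin_eq_K by blast
  show ?thesis
    unfolding primitive_integers_def ring_of_integers_def mem_Collect_eq eq
    using el_in_K[of a b c d] by blast
qed

lemma primitive_integers_E:
  assumes "\<theta> \<in> primitive_integers K"
  obtains a b c d where "\<theta> = el a b c d" "algebraic_int (el a b c d)" "c \<noteq> 0 \<or> d \<noteq> 0"
proof -
  have "\<theta> \<in> K" using assms by (simp add: primitive_integers_def ring_of_integers_def)
  then obtain a b c d where "\<theta> = el a b c d" by (rule K_E)
  then show ?thesis using that assms primitive_integers_iff by blast
qed

lemma conjugates_norm:
  "prod_list (conjugates a b c d) = of_rat (Nm a b c d)"
proof -
  have 1: "el a (- b) (- d) c * el a (- b) d (- c) = el (U a b c d) (- V a b c d) 0 0"
  proof -
    have "U a (- b) (- d) c = U a b c d" by (simp add: U_def algebra_simps)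
    moreover have "V a (- b) (- d) c = - V a b c d"
      by (simp add: V_def algebra_simps diff_divide_distrib)
    ultimately show ?thesis using rel_norm[of a "- b" "- d" c] by simp
  qed
  show ?thesis
    unfolding norm_eq[symmetric] 1[symmetric] conjugates_def by (simp add: mult_ac)
qed

text \<open>Both sides are monic of degree 4 and vanish at the conjugates. As these are distinct,
  the difference has too many roots for its degree.\<close>

lemma field_char_poly_eq:
  assumes cd: "c \<noteq> 0 \<or> d \<noteq> 0"
  shows "map_poly of_rat (field_char_poly K (el a b c d)) = (\<Prod>r\<leftarrow>conjugates a b c d. [:- r, 1:])"
    (is "?F = ?G")
proof -
  have stable: "el a b c d * x \<in> K" if "x \<in> K" for x
    using that K_mult[OF el_in_K] by blast
  note F = field_char_poly_root[OF K_basis _ stable, simplified]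
  have degF: "degree ?F = 4" "lead_coeff ?F = 1" using F(2,3) by simp_all
  have degG: "degree ?G = 4" "lead_coeff ?G = 1"
  proof -
    show "degree ?G = 4"
      by (simp add: conjugates_def degree_mult_eq del: mult_pCons_left mult_pCons_right)
    show "lead_coeff ?G = 1"
      unfolding conjugates_def list.map prod_list.Cons prod_list.Nil lead_coeff_mult by simp
  qed
  have "degree (?F - ?G) < 4"
  proof (rule degree_lessI)
    show "?F - ?G \<noteq> 0 \<or> (0::nat) < 4" by simp
    show "\<forall>k\<ge>4. coeff (?F - ?G) k = 0"
    proof (intro allI impI)
      fix k :: nat assume "4 \<le> k"
      then show "coeff (?F - ?G) k = 0"
        using degF degG by (cases "k = 4") (auto simp: coeff_eq_0)
    qed
  qed
  moreover have "poly (?F - ?G) x = 0" if "x \<in> set (conjugates a b c d)" for x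
  proof -
    have "poly ?F x = 0" using conjugates_root[OF F(1) that] .
    moreover have "poly ?G x = 0" using that unfolding poly_linear_factors prod_list_zero_iff by force
    ultimately show ?thesis by simp
  qed
  ultimately show ?thesis using complex_poly_eq_0[OF cd, of a b "?F - ?G"] by simp
qed

text \<open>The coefficients are rational and, as polynomial expressions in integral conjugates,
  algebraic integers. Evaluating the factorization at an integer x gives the product of the
  conjugates of x - theta, that is its norm.\<close>

lemma int_field_char_poly:
  assumes alg: "algebraic_int (el a b c d)" and cd: "c \<noteq> 0 \<or> d \<noteq> 0"
  defines "F \<equiv> int_field_char_poly K (el a b c d)"
  shows "of_int (poly F x) = Nm (of_int x - a) (- b) (- c) (- d)"
    "poly (map_poly of_int F) (el a b c d) = 0" "degree F = 4" "lead_coeff F = 1"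
proof -
  let ?F = "field_char_poly K (el a b c d)"
  note 1 = conjugate_algebraic_int[OF alg]
  note 2 = conjugate_algebraic_int[OF 1]
  note 3 = conjugate_algebraic_int[OF 2]
  have conj: "algebraic_int r" if "r \<in> set (conjugates a b c d)" for r
    using that alg 1 2 3 by (auto simp: conjugates_def)
  have "algebraic_int (coeff (\<Prod>r\<leftarrow>rs. [:- r, 1:]) i)" if "\<And>r. r \<in> set rs \<Longrightarrow> algebraic_int r"
    for rs :: "complex list" and i
    using that
  proof (induction rs arbitrary: i)
    case (Cons r rs)
    show ?case unfolding list.map prod_list.Cons
      by (rule algebraic_int_coeff_mult)
         (use Cons in \<open>auto simp: coeff_pCons split: nat.splits\<close>)
  qed (auto simp: coeff_pCons split: nat.splits)
  from this[OF conj] have "algebraic_int (coeff (map_poly of_rat ?F :: complex poly) i)" for i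
    unfolding field_char_poly_eq[OF cd] .
  then have "coeff ?F i \<in> \<int>" for i
    by (intro of_rat_algebraic_int) (simp add: coeff_map_poly)
  then obtain G where G: "?F = map_poly of_int G" by (rule intpolyE)
  have "F = G"
    unfolding F_def int_field_char_poly_def G by (rule the_equality) simp_all
  with G have F: "?F = map_poly of_int F" by simp
  have stable: "el a b c d * x \<in> K" if "x \<in> K" for x
    using that K_mult[OF el_in_K] by blast
  note root = field_char_poly_root[OF K_basis _ stable, simplified, unfolded F]
  have eq: "map_poly of_rat (map_poly rat_of_int F) = (map_poly of_int F :: complex poly)"
    by (simp add: map_poly_map_poly o_def)
  show "poly (map_poly of_int F) (el a b c d) = 0" using root(1) unfolding eq .
  show "degree F = 4" using root(2) by simp
  show "lead_coeff F = 1" using root(3) by simp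
  have "(of_rat (of_int (poly F x)) :: complex) = poly (map_poly of_int F) (of_int x)"
    by simp
  also have "\<dots> = poly (\<Prod>r\<leftarrow>conjugates a b c d. [:- r, 1:]) (of_int x)"
    unfolding field_char_poly_eq[OF cd, symmetric] F eq ..
  also have "\<dots> = prod_list (map (\<lambda>r. of_int x - r) (conjugates a b c d))"
    by (rule poly_linear_factors)
  also have "map (\<lambda>r. of_int x - r) (conjugates a b c d)
      = conjugates (of_int x - a) (- b) (- c) (- d)"
    by (simp add: conjugates_def of_int_el el_diff)
  finally show "of_int (poly F x) = Nm (of_int x - a) (- b) (- c) (- d)"
    unfolding conjugates_norm of_rat_eq_iff .
qed

end

section \<open>Common divisors of the values of the characteristic polynomials\<close>

text \<open>Four times the form \<open>Nm\<close> at integer coordinates; the 4 clears the halves in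
  \<open>U\<close> and \<open>V\<close>. Only products occur, which suits reduction modulo
  3.\<close>

definition four_norm :: "int \<Rightarrow> int \<Rightarrow> int \<Rightarrow> int \<Rightarrow> int \<Rightarrow> int"
  where "four_norm m a b c d =
    (2 * a * a + 2 * (m * m + 16) * b * b - (m * m + 16) * (c * c + d * d))
      * (2 * a * a + 2 * (m * m + 16) * b * b - (m * m + 16) * (c * c + d * d))
    - (m * m + 16) * (4 * a * b - m * (c * c - d * d) - 8 * c * d)
      * (4 * a * b - m * (c * c - d * d) - 8 * c * d)"

text \<open>Integers of the field have coordinates with denominator 16, so raising x by 1 raises the
  scaled first coordinate by 16, and the shifts 0, 16, 32 meet all residues modulo 3. The check of
  243 cases reflects that 3 never splits completely: at most two primes lie over it, and each
  excludes at most one class of x.\<close>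

lemma three_not_dvd_four_norm:
  "\<not> (3 dvd four_norm m a b c d \<and> 3 dvd four_norm m (a + 16) b c d \<and> 3 dvd four_norm m (a + 32) b c d)"
proof -
  let ?P = "\<lambda>m a b c d. \<not> (four_norm m (a + 0) b c d mod 3 = 0
    \<and> four_norm m (a + 16) b c d mod 3 = 0 \<and> four_norm m (a + 32) b c d mod 3 = 0)"
  have "list_all (\<lambda>a. list_all (\<lambda>b. list_all (\<lambda>c. list_all (\<lambda>d. list_all (\<lambda>m. ?P m a b c d)
      [0,1,2]) [0,1,2]) [0,1,2]) [0,1,2]) [0,1,2]"
    by code_simp
  then have *: "\<forall>a\<in>{0,1,2}. \<forall>b\<in>{0,1,2}. \<forall>c\<in>{0,1,2}. \<forall>d\<in>{0,1,2}. \<forall>m\<in>{0,1,2}. ?P m a b c d"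
    unfolding list_all_iff list.set .
  have r: "x mod 3 \<in> {0,1,2}" for x :: int by auto
  have red: "four_norm (m mod 3) (a mod 3 + k) (b mod 3) (c mod 3) (d mod 3) mod 3
      = four_norm m (a + k) b c d mod 3" for k
    unfolding four_norm_def by (intro mod_add_cong mod_diff_cong mod_mult_cong refl mod_mod_trivial)
  show ?thesis
    using *[THEN bspec, OF r[of a], THEN bspec, OF r[of b], THEN bspec, OF r[of c],
        THEN bspec, OF r[of d], THEN bspec, OF r[of m]]
    by (simp only: red red[of 0, unfolded add_0_right] dvd_eq_mod_eq_0 add_0_right
        not_False_eq_True)
qed

text \<open>In this and the next two lemmas a single prime lies over 2, and it cannot contain both
  theta and theta - 1. In coordinates this is a parity check of the norm form.\<close>

lemma norm_2_mod_4_odd: "odd (norm_2_mod_4 l 0 b c d) \<or> odd (norm_2_mod_4 l 1 b c d)"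
  by (auto simp: norm_2_mod_4_def P_2_mod_4_def Q_2_mod_4_def norm_quadratic_def)

lemma norm_4_mod_8_odd: "odd n \<Longrightarrow> odd (norm_4_mod_8 n 0 b c d) \<or> odd (norm_4_mod_8 n 1 b c d)"
  by (auto simp: norm_4_mod_8_def P_4_mod_8_def Q_4_mod_8_def norm_quadratic_def)

lemma norm_8_odd: "odd l \<Longrightarrow> odd (norm_8 l 0 b c d) \<or> odd (norm_8 l 1 b c d)"
  by (auto simp: norm_8_def P_8_def Q_8_def norm_quadratic_def)

text \<open>For even b the value at 1 is odd. For odd b, divisibility of the value at 2 by 8 forces
  4 | P; then the norm says that P / 4 has the parity of k, while the formula for P gives the
  opposite parity.\<close>

lemma norm_8_not_dvd:
  assumes "even l"
  shows "\<not> 8 dvd norm_8 l 1 b c d \<or> \<not> 8 dvd norm_8 l 2 b c d"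
proof (cases "even b")
  case True
  then have "odd (norm_8 l 1 b c d)" using assms by (simp add: norm_8_def P_8_def Q_8_def norm_quadratic_def)
  then show ?thesis by auto
next
  case False
  obtain k where k: "l = 2 * k" using assms by blast
  obtain r where r: "b = 2 * r + 1" using False oddE by blast
  define S where "S = r\<^sup>2 + r"
  have b2: "b\<^sup>2 = 4 * S + 1" by (simp add: r S_def power2_eq_square algebra_simps)
  define P where "P = 4 + l\<^sup>2 * b\<^sup>2 - (c\<^sup>2 + d\<^sup>2) * (4 * l\<^sup>2 + 1) + (c\<^sup>2 - d\<^sup>2 + 4 * c * d * l)"
  define Q where "Q = 4 * b + b\<^sup>2 - 2 * (c\<^sup>2 - d\<^sup>2 + 4 * c * d * l)"
  have N: "norm_8 l 2 b c d = P * (P + Q) - l\<^sup>2 * Q\<^sup>2"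
    by (simp add: norm_8_def P_8_def Q_8_def norm_quadratic_def P_def Q_def power2_eq_square algebra_simps)
  have "odd Q" by (simp add: Q_def False)
  then obtain q where q: "Q = 2 * q + 1" using oddE by blast
  have P: "P = 4 + 4 * k\<^sup>2 - 2 * d\<^sup>2 + 8 * (2 * k\<^sup>2 * S - 2 * (c\<^sup>2 + d\<^sup>2) * k\<^sup>2 + c * d * k)"
    unfolding P_def b2 k by (simp add: power2_eq_square algebra_simps)
  have "even P" unfolding P by simp
  then obtain p where p: "P = 2 * p" by blast
  have dvd8: "8 dvd 2 * x \<Longrightarrow> 4 dvd x" for x :: int by presburger
  have "\<not> 8 dvd norm_8 l 2 b c d"
  proof
    assume "8 dvd norm_8 l 2 b c d"
    moreover have "norm_8 l 2 b c d = 2 * (p * (2 * (p + q) + 1) - 2 * (k\<^sup>2 * Q\<^sup>2))"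
      unfolding N unfolding p k q by (simp add: power2_eq_square algebra_simps)
    ultimately have 4: "4 dvd p * (2 * (p + q) + 1) - 2 * (k\<^sup>2 * Q\<^sup>2)"
      using dvd8 by metis
    from even_if_four_dvd[OF this] have "even p" by simp
    then obtain p' where p': "p = 2 * p'" by blast
    have "4 dvd 2 * (p' * (2 * (p + q) + 1) - k\<^sup>2 * Q\<^sup>2)"
      using 4 unfolding p' by (simp add: algebra_simps)
    from four_dvd_doubleD[OF this] have par: "even p' \<longleftrightarrow> even k"
      using \<open>odd Q\<close> by simp
    have "4 * p' = 4 + 4 * k\<^sup>2 - 2 * d\<^sup>2 + 8 * (2 * k\<^sup>2 * S - 2 * (c\<^sup>2 + d\<^sup>2) * k\<^sup>2 + c * d * k)"
      using P unfolding p p' by simp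
    then have 2: "2 * p' = 2 + 2 * k\<^sup>2 - d\<^sup>2 + 4 * (2 * k\<^sup>2 * S - 2 * (c\<^sup>2 + d\<^sup>2) * k\<^sup>2 + c * d * k)"
      by simp
    have "even (2 + 2 * k\<^sup>2 - d\<^sup>2 + 4 * (2 * k\<^sup>2 * S - 2 * (c\<^sup>2 + d\<^sup>2) * k\<^sup>2 + c * d * k))"
      unfolding 2[symmetric] by simp
    then have "even d" by simp
    then obtain d' where d': "d = 2 * d'" by blast
    have "2 * p' = 2 * (1 + k\<^sup>2 - 2 * d'\<^sup>2 + 2 * (2 * k\<^sup>2 * S - 2 * (c\<^sup>2 + d\<^sup>2) * k\<^sup>2 + c * d * k))"
      unfolding 2 unfolding d' by (simp add: power2_eq_square algebra_simps)
    then have p'_eq: "p' = 1 + k\<^sup>2 - 2 * d'\<^sup>2 + 2 * (2 * k\<^sup>2 * S - 2 * (c\<^sup>2 + d\<^sup>2) * k\<^sup>2 + c * d * k)"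
      by simp
    have "even p' \<longleftrightarrow> odd k" unfolding p'_eq by simp
    with par show False by simp
  qed
  then show ?thesis ..
qed

text \<open>Unless c and d are even and b is odd, the norm is odd at 0 or 1. In the exceptional case
  the element is a + t modulo 2A and all values are divisible by 4, so the quotient by 4 is examined
  and found odd at 0 or at 2.\<close>

lemma norm_odd_not_dvd:
  assumes "odd m"
  shows "\<exists>a\<in>{0, 1, 2}. \<not> 8 dvd norm_odd m a b c d"
proof (cases "even c \<and> even d \<and> odd b")
  case False
  have "odd (norm_odd m 0 b c d) \<or> odd (norm_odd m 1 b c d)"
    using False assms by (auto simp: norm_odd_def P_odd_def Q_odd_def norm_quadratic_def)
  then show ?thesis by auto
next
  case True
  then obtain c' d' where cd: "c = 2 * c'" "d = 2 * d'" by (meson evenE)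
  have b: "odd b" using True by simp
  \<comment> \<open>Modulo 2 the number P below equals (1 + a + c') (1 + d'); this choice makes the
    first factor even.\<close>
  define a where "a = (if even c' then 1 else 0 :: int)"
  have *: "\<not> 8 dvd norm_odd m (2 * a) b c d"
  proof
    define P where "P = a\<^sup>2 + b\<^sup>2 + a * d' * m + 2 * b * (c' - d') - c'\<^sup>2 - d'\<^sup>2 + c' * d' * (m - 2)"
    define Q where "Q = 4 * a * b + m * b\<^sup>2 + 4 * a * (c' - d') + 2 * m * b * c' - 8 * c' * d'"
    have "norm_odd m (2 * a) b c d = 4 * (4 * P\<^sup>2 + m * P * Q - Q\<^sup>2)"
      unfolding norm_odd_def P_odd_def Q_odd_def norm_quadratic_def cd P_def Q_def
      by (simp add: power2_eq_square algebra_simps)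
    moreover assume "8 dvd norm_odd m (2 * a) b c d"
    moreover have "8 dvd 4 * x \<Longrightarrow> even x" for x :: int by presburger
    ultimately have "even (4 * P\<^sup>2 + m * P * Q - Q\<^sup>2)" by metis
    moreover have "odd Q" using assms b by (simp add: Q_def)
    ultimately have "odd P" using assms by simp
    moreover have "even P" using assms b by (auto simp: P_def a_def)
    ultimately show False by simp
  qed
  have "2 * a \<in> {0, 1, 2}" by (simp add: a_def)
  with * show ?thesis by blast
qed

text \<open>These are the values for theta = t + 2 \<alpha>. Since t^2 = m t + 4, t is modulo 2A an
  idempotent other than 0 and 1, so every x - theta lies in one of the two primes over 2, and both
  have norm 4.\<close>

lemma norm_odd_4_dvd: "odd m \<Longrightarrow> 4 dvd norm_odd m x (- 1) (- 2) 0"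
proof -
  assume "odd m"
  then obtain l where l: "m = 2 * l + 1" using oddE by blast
  show ?thesis
  proof (cases "even x")
    case True
    then obtain y where y: "x = 2 * y" by blast
    show ?thesis unfolding norm_odd_def P_odd_def Q_odd_def norm_quadratic_def y
      by (rule dvdI[of _ _ "(2 * y\<^sup>2 + 4)\<^sup>2 + m * (y\<^sup>2 + 2) * (3 * m - 8 * y) - (3 * m - 8 * y)\<^sup>2"])
         (simp add: power2_eq_square algebra_simps)
  next
    case False
    then obtain y where y: "x = 2 * y + 1" using oddE by blast
    define P where "P = 4 * (y\<^sup>2 + y + 2) + 1"
    define Q where "Q = 3 * m - 4 * x"
    have "norm_odd m x (- 1) (- 2) 0 = P * (P + m * Q) - 4 * Q\<^sup>2"
      unfolding norm_odd_def P_odd_def Q_odd_def norm_quadratic_def P_def Q_def y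
      by (simp add: power2_eq_square algebra_simps)
    moreover have "P + m * Q = 4 * (y\<^sup>2 + y + 2 + 3 * (l\<^sup>2 + l) + 1 - m * x)"
      unfolding P_def Q_def l by (simp add: power2_eq_square algebra_simps)
    ultimately show ?thesis by simp
  qed
qed

text \<open>These are the values for theta = \<open>w8\<close> + 2 \<open>e4\<close>. For even l the
  equation w8^2 = w8 + l^2 makes \<open>w8\<close> idempotent modulo 2A, which is the product of the
  squares of two primes of norm 2; every x - theta lies in one of these squares.\<close>

lemma norm_8_4_dvd:
  assumes "even l"
  shows "4 dvd norm_8 l x (- 1) (- 2) 0"
proof -
  obtain k where k: "l = 2 * k" using assms by blast
  define P' where "P' = - 15 * k\<^sup>2"
  \<comment> \<open>Modulo 4 the norm will turn out to be the square of x (x - 1).\<close>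
  have "even (x * (x - 1))" by simp
  then obtain z where z: "x * (x - 1) = 2 * z" by blast
  define Q where "Q = - 2 * x - 7"
  have "norm_8 l x (- 1) (- 2) 0 = (x\<^sup>2 + 4 * P') * (x\<^sup>2 + 4 * P' + Q) - 4 * (k\<^sup>2 * Q\<^sup>2)"
    unfolding norm_8_def P_8_def Q_8_def norm_quadratic_def P'_def Q_def k
    by (simp add: power2_eq_square algebra_simps)
  also have "x\<^sup>2 + 4 * P' + Q = (x - 1)\<^sup>2 + 4 * (P' - 2)"
    by (simp add: Q_def power2_eq_square algebra_simps)
  also have "(x\<^sup>2 + 4 * P') * ((x - 1)\<^sup>2 + 4 * (P' - 2))
      = (x * (x - 1))\<^sup>2 + 4 * (P' * (x - 1)\<^sup>2 + (P' - 2) * x\<^sup>2 + 4 * P' * (P' - 2))"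
    by (simp add: power2_eq_square algebra_simps)
  also have "(x * (x - 1))\<^sup>2 = 4 * z\<^sup>2" unfolding z by simp
  finally show ?thesis by (simp add: dvd_diff)
qed

text \<open>This is the shape of \<open>Nm\<close> as a function of its first coordinate y: U is y^2
  plus a constant and V is 2 y b plus a constant.\<close>

lemma fourth_difference:
  fixes y b u v M :: rat
  defines "f \<equiv> \<lambda>y. (y\<^sup>2 + u)\<^sup>2 - M * (2 * y * b + v)\<^sup>2"
  shows "f (y + 4) - 4 * f (y + 3) + 6 * f (y + 2) - 4 * f (y + 1) + f y = 24"
  unfolding f_def by (simp add: power2_eq_square algebra_simps)

section \<open>From norm forms to i(theta) and i(K)\<close>

context simplest_quartic
begin

lemma m_cases:
  obtains "odd m" | l where "m = 2 * (2 * l + 1)" | n where "m = 4 * n" "odd n" | l where "m = 8 * l"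
proof -
  have "\<exists>l. m = 2 * (2 * l + 1)" if "even m" "\<not> 4 dvd m" using that by presburger
  moreover have "\<exists>n. m = 4 * n \<and> odd n" if "4 dvd m" "\<not> 8 dvd m" using that by presburger
  ultimately show ?thesis using that by (metis dvd_def)
qed

lemma sixteen_integral:
  assumes "x \<in> ring_of_integers K"
  shows "16 * x \<in> lat s g h"
proof (rule m_cases)
  assume "odd m"
  from ring_of_integers_odd[OF this] show ?thesis using assms sixteen_lat[OF sixteen_odd] by simp
next
  fix l assume "m = 2 * (2 * l + 1)"
  from ring_of_integers_2_mod_4[OF this] show ?thesis
    using assms sixteen_lat[OF sixteen_2_mod_4] by simp
next
  fix n assume "m = 4 * n" "odd n"
  from ring_of_integers_4_mod_8[OF this] show ?thesis
    using assms sixteen_lat[OF sixteen_4_mod_8] by simp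
next
  fix l assume "m = 8 * l"
  from ring_of_integers_8[OF this] show ?thesis using assms sixteen_lat[OF sixteen_8] by simp
qed

abbreviation value_poly :: "complex \<Rightarrow> int \<Rightarrow> int"
  where "value_poly \<theta> x \<equiv> poly (int_field_char_poly K \<theta>) x"

lemma dvd_element_value_gcd_iff: "k dvd element_value_gcd K \<theta> \<longleftrightarrow> (\<forall>x. k dvd value_poly \<theta> x)"
  by (auto simp: element_value_gcd_def dvd_Gcd_iff)

lemma element_value_gcd_dvd: "element_value_gcd K \<theta> dvd value_poly \<theta> x"
  by (simp add: element_value_gcd_def)

lemma element_value_gcd_dvd_24:
  assumes "\<theta> \<in> primitive_integers K"
  shows "element_value_gcd K \<theta> dvd 24"
proof -
  obtain a b c d where \<theta>: "\<theta> = el a b c d" "algebraic_int (el a b c d)" "c \<noteq> 0 \<or> d \<noteq> 0"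
    using assms by (rule primitive_integers_E)
  note F = int_field_char_poly(1)[OF \<theta>(2,3), folded \<theta>(1)]
  define f where "f y = (y\<^sup>2 + (rM * b\<^sup>2 - rM * (c\<^sup>2 + d\<^sup>2) / 2))\<^sup>2
      - rM * (2 * y * (- b) + (- rm * (c\<^sup>2 - d\<^sup>2) / 2 - 4 * c * d))\<^sup>2" for y
  have "U y (- b) (- c) (- d) = y\<^sup>2 + (rM * b\<^sup>2 - rM * (c\<^sup>2 + d\<^sup>2) / 2)" for y
    by (simp add: U_def)
  moreover have "V y (- b) (- c) (- d) = 2 * y * (- b) + (- rm * (c\<^sup>2 - d\<^sup>2) / 2 - 4 * c * d)" for y
    by (simp add: V_def)
  ultimately have f: "Nm y (- b) (- c) (- d) = f y" for y
    by (simp only: Nm_def f_def)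
  have v: "of_int (value_poly \<theta> x) = f (- a + of_int x)" for x
    unfolding F f by simp
  have "(of_int (value_poly \<theta> 4 - 4 * value_poly \<theta> 3 + 6 * value_poly \<theta> 2 - 4 * value_poly \<theta> 1
      + value_poly \<theta> 0) :: rat) = of_int 24"
    unfolding of_int_add of_int_diff of_int_mult v
    using fourth_difference[of "- a" "rM * b\<^sup>2 - rM * (c\<^sup>2 + d\<^sup>2) / 2" rM "- b"
        "- rm * (c\<^sup>2 - d\<^sup>2) / 2 - 4 * c * d"]
    unfolding f_def[symmetric] by simp
  then have eq: "value_poly \<theta> 4 - 4 * value_poly \<theta> 3 + 6 * value_poly \<theta> 2 - 4 * value_poly \<theta> 1
      + value_poly \<theta> 0 = 24"
    by (simp only: of_int_eq_iff)
  show ?thesis unfolding eq[symmetric]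
    by (intro dvd_add dvd_diff dvd_mult element_value_gcd_dvd)
qed

lemma not_three_dvd_element_value_gcd:
  assumes "\<theta> \<in> primitive_integers K"
  shows "\<not> 3 dvd element_value_gcd K \<theta>"
proof
  assume "3 dvd element_value_gcd K \<theta>"
  then have 3: "3 dvd value_poly \<theta> x" for x by (simp add: dvd_element_value_gcd_iff)
  obtain a b c d where \<theta>: "\<theta> = el a b c d" "algebraic_int (el a b c d)" "c \<noteq> 0 \<or> d \<noteq> 0"
    using assms by (rule primitive_integers_E)
  note F = int_field_char_poly(1)[OF \<theta>(2,3), folded \<theta>(1)]
  have "16 * el a b c d \<in> lat s g h"
    using assms \<theta>(1) sixteen_integral by (simp add: primitive_integers_def)
  then obtain A B C D where "el (16 * a) (16 * b) (16 * c) (16 * d)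
      = el (of_int A) (of_int B) (of_int C) (of_int D)"
    unfolding sixteen_el lat_sgh by blast
  then have coords: "a = of_int A / 16" "b = of_int B / 16" "c = of_int C / 16" "d = of_int D / 16"
    by (simp_all add: el_eq_iff)
  have scale: "4 * 16 ^ 4 * Nm y (B' / 16) (C' / 16) (D' / 16) = 4 * Nm (16 * y) B' C' D'" for y B' C' D'
    unfolding Nm_def U_def V_def by (simp add: expand_simps)
  have four: "4 * Nm (of_int a) (of_int b) (of_int c) (of_int d) = of_int (four_norm m a b c d)"
    for a b c d
  proof -
    have "4 * Nm y B' C' D' =
      (2 * y * y + 2 * (rm * rm + 16) * B' * B' - (rm * rm + 16) * (C' * C' + D' * D'))
      * (2 * y * y + 2 * (rm * rm + 16) * B' * B' - (rm * rm + 16) * (C' * C' + D' * D'))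
      - (rm * rm + 16) * (4 * y * B' - rm * (C' * C' - D' * D') - 8 * C' * D')
      * (4 * y * B' - rm * (C' * C' - D' * D') - 8 * C' * D')" for y B' C' D'
      unfolding Nm_def U_def V_def rM_def
      by (simp add: expand_simps)
    then show ?thesis unfolding four_norm_def rm_def
      by (simp only: of_int_add of_int_diff of_int_mult of_int_numeral)
  qed
  have "3 dvd four_norm m (- A + 16 * x) (- B) (- C) (- D)" for x
  proof -
    have "(of_int (4 * 16 ^ 4 * value_poly \<theta> x) :: rat)
        = 4 * 16 ^ 4 * Nm (of_int x - a) (- of_int B / 16) (- of_int C / 16) (- of_int D / 16)"
      unfolding of_int_mult F coords by simp
    also have "\<dots> = 4 * Nm (of_int (- A + 16 * x)) (of_int (- B)) (of_int (- C)) (of_int (- D))"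
      unfolding scale coords by simp
    finally have "4 * 16 ^ 4 * value_poly \<theta> x = four_norm m (- A + 16 * x) (- B) (- C) (- D)"
      by (simp only: four of_int_eq_iff)
    then show ?thesis using 3[of x] by (metis dvd_mult)
  qed
  from this[of 0] this[of 1] this[of 2]
  show False using three_not_dvd_four_norm[of m "- A" "- B" "- C" "- D"] by simp
qed

lemma value_poly_eq:
  assumes N: "\<And>A B C D a b c d. el A B C D = of_int a + of_int b * w + of_int c * e + of_int d * f
      \<Longrightarrow> Nm A B C D = of_int (N a b c d)"
    and \<theta>: "\<theta> = of_int a + of_int b * w + of_int c * e + of_int d * f"
    and prim: "\<theta> \<in> primitive_integers K"
  shows "value_poly \<theta> x = N (x - a) (- b) (- c) (- d)"
proof -
  obtain A B C D where el: "\<theta> = el A B C D" "algebraic_int (el A B C D)" "C \<noteq> 0 \<or> D \<noteq> 0"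
    using prim by (rule primitive_integers_E)
  have "el (of_int x - A) (- B) (- C) (- D) = of_int x - \<theta>"
    unfolding el(1) of_int_el[of x] el_diff by simp
  also have "\<dots> = of_int (x - a) + of_int (- b) * w + of_int (- c) * e + of_int (- d) * f"
    unfolding \<theta> by simp
  finally have "Nm (of_int x - A) (- B) (- C) (- D) = of_int (N (x - a) (- b) (- c) (- d))"
    by (rule N)
  then have "(of_int (value_poly \<theta> x) :: rat) = of_int (N (x - a) (- b) (- c) (- d))"
    using int_field_char_poly(1)[OF el(2,3), folded el(1)] by simp
  then show ?thesis by (simp only: of_int_eq_iff)
qed

lemma primitive_in_lat:
  assumes "ring_of_integers K = lat w e f" "\<theta> \<in> primitive_integers K"
  obtains a b c d where "\<theta> = of_int a + of_int b * w + of_int c * e + of_int d * f"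
  using assms by (auto simp: primitive_integers_def elim: latE)

text \<open>As x runs through the integers, so does the first coordinate of x - theta. A common
  divisor of all values thus divides the norm form at every first coordinate, with the other three
  fixed, and bounds on i(theta) follow from a few values of that form.\<close>

lemma dvd_gcd_imp_norm:
  assumes "ring_of_integers K = lat w e f"
    and N: "\<And>A B C D a b c d. el A B C D = of_int a + of_int b * w + of_int c * e + of_int d * f
      \<Longrightarrow> Nm A B C D = of_int (N a b c d)"
    and \<theta>: "\<theta> \<in> primitive_integers K" "k dvd element_value_gcd K \<theta>"
  obtains b c d where "\<And>a. k dvd N a b c d"
proof -
  obtain a b c d where eq: "\<theta> = of_int a + of_int b * w + of_int c * e + of_int d * f"
    using primitive_in_lat[OF assms(1) \<theta>(1)] .
  have "value_poly \<theta> x = N (x - a) (- b) (- c) (- d)" for x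
    by (rule value_poly_eq[where N = N, OF _ eq \<theta>(1)]) (rule N)
  from this[of "y + a" for y] have "k dvd N y (- b) (- c) (- d)" for y
    using \<theta>(2) unfolding dvd_element_value_gcd_iff by (metis add_diff_cancel)
  then show ?thesis by (rule that)
qed

lemma field_value_lcm_eq_1:
  assumes "\<And>\<theta>. \<theta> \<in> primitive_integers K \<Longrightarrow> odd (element_value_gcd K \<theta>)"
  shows "field_value_lcm K = 1"
proof -
  have "element_value_gcd K \<theta> dvd 1" if "\<theta> \<in> primitive_integers K" for \<theta>
  proof -
    have "prime (3::int)" by simp
    then have "coprime 3 (element_value_gcd K \<theta>)"
      using not_three_dvd_element_value_gcd[OF that] by (rule prime_imp_coprime)
    then have "coprime (element_value_gcd K \<theta>) 3" by (rule coprime_commute[THEN iffD1])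
    moreover have "coprime (element_value_gcd K \<theta>) (2 ^ 3)"
      using assms[OF that] by (simp only: coprime_power_right_iff) simp
    ultimately have "coprime (element_value_gcd K \<theta>) (2 ^ 3 * 3)" by (simp only: coprime_mult_right_iff)
    moreover have "element_value_gcd K \<theta> dvd 2 ^ 3 * 3" using element_value_gcd_dvd_24[OF that] by simp
    ultimately show ?thesis by (metis coprime_common_divisor dvd_refl)
  qed
  then have "field_value_lcm K dvd 1" unfolding field_value_lcm_def by (intro Lcm_least) auto
  moreover have "field_value_lcm K \<ge> 0" by (simp add: field_value_lcm_def)
  ultimately show ?thesis by simp
qed

text \<open>Every i(theta) is a divisor of 24 divisible by neither 3 nor 8, hence 1, 2 or 4, and one
  witness with 4 decides.\<close>

lemma field_value_lcm_eq_4: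
  assumes not8: "\<And>\<theta>. \<theta> \<in> primitive_integers K \<Longrightarrow> \<not> 8 dvd element_value_gcd K \<theta>"
    and \<theta>0: "\<theta>0 \<in> primitive_integers K" "4 dvd element_value_gcd K \<theta>0"
  shows "field_value_lcm K = 4"
proof -
  have "element_value_gcd K \<theta> dvd 4" if "\<theta> \<in> primitive_integers K" for \<theta>
  proof -
    let ?k = "element_value_gcd K \<theta>"
    have k: "?k dvd 24" "\<not> 3 dvd ?k" "\<not> 8 dvd ?k"
      using element_value_gcd_dvd_24 not_three_dvd_element_value_gcd not8 that by blast+
    have "0 \<le> ?k" by (simp add: element_value_gcd_def)
    moreover have "?k \<le> 24" using k(1) by (rule zdvd_imp_le) simp
    ultimately have "?k \<in> set [0..24]" by simp
    moreover have "\<forall>k\<in>set [0..24]. k dvd 24 \<and> \<not> 3 dvd k \<and> \<not> 8 dvd k \<longrightarrow> k dvd (4::int)"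
      by code_simp
    ultimately show ?thesis using k by blast
  qed
  then have "field_value_lcm K dvd 4" unfolding field_value_lcm_def by (intro Lcm_least) auto
  moreover have "4 dvd field_value_lcm K"
    unfolding field_value_lcm_def by (rule dvd_trans[OF \<theta>0(2)]) (simp add: \<theta>0(1))
  moreover have "field_value_lcm K \<ge> 0" by (simp add: field_value_lcm_def)
  ultimately show ?thesis by (intro zdvd_antisym_nonneg) auto
qed

text \<open>The summand w fixes the residues modulo 2; the summand 2 e leaves them unchanged and
  supplies the nonzero coordinate that makes the sum primitive.\<close>

lemma witness_4_dvd:
  assumes R: "ring_of_integers K = lat w e f"
    and N: "\<And>A B C D a b c d. el A B C D = of_int a + of_int b * w + of_int c * e + of_int d * f
      \<Longrightarrow> Nm A B C D = of_int (N a b c d)"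
    and 4: "\<And>x. 4 dvd N x (- 1) (- 2) 0"
    and el: "w + 2 * e = el A B C D" "C \<noteq> 0"
  shows "w + 2 * e \<in> primitive_integers K" "4 dvd element_value_gcd K (w + 2 * e)"
proof -
  have eq: "w + 2 * e = of_int 0 + of_int 1 * w + of_int 2 * e + of_int 0 * f" by simp
  have "w + 2 * e \<in> ring_of_integers K" unfolding R by (rule latI[OF eq])
  then show prim: "w + 2 * e \<in> primitive_integers K"
    using el unfolding el(1) primitive_integers_iff by (simp add: ring_of_integers_def)
  have "value_poly (w + 2 * e) x = N (x - 0) (- 1) (- 2) (- 0)" for x
    by (rule value_poly_eq[where N = N, OF _ eq prim]) (rule N)
  then have "4 dvd value_poly (w + 2 * e) x" for x
    using 4 by simp
  then show "4 dvd element_value_gcd K (w + 2 * e)" by (simp add: dvd_element_value_gcd_iff)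
qed

lemma field_value_lcm_odd:
  assumes "odd m"
  shows "field_value_lcm K = 4"
proof (rule field_value_lcm_eq_4)
  note R = ring_of_integers_odd[OF assms]
  fix \<theta> assume \<theta>: "\<theta> \<in> primitive_integers K"
  show "\<not> 8 dvd element_value_gcd K \<theta>"
  proof
    assume "8 dvd element_value_gcd K \<theta>"
    from dvd_gcd_imp_norm[where N = "norm_odd m", OF R Nm_odd \<theta> this] obtain b c d where
      "\<And>a. 8 dvd norm_odd m a b c d" by blast
    then show False using norm_odd_not_dvd[OF assms, of b c d] by blast
  qed
next
  note R = ring_of_integers_odd[OF assms]
  have "t + 2 * e1 = el (rm / 2 + 2 * (rm / 4)) (1 / 2 + 2 * (1 / 4)) (2 * (1 / 2)) 0"
    using of_int_scale[of 2 "rm / 4" "1 / 4" "1 / 2" 0] by (simp add: t_el e1_def el_add)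
  note wit = witness_4_dvd[where N = "norm_odd m", OF R Nm_odd norm_odd_4_dvd[OF assms] this]
  show "t + 2 * e1 \<in> primitive_integers K" "4 dvd element_value_gcd K (t + 2 * e1)"
    using wit by simp_all
qed

lemma field_value_lcm_2_mod_4:
  assumes "m = 2 * (2 * l + 1)"
  shows "field_value_lcm K = 1"
proof (rule field_value_lcm_eq_1, rule notI)
  fix \<theta> assume \<theta>: "\<theta> \<in> primitive_integers K" "even (element_value_gcd K \<theta>)"
  from dvd_gcd_imp_norm[where N = "norm_2_mod_4 l", OF ring_of_integers_2_mod_4[OF assms]
      Nm_2_mod_4[OF assms] \<theta>]
  obtain b c d where "\<And>a. even (norm_2_mod_4 l a b c d)" by blast
  then show False using norm_2_mod_4_odd by blast
qed

lemma field_value_lcm_4_mod_8: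
  assumes "m = 4 * n" "odd n"
  shows "field_value_lcm K = 1"
proof (rule field_value_lcm_eq_1, rule notI)
  fix \<theta> assume \<theta>: "\<theta> \<in> primitive_integers K" "even (element_value_gcd K \<theta>)"
  from dvd_gcd_imp_norm[where N = "norm_4_mod_8 n", OF ring_of_integers_4_mod_8[OF assms]
      Nm_4_mod_8[OF assms(1)] \<theta>]
  obtain b c d where "\<And>a. even (norm_4_mod_8 n a b c d)" by blast
  then show False using norm_4_mod_8_odd[OF assms(2)] by blast
qed

lemma field_value_lcm_8_mod_16:
  assumes "m = 8 * l" "odd l"
  shows "field_value_lcm K = 1"
proof (rule field_value_lcm_eq_1, rule notI)
  fix \<theta> assume \<theta>: "\<theta> \<in> primitive_integers K" "even (element_value_gcd K \<theta>)"
  from dvd_gcd_imp_norm[where N = "norm_8 l", OF ring_of_integers_8[OF assms(1)]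
      Nm_8[OF assms(1)] \<theta>]
  obtain b c d where "\<And>a. even (norm_8 l a b c d)" by blast
  then show False using norm_8_odd[OF assms(2)] by blast
qed

lemma field_value_lcm_16:
  assumes "m = 8 * l" "even l"
  shows "field_value_lcm K = 4"
proof (rule field_value_lcm_eq_4)
  note R = ring_of_integers_8[OF assms(1)]
  fix \<theta> assume \<theta>: "\<theta> \<in> primitive_integers K"
  show "\<not> 8 dvd element_value_gcd K \<theta>"
  proof
    assume "8 dvd element_value_gcd K \<theta>"
    from dvd_gcd_imp_norm[where N = "norm_8 l", OF R Nm_8[OF assms(1)] \<theta> this] obtain b c d where
      "\<And>a. 8 dvd norm_8 l a b c d" by blast
    then show False using norm_8_not_dvd[OF assms(2), of b c d] by blast
  qed
next
  note R = ring_of_integers_8[OF assms(1)]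
  have "w8 + 2 * e4 = el (1 / 2) (1 / 8) (2 * (1 / 4)) (2 * (1 / 4))"
    using of_int_scale[of 2 0 0 "1 / 4" "1 / 4"] by (simp add: w8_def e4_def el_add)
  note wit = witness_4_dvd[where N = "norm_8 l", OF R Nm_8[OF assms(1)] norm_8_4_dvd[OF assms(2)] this]
  show "w8 + 2 * e4 \<in> primitive_integers K" "4 dvd element_value_gcd K (w8 + 2 * e4)"
    using wit by simp_all
qed

end

section \<open>The field index\<close>

context simplest_quartic
begin

abbreviation "A \<equiv> ring_of_integers K"

lemma A_closed:
  shows A_add: "x \<in> A \<Longrightarrow> y \<in> A \<Longrightarrow> x + y \<in> A"
    and A_mult: "x \<in> A \<Longrightarrow> y \<in> A \<Longrightarrow> x * y \<in> A"
    and A_diff: "x \<in> A \<Longrightarrow> y \<in> A \<Longrightarrow> x - y \<in> A"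
    and A_minus: "x \<in> A \<Longrightarrow> - x \<in> A"
    and A_1: "1 \<in> A"
  by (auto simp: ring_of_integers_def
      intro: K_intros algebraic_int_add algebraic_int_mult algebraic_int_diff)

lemma int_adjoin_subset:
  assumes "\<theta> \<in> A"
  shows "int_adjoin \<theta> \<subseteq> A"
proof
  fix x assume "x \<in> int_adjoin \<theta>"
  then show "x \<in> A"
    by (induction rule: int_adjoin_induct) (auto intro: A_closed assms)
qed

lemma subgroup_pair: "\<theta> \<in> A \<Longrightarrow> additive_subgroup_pair A (int_adjoin \<theta>)"
  by unfold_locales (auto intro: int_adjoin_0 int_adjoin_diff A_diff dest: int_adjoin_subset)

lemma ring_of_integers_lat:
  obtains w e f where "A = lat w e f"
  using m_cases ring_of_integers_odd ring_of_integers_2_mod_4 ring_of_integers_4_mod_8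
    ring_of_integers_8 by metis

text \<open>As N A is contained in Z[theta], the lattice elements with coordinates reduced modulo N
  represent all cosets.\<close>

lemma finite_index:
  assumes \<theta>: "\<theta> \<in> A" and N: "N > 0" "\<And>x. x \<in> A \<Longrightarrow> of_nat N * x \<in> int_adjoin \<theta>"
  shows "finite (a_rcosets\<^bsub>complex_ring\<lparr>carrier := A\<rparr>\<^esub> (int_adjoin \<theta>))"
    "element_index K \<theta> \<noteq> 0"
proof -
  interpret additive_subgroup_pair A "int_adjoin \<theta>" by (rule subgroup_pair[OF \<theta>])
  obtain w e f where R: "A = lat w e f" by (rule ring_of_integers_lat)
  define r where "r = (\<lambda>(i, j, k, l). of_int i + of_int j * w + of_int k * e + of_int l * f :: complex)"
  define I where "I = {0..<int N}"
  define F where "F = r ` (I \<times> I \<times> I \<times> I)"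
  have 1: "finite F" by (simp add: F_def I_def)
  have 2: "F \<subseteq> A" unfolding R by (auto simp: F_def r_def) (rule latI, rule refl)
  have 3: "\<exists>y\<in>F. x - y \<in> int_adjoin \<theta>" if xA: "x \<in> A" for x
  proof -
    from xA obtain a b c d where x: "x = of_int a + of_int b * w + of_int c * e + of_int d * f"
      unfolding R by (rule latE)
    let ?M = "\<lambda>a. a mod int N" and ?D = "\<lambda>a. a div int N"
    let ?z = "of_int (?D a) + of_int (?D b) * w + of_int (?D c) * e + of_int (?D d) * f"
    have div: "(of_int k :: complex) = of_int (?M k) + of_nat N * of_int (?D k)" for k
    proof -
      have "(of_int k :: complex) = of_int (?M k + int N * ?D k)" by simp
      then show ?thesis by (simp only: of_int_add of_int_mult of_int_of_nat_eq)
    qed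
    have "x = r (?M a, ?M b, ?M c, ?M d) + of_nat N * ?z"
      unfolding x r_def prod.case div[of a] div[of b] div[of c] div[of d]
      by (simp only: distrib_left distrib_right mult.assoc add_ac)
    then have "x - r (?M a, ?M b, ?M c, ?M d) = of_nat N * ?z" by simp
    moreover have "of_nat N * ?z \<in> int_adjoin \<theta>"
      by (rule N(2)) (unfold R, rule latI, rule refl)
    moreover have "r (?M a, ?M b, ?M c, ?M d) \<in> F"
      using N(1) by (auto simp: F_def I_def)
    ultimately show ?thesis by metis
  qed
  show "finite cosets" by (rule finite_cosets(1)[OF 1 2 3])
  show "element_index K \<theta> \<noteq> 0" unfolding element_index_def by (rule finite_cosets(3)[OF 1 2 3])
qed

lemma prime_dvd_index:
  assumes \<theta>: "\<theta> \<in> A" and N: "N > 0" "\<And>x. x \<in> A \<Longrightarrow> of_nat N * x \<in> int_adjoin \<theta>"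
    and p: "prime p" "p dvd element_index K \<theta>"
  shows "p dvd N"
proof -
  interpret additive_subgroup_pair A "int_adjoin \<theta>" by (rule subgroup_pair[OF \<theta>])
  show ?thesis
    using prime_dvd_exponent[OF finite_index(1)[OF \<theta> N] p(1) _ N(2)] p(2)
    by (simp add: element_index_def)
qed

section \<open>The index of \<alpha>, and elements of odd index for even m\<close>

lemma \<alpha>_in_A: "\<alpha> \<in> A"
  using \<alpha>_in_K \<alpha>_algebraic_int by (simp add: ring_of_integers_def)

lemma \<alpha>_primitive: "\<alpha> \<in> primitive_integers K"
  using \<alpha>_in_A rat_adjoin_\<alpha> by (simp add: primitive_integers_def)

text \<open>The constant coefficient 1 of the quartic makes \<alpha> a unit of Z[\<alpha>], which
  therefore contains t and g; the definition of h costs a factor 4.\<close>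

lemma int_adjoin_\<alpha>:
  shows t_in: "t \<in> int_adjoin \<alpha>" and s_in: "s \<in> int_adjoin \<alpha>" and g_in: "g \<in> int_adjoin \<alpha>"
    and h4_in: "4 * h \<in> int_adjoin \<alpha>"
proof -
  have "\<alpha> * (- (\<alpha> ^ 3 - cm * \<alpha>\<^sup>2 - 6 * \<alpha> + cm)) = 1 - (\<alpha> ^ 4 - cm * \<alpha> ^ 3 - 6 * \<alpha>\<^sup>2 + cm * \<alpha> + 1)"
    by (simp add: algebra_simps power2_eq_square power3_eq_cube power4_eq_xxxx)
  then have "inverse \<alpha> = - (\<alpha> ^ 3 - cm * \<alpha>\<^sup>2 - 6 * \<alpha> + cm)"
    unfolding \<alpha>_eq by (intro inverse_unique) simp
  then have inv: "inverse \<alpha> \<in> int_adjoin \<alpha>"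
    unfolding cm_def by (simp only:) (intro int_adjoin_intros)
  show t: "t \<in> int_adjoin \<alpha>" unfolding t_def by (intro int_adjoin_intros inv)
  show s: "s \<in> int_adjoin \<alpha>" unfolding s_def cm_def by (intro int_adjoin_intros t)
  show g: "g \<in> int_adjoin \<alpha>" unfolding g_def by (intro int_adjoin_intros inv)
  have "4 * h = (s - of_int m) * g" by (simp add: h_def cm_def)
  then show "4 * h \<in> int_adjoin \<alpha>" by (simp only:) (intro int_adjoin_intros s g)
qed

lemma index_\<alpha>_prime:
  assumes "prime p" "p dvd element_index K \<alpha>"
  shows "p = 2"
proof -
  \<comment> \<open>64 is 16 times 4: 16 A lies in the span of 1, s, g, h, and 4 h lies in
    Z[\<alpha>].\<close>
  have "of_nat 64 * x \<in> int_adjoin \<alpha>" if xA: "x \<in> A" for x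
  proof -
    obtain a b c d where "16 * x = of_int a + of_int b * s + of_int c * g + of_int d * h"
      using sixteen_integral[OF xA] by (rule latE)
    then have "4 * (16 * x) = 4 * (of_int a + of_int b * s + of_int c * g) + of_int d * (4 * h)"
      by (simp only: distrib_left mult.left_commute)
    moreover have "of_nat 64 * x = 4 * (16 * x)" by simp
    moreover have "4 * (of_int a + of_int b * s + of_int c * g) + of_int d * (4 * h) \<in> int_adjoin \<alpha>"
      by (intro int_adjoin_intros s_in g_in h4_in)
    ultimately show ?thesis by (simp only:)
  qed
  then have "p dvd 64" using prime_dvd_index[OF \<alpha>_in_A _ _ assms, of 64] by simp
  then have "p dvd 2 ^ 6" by simp
  then have "p dvd 2" using assms(1) prime_dvd_power by blast
  then show ?thesis using assms(1) primes_dvd_imp_eq two_is_prime_nat by blast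
qed

text \<open>A prime dividing all indices is 2 because of \<alpha>, and divides the odd number N
  because N A lies in Z[theta].\<close>

lemma field_index_eq_1:
  assumes \<theta>: "\<theta> \<in> primitive_integers K" and N: "odd N" "\<And>x. x \<in> A \<Longrightarrow> of_nat N * x \<in> int_adjoin \<theta>"
  shows "field_index K = 1"
proof (rule ccontr)
  have \<theta>A: "\<theta> \<in> A" using \<theta> by (simp add: primitive_integers_def)
  have N0: "N > 0" using N(1) by (auto intro: Nat.gr0I)
  assume "field_index K \<noteq> 1"
  then obtain p where p: "prime p" "p dvd field_index K" using prime_factor_nat by blast
  have "p dvd element_index K \<alpha>" "p dvd element_index K \<theta>"
    using p(2) \<alpha>_primitive \<theta> unfolding field_index_def by (auto intro: dvd_trans Gcd_dvd)
  then have "p = 2" "p dvd N"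
    using index_\<alpha>_prime[OF p(1)] prime_dvd_index[OF \<theta>A N0 N(2) p(1)] by auto
  with N(1) show False by simp
qed

lemma scale_lat:
  assumes "k * w \<in> int_adjoin \<theta>" "k * e \<in> int_adjoin \<theta>" "k * f \<in> int_adjoin \<theta>" "k \<in> int_adjoin \<theta>"
    and "x \<in> lat w e f"
  shows "k * x \<in> int_adjoin \<theta>"
proof -
  obtain a b c d where "x = of_int a + of_int b * w + of_int c * e + of_int d * f"
    using assms(5) by (rule latE)
  then have "k * x = of_int a * k + of_int b * (k * w) + of_int c * (k * e) + of_int d * (k * f)"
    by (simp only: distrib_left mult.left_commute mult.commute[of k "of_int a"])
  then show ?thesis by (simp only:) (intro int_adjoin_intros assms)
qed

text \<open>The element is \<open>e2\<close>: its square provides n \<open>w2\<close> with n = m / 2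
  odd, and the product of \<open>w2\<close> and \<open>e2\<close> provides \<open>f2\<close>, so n A
  lies in Z[\<open>e2\<close>].\<close>

lemma field_index_2_mod_4:
  assumes m: "m = 2 * (2 * l + 1)"
  shows "field_index K = 1"
proof -
  define n where "n = 2 * l + 1"
  have n: "n > 0" "odd n" using m m_pos by (auto simp: n_def)
  define r :: rat where "r = of_int l"
  have rm: "rm = 2 * (2 * r + 1)" unfolding rm_def r_def using m by simp
  note els = w2_def e2_def f2_def
  have ee: "e2 * e2 = of_int (l * (2 * l + 1) + 2) + of_int n * w2"
    unfolding els of_int_scale of_int_el[of "l * (2 * l + 1) + 2"] el_mult el_add el_eq_iff n_def
    by (simp add: r_def rM_def rm expand_simps)
  have we: "w2 * e2 = of_int (l + 1) * e2 + f2"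
    unfolding els of_int_scale el_mult el_add el_eq_iff
    by (simp add: r_def rM_def rm expand_simps)
  let ?H = "int_adjoin e2"
  have "of_int n * w2 = e2 * e2 - of_int (l * (2 * l + 1) + 2)" unfolding ee by simp
  then have w: "of_int n * w2 \<in> ?H" by (simp only:) (intro int_adjoin_intros)
  have e: "of_int n * e2 \<in> ?H" by (intro int_adjoin_intros)
  have "f2 = w2 * e2 - of_int (l + 1) * e2" unfolding we by simp
  then have "of_int n * f2 = (of_int n * w2) * e2 - of_int (l + 1) * (of_int n * e2)"
    by (simp only: right_diff_distrib mult.assoc mult.left_commute)
  then have f: "of_int n * f2 \<in> ?H" by (simp only:) (intro int_adjoin_intros w)
  have R: "A = lat w2 e2 f2" by (rule ring_of_integers_2_mod_4[OF m])
  show ?thesis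
  proof (rule field_index_eq_1)
    have "e2 \<in> A" unfolding R by (rule lat_basis)
    then show "e2 \<in> primitive_integers K"
      unfolding e2_def primitive_integers_iff by (simp add: ring_of_integers_def)
    show "odd (nat n)" using n by (simp add: even_nat_iff)
    fix x assume "x \<in> A"
    then have "of_int n * x \<in> ?H" unfolding R by (rule scale_lat[OF w e f int_adjoin_of_int])
    then show "of_nat (nat n) * x \<in> ?H" using n by simp
  qed
qed

text \<open>The element is \<open>e4\<close>: its square provides \<open>w4\<close>, and the product
  of \<open>w4\<close> and \<open>e4\<close> provides n \<open>f4\<close> with n = m / 4
  odd.\<close>

lemma field_index_4_mod_8:
  assumes m: "m = 4 * n" and "odd n"
  shows "field_index K = 1"
proof -
  have n: "n > 0" using m m_pos by auto
  define r :: rat where "r = of_int n"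
  have rm: "rm = 4 * r" unfolding rm_def r_def using m by simp
  note els = w4_def e4_def f4_def
  have ee: "e4 * e4 = of_int (n\<^sup>2 + 1) + of_int 1 * w4"
    unfolding els of_int_scale of_int_el[of "n\<^sup>2 + 1"] el_mult el_add el_eq_iff
    by (simp add: r_def rM_def rm expand_simps)
  have we: "w4 * e4 = e4 + of_int n * f4"
    unfolding els of_int_scale el_mult el_add el_eq_iff
    by (simp add: r_def rM_def rm expand_simps)
  let ?H = "int_adjoin e4"
  have "w4 = e4 * e4 - of_int (n\<^sup>2 + 1)" unfolding ee by simp
  then have w: "w4 \<in> ?H" by (simp only:) (intro int_adjoin_intros)
  have "of_int n * f4 = w4 * e4 - e4" unfolding we by simp
  then have f: "of_int n * f4 \<in> ?H" by (simp only:) (intro int_adjoin_intros w)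
  have R: "A = lat w4 e4 f4" by (rule ring_of_integers_4_mod_8[OF assms])
  show ?thesis
  proof (rule field_index_eq_1)
    have "e4 \<in> A" unfolding R by (rule lat_basis)
    then show "e4 \<in> primitive_integers K"
      unfolding e4_def primitive_integers_iff by (simp add: ring_of_integers_def)
    show "odd (nat n)" using n \<open>odd n\<close> by (simp add: even_nat_iff)
    fix x assume "x \<in> A"
    then have "of_int n * x \<in> ?H"
      unfolding R by (rule scale_lat[rotated 4]) (intro int_adjoin_intros w f)+
    then show "of_nat (nat n) * x \<in> ?H" using n by simp
  qed
qed

text \<open>If \<open>F(\<theta>) = 0\<close> for a monic integral quartic \<open>F\<close> and \<open>z = 2\<theta>\<close>, then \<open>G(z) = 0\<close> for
  \<open>G(x) = 16 F(x/2)\<close>, so \<open>2\<theta> - j\<close> divides \<open>G(j)\<close> in \<open>\<int>[\<theta>]\<close>, and \<open>G(j) \<equiv> j\<^sup>4\<close> is odd.\<close>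

lemma odd_multiple:
  assumes \<theta>: "\<theta> \<in> primitive_integers K" and j: "odd j"
  obtains N y where "odd N" "N > 0" "y \<in> int_adjoin \<theta>" "of_int N = (2 * \<theta> - of_int j) * y"
proof -
  obtain a b c d where el: "\<theta> = el a b c d" "algebraic_int (el a b c d)" "c \<noteq> 0 \<or> d \<noteq> 0"
    using \<theta> by (rule primitive_integers_E)
  define F where "F = int_field_char_poly K \<theta>"
  note F = int_field_char_poly(2-4)[OF el(2,3), folded el(1), folded F_def]
  define c0 c1 c2 c3 where "c0 = coeff F 0" and "c1 = coeff F 1" and "c2 = coeff F 2" and "c3 = coeff F 3"
  have "0 = (\<Sum>i\<le>4. of_int (coeff F i) * \<theta> ^ i)"
    using F(1) by (simp add: poly_altdef F(2) coeff_map_poly)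
  also have "\<dots> = of_int c0 + of_int c1 * \<theta> + of_int c2 * \<theta>\<^sup>2 + of_int c3 * \<theta> ^ 3 + \<theta> ^ 4"
    using F(2,3) by (simp add: eval_nat_numeral c0_def c1_def c2_def c3_def add.assoc)
  finally have root: "of_int c0 + of_int c1 * \<theta> + of_int c2 * \<theta>\<^sup>2 + of_int c3 * \<theta> ^ 3 + \<theta> ^ 4 = 0" ..
  define k :: int where "k = j ^ 4 + 2 * c3 * j ^ 3 + 4 * c2 * j\<^sup>2 + 8 * c1 * j + 16 * c0"
  define y where "y = - ((2 * \<theta>) ^ 3 + (2 * \<theta>)\<^sup>2 * of_int j + (2 * \<theta>) * (of_int j)\<^sup>2 + (of_int j) ^ 3
    + 2 * of_int c3 * ((2 * \<theta>)\<^sup>2 + (2 * \<theta>) * of_int j + (of_int j)\<^sup>2)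
    + 4 * of_int c2 * (2 * \<theta> + of_int j) + 8 * of_int c1)"
  have gen: "(j' ^ 4 + 2 * d3 * j' ^ 3 + 4 * d2 * j'\<^sup>2 + 8 * d1 * j' + 16 * d0)
    - (2 * x - j') * (- ((2 * x) ^ 3 + (2 * x)\<^sup>2 * j' + (2 * x) * j'\<^sup>2 + j' ^ 3
    + 2 * d3 * ((2 * x)\<^sup>2 + (2 * x) * j' + j'\<^sup>2) + 4 * d2 * (2 * x + j') + 8 * d1))
    = 16 * (d0 + d1 * x + d2 * x\<^sup>2 + d3 * x ^ 3 + x ^ 4)" for j' d0 d1 d2 d3 x :: complex
    by (simp add: algebra_simps power2_eq_square power3_eq_cube power4_eq_xxxx)
  have "of_int k - (2 * \<theta> - of_int j) * y = 0"
    using gen[of "of_int j" "of_int c3" "of_int c2" "of_int c1" "of_int c0" \<theta>]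
    unfolding root k_def y_def by simp
  then have eq: "of_int k = (2 * \<theta> - of_int j) * y" by simp
  have k: "odd k" using j by (simp add: k_def)
  have y: "y \<in> int_adjoin \<theta>" unfolding y_def by (intro int_adjoin_intros)
  show ?thesis
  proof (cases "k > 0")
    case True
    then show ?thesis using that k y eq by blast
  next
    case False
    have "k \<noteq> 0" using k by auto
    with False have "- k > 0" by simp
    moreover have "of_int (- k) = (2 * \<theta> - of_int j) * (- y)" using eq by simp
    ultimately show ?thesis using that[of "- k" "- y"] k int_adjoin_minus[OF y] by simp
  qed
qed

text \<open>theta is the sum of \<open>w8\<close>, which generates the residues at 2, and u = g / 2,
  whose square is 2 times a number prime to 2. Substituting u = theta - w8 into theta^2 leaves an
  equation linear in w8 with coefficient 2 theta - (1 - 8 l), and by \<open>odd_multiple\<close>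
  this coefficient divides an odd integer in Z[theta].\<close>

lemma field_index_8:
  assumes m: "m = 8 * l"
  shows "field_index K = 1"
proof -
  define r :: rat where "r = of_int l"
  have rm: "rm = 8 * r" unfolding rm_def r_def using m by simp
  define L where "L = (of_int l :: complex)"
  note els = w8_def e4_def f4_def
  define u where "u = e4 + f4"
  define \<theta> where "\<theta> = w8 + u"
  have u_el: "u = el 0 0 (1 / 2) 0" unfolding u_def els el_add by simp
  have "w8 * w8 = of_int 1 * w8 + of_int (l * l)"
    unfolding els of_int_scale of_int_el[of "l * l"] el_mult el_add el_eq_iff
    by (simp add: r_def rM_def rm expand_simps)
  then have ww: "w8 * w8 = w8 + L * L" by (simp add: L_def)
  have "u * u = of_int (8 * l * l + 2 - 4 * l) + of_int (8 * l) * w8"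
    unfolding u_el els of_int_scale of_int_el[of "8 * l * l + 2 - 4 * l"] el_mult el_add el_eq_iff
    by (simp add: r_def rM_def rm expand_simps)
  then have uu: "u * u = 8 * L * L + 2 - 4 * L + 8 * L * w8" by (simp add: L_def)
  have "w8 * u = e4 + of_int l * u"
    unfolding u_el els of_int_scale el_mult el_add el_eq_iff
    by (simp add: r_def rM_def rm expand_simps)
  then have wu: "e4 = w8 * u - L * u" by (simp add: L_def)
  have R: "A = lat w8 e4 f4" by (rule ring_of_integers_8[OF m])
  have "\<theta> \<in> A" unfolding R \<theta>_def u_def by (intro lat_intros)
  moreover have "\<theta> = el (1 / 2) (1 / 8) (1 / 2) 0" unfolding \<theta>_def u_el els el_add by simp
  ultimately have prim: "\<theta> \<in> primitive_integers K"
    by (simp add: primitive_integers_iff ring_of_integers_def)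
  have "odd (1 - 8 * l)" by simp
  from odd_multiple[OF prim this] obtain N y where N: "odd N" "N > 0" "y \<in> int_adjoin \<theta>"
    "of_int N = (2 * \<theta> - of_int (1 - 8 * l)) * y" by blast
  let ?H = "int_adjoin \<theta>"
  define N' where "N' = (of_int N :: complex)"
  have N': "N' \<in> ?H" unfolding N'_def by (rule int_adjoin_of_int)
  have L: "L \<in> ?H" unfolding L_def by (rule int_adjoin_of_int)
  have "w8 * (2 * \<theta> - (1 - 8 * L)) = 2 * (w8 * w8) + 2 * (w8 * u) - w8 + 8 * L * w8"
    by (simp add: \<theta>_def algebra_simps)
  also have "\<dots> = w8 * w8 + 2 * (w8 * u) + u * u - 7 * L * L + 4 * L - 2"
    unfolding ww uu by (simp add: algebra_simps)
  also have "\<dots> = \<theta> * \<theta> - 7 * L * L + 4 * L - 2"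
    by (simp add: \<theta>_def algebra_simps)
  finally have "w8 * (2 * \<theta> - (1 - 8 * L)) * y = (\<theta> * \<theta> - 7 * L * L + 4 * L - 2) * y" by simp
  moreover have "(2 * \<theta> - (1 - 8 * L)) * y = N'" unfolding N'_def N(4) L_def by simp
  ultimately have "w8 * N' = (\<theta> * \<theta> - 7 * L * L + 4 * L - 2) * y" by (simp only: mult.assoc)
  then have w: "w8 * N' \<in> ?H" by (simp only:) (intro int_adjoin_intros L N(3))
  have "u * N' = \<theta> * N' - w8 * N'" by (simp add: \<theta>_def algebra_simps)
  then have u: "u * N' \<in> ?H" by (simp only:) (intro int_adjoin_intros w N')
  have w2: "(N' * N') * w8 \<in> ?H" using int_adjoin_mult[OF N' w] by (simp add: mult_ac)
  \<comment> \<open>\<open>e4\<close> involves the product of \<open>w8\<close> and u, each of which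
    needs the factor N, hence the square of N.\<close>
  have "(N' * N') * e4 = (w8 * N') * (u * N') - L * N' * (u * N')"
    unfolding wu by (simp add: algebra_simps)
  then have e2: "(N' * N') * e4 \<in> ?H" by (simp only:) (intro int_adjoin_intros w u L N')
  have "(N' * N') * f4 = N' * (u * N') - (N' * N') * e4"
    by (simp add: u_def algebra_simps)
  then have f2: "(N' * N') * f4 \<in> ?H" by (simp only:) (intro int_adjoin_intros u N' e2)
  show ?thesis
  proof (rule field_index_eq_1[OF prim])
    show "odd (nat (N * N))" using N by (simp add: even_nat_iff)
    fix x assume "x \<in> A"
    then have "(N' * N') * x \<in> ?H"
      unfolding R by (rule scale_lat[OF w2 e2 f2 int_adjoin_mult[OF N' N']])
    then show "of_nat (nat (N * N)) * x \<in> ?H" using N(2) by (simp add: N'_def)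
  qed
qed

end

section \<open>Odd m: every index is even\<close>

lemma table_mult_odd:
  fixes m t e f a b c d a' b' c' d' :: complex
  assumes tt: "t * t = m * t + 4" and te: "t * e = 2 - m + t + m * e + 2 * f"
    and tf: "t * f = - 2 - t + 2 * e" and ee: "e * e = 3 - m + t + m * e + 2 * f"
    and ff: "f * f = 3 + t - 2 * e + m * f" and ef: "e * f = - 1 + e - f"
  shows "(a + b * t + c * e + d * f) * (a' + b' * t + c' * e + d' * f) =
    (a * a' + 4 * b * b' + (2 - m) * (b * c' + c * b') - 2 * (b * d' + d * b')
      + (3 - m) * c * c' + 3 * d * d' - (c * d' + d * c'))
    + (a * b' + b * a' + m * b * b' + (b * c' + c * b') - (b * d' + d * b') + c * c' + d * d') * t
    + (a * c' + c * a' + m * (b * c' + c * b') + 2 * (b * d' + d * b') + m * c * c' - 2 * d * d'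
      + (c * d' + d * c')) * e
    + (a * d' + d * a' + 2 * (b * c' + c * b') + 2 * c * c' + m * d * d' - (c * d' + d * c')) * f"
proof -
  have "(a + b * t + c * e + d * f) * (a' + b' * t + c' * e + d' * f) =
    a * a' + (a * b' + b * a') * t + (a * c' + c * a') * e + (a * d' + d * a') * f
    + b * b' * (t * t) + (b * c' + c * b') * (t * e) + (b * d' + d * b') * (t * f)
    + c * c' * (e * e) + d * d' * (f * f) + (c * d' + d * c') * (e * f)"
    by (simp add: algebra_simps)
  then show ?thesis
    unfolding assms by (simp add: algebra_simps)
qed

context simplest_quartic
begin

lemma table_odd:
  shows "t * t = cm * t + 4" "t * e1 = 2 - cm + t + cm * e1 + 2 * \<beta>"
    "t * \<beta> = - 2 - t + 2 * e1" "e1 * e1 = 3 - cm + t + cm * e1 + 2 * \<beta>"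
    "\<beta> * \<beta> = 3 + t - 2 * e1 + cm * \<beta>" "e1 * \<beta> = - 1 + e1 - \<beta>"
proof -
  note els = t_el e1_def \<beta>_def
  show "t * t = cm * t + 4" by (rule table(1))
  have "t * e1 = of_int (2 - m) + of_int 1 * t + of_int m * e1 + of_int 2 * \<beta>"
    unfolding els lat_el el_mult el_eq_iff
    by (simp add: rM_def expand_simps flip: rm_def)
  then show "t * e1 = 2 - cm + t + cm * e1 + 2 * \<beta>" by (simp add: cm_def)
  have "t * \<beta> = of_int (- 2) + of_int (- 1) * t + of_int 2 * e1 + of_int 0 * \<beta>"
    unfolding els lat_el el_mult el_eq_iff
    by (simp add: rM_def expand_simps flip: rm_def)
  then show "t * \<beta> = - 2 - t + 2 * e1" by simp
  have "e1 * e1 = of_int (3 - m) + of_int 1 * t + of_int m * e1 + of_int 2 * \<beta>"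
    unfolding els lat_el el_mult el_eq_iff
    by (simp add: rM_def expand_simps flip: rm_def)
  then show "e1 * e1 = 3 - cm + t + cm * e1 + 2 * \<beta>" by (simp add: cm_def)
  have "\<beta> * \<beta> = of_int 3 + of_int 1 * t + of_int (- 2) * e1 + of_int m * \<beta>"
    unfolding els lat_el el_mult el_eq_iff
    by (simp add: rM_def expand_simps flip: rm_def)
  then show "\<beta> * \<beta> = 3 + t - 2 * e1 + cm * \<beta>" by (simp add: cm_def)
  have "e1 * \<beta> = of_int (- 1) + of_int 0 * t + of_int 1 * e1 + of_int (- 1) * \<beta>"
    unfolding els lat_el el_mult el_eq_iff
    by (simp add: rM_def expand_simps flip: rm_def)
  then show "e1 * \<beta> = - 1 + e1 - \<beta>" by simp
qed

lemma lat_mult_odd: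
  "(of_int a + of_int b * t + of_int c * e1 + of_int d * \<beta>)
    * (of_int a' + of_int b' * t + of_int c' * e1 + of_int d' * \<beta>) =
    of_int (a * a' + 4 * b * b' + (2 - m) * (b * c' + c * b') - 2 * (b * d' + d * b')
      + (3 - m) * c * c' + 3 * d * d' - (c * d' + d * c'))
    + of_int (a * b' + b * a' + m * b * b' + (b * c' + c * b') - (b * d' + d * b') + c * c' + d * d') * t
    + of_int (a * c' + c * a' + m * (b * c' + c * b') + 2 * (b * d' + d * b') + m * c * c' - 2 * d * d'
      + (c * d' + d * c')) * e1
    + of_int (a * d' + d * a' + 2 * (b * c' + c * b') + 2 * c * c' + m * d * d' - (c * d' + d * c')) * \<beta>"
  unfolding table_mult_odd[OF table_odd] cm_def
  by (simp only: of_int_add of_int_diff of_int_mult of_int_numeral)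

lemma int_adjoin_poly:
  assumes \<theta>: "\<theta> \<in> primitive_integers K" and x: "x \<in> int_adjoin \<theta>"
  obtains q :: "int poly" where "degree q < 4" "x = poly (map_poly of_int q) \<theta>"
proof -
  obtain a b c d where el: "\<theta> = el a b c d" "algebraic_int (el a b c d)" "c \<noteq> 0 \<or> d \<noteq> 0"
    using \<theta> by (rule primitive_integers_E)
  define F where "F = int_field_char_poly K \<theta>"
  note F = int_field_char_poly(2-4)[OF el(2,3), folded el(1), folded F_def]
  let ?ev = "\<lambda>p. poly (map_poly of_int p) \<theta>"
  have "\<exists>p. x = ?ev p"
    using x
  proof (induction rule: int_adjoin_induct)
    case one
    show ?case by (rule exI[of _ 1]) simp
  next
    case self
    show ?case by (rule exI[of _ "[:0, 1:]"]) (simp add: of_int_hom.map_poly_pCons_hom)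
  next
    case (minus x)
    then obtain p where "x = ?ev p" by blast
    then show ?case by (intro exI[of _ "- p"]) (simp add: of_int_poly_hom.hom_uminus)
  next
    case (add x y)
    then obtain p q where "x = ?ev p" "y = ?ev q" by blast
    then show ?case by (intro exI[of _ "p + q"]) (simp add: of_int_poly_hom.hom_add)
  next
    case (mult x y)
    then obtain p q where "x = ?ev p" "y = ?ev q" by blast
    then show ?case by (intro exI[of _ "p * q"]) (simp add: of_int_poly_hom.hom_mult)
  qed
  then obtain p where p: "x = ?ev p" by blast
  have "\<exists>q. degree q < 4 \<and> ?ev p = ?ev q"
  proof (induction p)
    case 0
    show ?case by (rule exI[of _ 0]) simp
  next
    case (pCons k p)
    then obtain q where q: "degree q < 4" "?ev p = ?ev q" by blast
    \<comment> \<open>Multiplying q by x creates at most a term of degree 4, with coefficient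
      \<open>coeff q 3\<close>; the monic F removes it without leaving the integers.\<close>
    define r where "r = pCons k q - smult (coeff q 3) F"
    have "degree r < 4"
    proof (rule degree_lessI)
      show "\<forall>i\<ge>4. coeff r i = 0"
      proof (intro allI impI)
        fix i :: nat assume i: "4 \<le> i"
        show "coeff r i = 0"
        proof (cases "i = 4")
          case True
          then show ?thesis using F(2,3) by (simp add: r_def coeff_pCons eval_nat_numeral)
        next
          case False
          with i obtain n where n: "i = Suc n" "n \<ge> 4" by (cases i) auto
          then have "coeff q n = 0" "coeff F i = 0" using q(1) F(2) by (auto simp: coeff_eq_0)
          then show ?thesis by (simp add: r_def n)
        qed
      qed
    qed simp
    moreover have "?ev (pCons k p) = ?ev r"
      unfolding r_def of_int_poly_hom.hom_minus of_int_hom.map_poly_pCons_hom of_int_hom.map_poly_hom_smult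
      using q(2) F(1) by simp
    ultimately show ?case by blast
  qed
  then show ?thesis using that p by metis
qed

text \<open>By independence of the powers of theta up to the third, y in Z[theta] would make r twice
  an integer polynomial.\<close>

lemma half_not_in_int_adjoin:
  assumes \<theta>: "\<theta> \<in> primitive_integers K" and r: "degree r < 4" "odd (coeff r i)"
    and y: "2 * y = poly (map_poly of_int r) \<theta>"
  shows "y \<notin> int_adjoin \<theta>"
proof
  assume "y \<in> int_adjoin \<theta>"
  then obtain q where q: "degree q < 4" "y = poly (map_poly of_int q) \<theta>"
    using int_adjoin_poly[OF \<theta>] by blast
  obtain a b c d where el: "\<theta> = el a b c d" "c \<noteq> 0 \<or> d \<noteq> 0"
    using \<theta> by (rule primitive_integers_E)
  define p where "p = smult 2 q - r"
  have deg: "degree p < 4"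
    unfolding p_def using q(1) r(1) degree_smult_le[of 2 q] by (intro degree_diff_less) auto
  have "poly (map_poly of_int p) \<theta> = 0"
    unfolding p_def of_int_poly_hom.hom_minus of_int_hom.map_poly_hom_smult using q(2) y by simp
  moreover have "map_poly of_rat (map_poly rat_of_int p) = (map_poly of_int p :: complex poly)"
    by (simp add: map_poly_map_poly o_def)
  ultimately have "map_poly rat_of_int p = 0"
    using rat_poly_eq_0[OF el(2), of "map_poly rat_of_int p" a b] deg el(1) by simp
  then have "p = 0" by simp
  then have "coeff r i = 2 * coeff q i" by (simp add: p_def flip: coeff_smult)
  with r(2) show False by simp
qed

text \<open>Half of the combination belongs to A by the parities of its coordinates, but not to
  Z[theta], as one of its coefficients is odd. Its class has order 2 in A / Z[theta].\<close>

lemma even_index_if_relation: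
  assumes R: "A = lat t e1 \<beta>" and \<theta>: "\<theta> \<in> primitive_integers K"
    and coords: "\<theta> = of_int a + of_int b * t + of_int c * e1 + of_int d * \<beta>"
      "\<theta>\<^sup>2 = of_int a2 + of_int b2 * t + of_int c2 * e1 + of_int d2 * \<beta>"
      "\<theta> ^ 3 = of_int a3 + of_int b3 * t + of_int c3 * e1 + of_int d3 * \<beta>"
    and ev: "even (k0 + k1 * a + k2 * a2 + k3 * a3)" "even (k1 * b + k2 * b2 + k3 * b3)"
      "even (k1 * c + k2 * c2 + k3 * c3)" "even (k1 * d + k2 * d2 + k3 * d3)"
    and odd: "odd k1 \<or> odd k2 \<or> odd k3"
  shows "even (element_index K \<theta>)"
proof -
  have \<theta>A: "\<theta> \<in> A" using \<theta> by (simp add: primitive_integers_def)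
  interpret additive_subgroup_pair A "int_adjoin \<theta>" by (rule subgroup_pair[OF \<theta>A])
  define r where "r = [:k0, k1, k2, k3:]"
  define y where "y = poly (map_poly of_int r) \<theta> / 2"
  have y2: "2 * y = poly (map_poly of_int r) \<theta>" by (simp add: y_def)
  also have "\<dots> = of_int k0 + of_int k1 * \<theta> + of_int k2 * \<theta>\<^sup>2 + of_int k3 * \<theta> ^ 3"
    by (simp add: r_def of_int_hom.map_poly_pCons_hom algebra_simps power2_eq_square power3_eq_cube)
  also have "\<dots> = of_int (k0 + k1 * a + k2 * a2 + k3 * a3) + of_int (k1 * b + k2 * b2 + k3 * b3) * t
      + of_int (k1 * c + k2 * c2 + k3 * c3) * e1 + of_int (k1 * d + k2 * d2 + k3 * d3) * \<beta>"
    unfolding coords(2,3) unfolding coords(1)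
    by (simp only: of_int_add of_int_mult distrib_left distrib_right mult.assoc add_ac)
  finally have y: "y \<in> A" unfolding R by (rule two_lat_evenE) (use ev in simp_all)
  have "degree r < 4" by (simp add: r_def)
  moreover have "odd (coeff r 1) \<or> odd (coeff r 2) \<or> odd (coeff r 3)"
    using odd by (simp add: r_def eval_nat_numeral)
  ultimately have "y \<notin> int_adjoin \<theta>"
    using half_not_in_int_adjoin[OF \<theta> _ _ y2] by blast
  moreover have "of_nat 2 * y \<in> int_adjoin \<theta>"
  proof -
    have "of_nat 2 * y = of_int k0 + \<theta> * (of_int k1 + \<theta> * (of_int k2 + \<theta> * of_int k3))"
      using y2 by (simp add: r_def of_int_hom.map_poly_pCons_hom)
    then show ?thesis by (simp only:) (intro int_adjoin_intros)
  qed
  ultimately show ?thesis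
    unfolding element_index_def by (intro prime_dvd_card_cosets[OF two_is_prime_nat y])
qed

text \<open>For odd \<open>m\<close> the ring \<open>A / 2A\<close> is a product of two fields with 4 elements, so every
  \<open>\<theta>\<close> is a root modulo 2 of one of \<open>x\<^sup>2 + x\<close>, \<open>x\<^sup>2 + x + 1\<close>, \<open>x (x\<^sup>2 + x + 1)\<close> and
  \<open>(x + 1) (x\<^sup>2 + x + 1)\<close>.\<close>

lemma even_index:
  assumes "odd m" and \<theta>: "\<theta> \<in> primitive_integers K"
  shows "even (element_index K \<theta>)"
proof -
  note R = ring_of_integers_odd[OF assms(1)]
  obtain a b c d where c1: "\<theta> = of_int a + of_int b * t + of_int c * e1 + of_int d * \<beta>"
    using primitive_in_lat[OF R \<theta>] .
  define X0 where "X0 = (\<lambda>a' b' c' d'. a * a' + 4 * b * b' + (2 - m) * (b * c' + c * b')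
      - 2 * (b * d' + d * b') + (3 - m) * c * c' + 3 * d * d' - (c * d' + d * c'))"
  define X1 where "X1 = (\<lambda>a' b' c' d'. a * b' + b * a' + m * b * b' + (b * c' + c * b')
      - (b * d' + d * b') + c * c' + d * d')"
  define X2 where "X2 = (\<lambda>a' b' c' d'. a * c' + c * a' + m * (b * c' + c * b')
      + 2 * (b * d' + d * b') + m * c * c' - 2 * d * d' + (c * d' + d * c'))"
  define X3 where "X3 = (\<lambda>a' b' c' d'. a * d' + d * a' + 2 * (b * c' + c * b') + 2 * c * c'
      + m * d * d' - (c * d' + d * c'))"
  have mult: "\<theta> * (of_int a' + of_int b' * t + of_int c' * e1 + of_int d' * \<beta>) =
      of_int (X0 a' b' c' d') + of_int (X1 a' b' c' d') * t + of_int (X2 a' b' c' d') * e1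
      + of_int (X3 a' b' c' d') * \<beta>" for a' b' c' d'
    unfolding c1 X0_def X1_def X2_def X3_def by (rule lat_mult_odd)
  define a2 b2 c2 d2 where "a2 = X0 a b c d" and "b2 = X1 a b c d" and "c2 = X2 a b c d" and "d2 = X3 a b c d"
  define a3 b3 c3 d3 where "a3 = X0 a2 b2 c2 d2" and "b3 = X1 a2 b2 c2 d2"
    and "c3 = X2 a2 b2 c2 d2" and "d3 = X3 a2 b2 c2 d2"
  have c2: "\<theta>\<^sup>2 = of_int a2 + of_int b2 * t + of_int c2 * e1 + of_int d2 * \<beta>"
    using mult[of a b c d, folded c1] by (simp add: power2_eq_square a2_def b2_def c2_def d2_def)
  have "\<theta> ^ 3 = \<theta> * \<theta>\<^sup>2" by (simp add: power3_eq_cube power2_eq_square)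
  then have c3: "\<theta> ^ 3 = of_int a3 + of_int b3 * t + of_int c3 * e1 + of_int d3 * \<beta>"
    unfolding c2 mult a3_def b3_def c3_def d3_def .
  note rel = even_index_if_relation[OF R \<theta> c1 c2 c3]
  have par2: "even a2 \<longleftrightarrow> (even a \<longleftrightarrow> even d)" "even b2 \<longleftrightarrow> (even b \<longleftrightarrow> (even c \<longleftrightarrow> even d))"
    "even c2 \<longleftrightarrow> even c" "even d2 \<longleftrightarrow> even d"
    using assms(1) by (auto simp: a2_def b2_def c2_def d2_def X0_def X1_def X2_def X3_def)
  have par3: "even a3 \<longleftrightarrow> even (a * a2 + b * c2 + c * b2 + d * d2 + c * d2 + d * c2)"
    "even b3 \<longleftrightarrow> even (a * b2 + b * a2 + b * b2 + b * c2 + c * b2 + b * d2 + d * b2 + c * c2 + d * d2)"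
    "even c3 \<longleftrightarrow> even (a * c2 + c * a2 + b * c2 + c * b2 + c * c2 + c * d2 + d * c2)"
    "even d3 \<longleftrightarrow> even (a * d2 + d * a2 + d * d2 + c * d2 + d * c2)"
    using assms(1) by (simp_all add: a3_def b3_def c3_def d3_def X0_def X1_def X2_def X3_def) argo+
  \<comment> \<open>At the prime over 2 where t = 0, \<open>e1\<close> is 1 and
    \<open>\<beta>\<close> generates the residue field; where t = 1 the roles are exchanged. So
    theta is in the prime field at the first iff d is even, with value a + c, and at the second iff
    c is even, with value a + b + d; this selects the polynomial.\<close>
  consider "even c" "even d" | "odd c" "odd d" | "odd c" "even d" "even a" | "odd c" "even d" "odd a"
    | "even c" "odd d" "odd (a + b)" | "even c" "odd d" "even (a + b)"
    by blast
  then show ?thesis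
  proof cases
    case 1
    then show ?thesis by (intro rel[of 0 1 1 0]) (auto simp: par2)
  next
    case 2
    then show ?thesis by (intro rel[of 1 1 1 0]) (auto simp: par2)
  next
    case 3
    then show ?thesis by (intro rel[of 1 0 0 1]) (auto simp: par3 par2)
  next
    case 4
    then show ?thesis by (intro rel[of 0 1 1 1]) (auto simp: par3 par2)
  next
    case 5
    then show ?thesis by (intro rel[of 0 1 1 1]) (auto simp: par3 par2)
  next
    case 6
    then show ?thesis by (intro rel[of 1 0 0 1]) (auto simp: par3 par2)
  qed
qed

text \<open>Z[\<alpha>] contains t, \<alpha> and 2 \<beta>, so 0 and \<beta> represent all cosets;
  evenness then leaves only the index 2.\<close>

lemma field_index_odd:
  assumes "odd m"
  shows "field_index K = 2"
proof -
  interpret additive_subgroup_pair A "int_adjoin \<alpha>" by (rule subgroup_pair[OF \<alpha>_in_A])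
  note R = ring_of_integers_odd[OF assms]
  have e1: "e1 \<in> int_adjoin \<alpha>" unfolding e1_eq by (rule int_adjoin_self)
  have "of_int 2 * \<beta> = t * e1 - (2 - of_int m) - t - of_int m * e1"
    using table_odd(2) by (simp add: cm_def)
  then have \<beta>2: "of_int 2 * \<beta> \<in> int_adjoin \<alpha>" by (simp only:) (intro int_adjoin_intros t_in e1)
  have 1: "finite {0, \<beta>}" by simp
  have 2: "{0, \<beta>} \<subseteq> A" unfolding R by (auto intro: lat_intros)
  have 3: "\<exists>y\<in>{0, \<beta>}. x - y \<in> int_adjoin \<alpha>" if xA: "x \<in> A" for x
  proof -
    obtain a b c d where x: "x = of_int a + of_int b * t + of_int c * e1 + of_int d * \<beta>"
      using xA unfolding R by (rule latE)
    define k where "k = d div 2"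
    have "of_int a + of_int b * t + of_int c * e1 + of_int k * (of_int 2 * \<beta>) \<in> int_adjoin \<alpha>"
      by (intro int_adjoin_intros t_in e1 \<beta>2)
    moreover have "d = 2 * k \<or> d = 2 * k + 1" unfolding k_def by presburger
    then have "x - 0 = of_int a + of_int b * t + of_int c * e1 + of_int k * (of_int 2 * \<beta>) \<or>
      x - \<beta> = of_int a + of_int b * t + of_int c * e1 + of_int k * (of_int 2 * \<beta>)"
      unfolding x by (auto simp: algebra_simps)
    ultimately show ?thesis by fastforce
  qed
  have "card {0, \<beta>} \<le> 2" by (simp add: card_insert_if)
  then have "element_index K \<alpha> \<le> 2" "element_index K \<alpha> \<noteq> 0"
    using finite_cosets(2,3)[OF 1 2 3] unfolding element_index_def by auto
  moreover have "even (element_index K \<alpha>)" by (rule even_index[OF assms \<alpha>_primitive])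
  ultimately have "element_index K \<alpha> = 2" by presburger
  then have "field_index K dvd 2"
    unfolding field_index_def using \<alpha>_primitive by (metis Gcd_dvd image_eqI)
  moreover have "2 dvd field_index K"
    unfolding field_index_def using even_index[OF assms] by (intro Gcd_greatest) auto
  ultimately show ?thesis by (rule dvd_antisym)
qed

end

theorem theorem1p4:
  fixes m :: int and \<alpha> :: complex and K :: "complex set"
  assumes "m > 0" and "m \<noteq> 3"
    and "\<And>k::int. odd k \<Longrightarrow> k > 1 \<Longrightarrow> \<not> k\<^sup>2 dvd m\<^sup>2 + 16"
    and "poly (map_poly of_int (simplest_quartic_poly m)) \<alpha> = 0"
    and "K = rat_adjoin \<alpha>"
  shows "field_index K = (if odd m then 2 else 1)
       \<and> field_value_lcm K = (if 1 \<le> multiplicity 2 m \<and> multiplicity 2 m \<le> 3 then 1 else 4)"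
proof -
  interpret Q: simplest_quartic m \<alpha>
    by unfold_locales (use assms in auto)
  have K: "K = Q.K" using assms(5) Q.rat_adjoin_\<alpha> by simp
  have "m \<noteq> 0" using assms(1) by simp
  then have mult: "k \<le> multiplicity 2 m \<longleftrightarrow> 2 ^ k dvd m" for k
    by (simp add: power_dvd_iff_le_multiplicity)
  have range: "1 \<le> multiplicity 2 m \<and> multiplicity 2 m \<le> 3 \<longleftrightarrow> even m \<and> \<not> 16 dvd m"
    using mult[of 1] mult[of 4] by auto
  show ?thesis
    unfolding K range
  proof (rule Q.m_cases, goal_cases)
    case 1
    then show ?case by (simp add: Q.field_index_odd Q.field_value_lcm_odd)
  next
    case (2 l)
    then have "even m" "\<not> 16 dvd m" by presburger+
    then show ?case
      by (simp add: Q.field_index_2_mod_4[OF 2] Q.field_value_lcm_2_mod_4[OF 2])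
  next
    case (3 n)
    then have "even m" "\<not> 16 dvd m" by presburger+
    then show ?case
      by (simp add: Q.field_index_4_mod_8[OF 3] Q.field_value_lcm_4_mod_8[OF 3])
  next
    case (4 l)
    then have "even m" "16 dvd m \<longleftrightarrow> even l" by presburger+
    then show ?case
      by (simp add: Q.field_index_8[OF 4] Q.field_value_lcm_16[OF 4] Q.field_value_lcm_8_mod_16[OF 4])
  qed
qed

end
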